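(* If $G$ is a connected geometric graph in $\mathbb{R}^2$, then $c(G) \leq 9$.
   Context: Geometric graph: given points $x_1,\dots,x_n\in\mathbb{R}^2$ and $r>0$, the geometric graph $G(x_1,\dots,x_n;r)$ has vertex set $\{x_1,\dots,x_n\}$ (formally indices $1,\dots,n$), with $x_i,x_j$ ($i\neq j$) adjacent iff $\|x_i-x_j\|\le r$ (Euclidean norm). Game of cops and robbers on a finite graph $G$: first $\ell$ cops choose starting vertices, then one robber chooses a starting vertex; then the players alternate turns, where on its turn each agent moves to an adjacent vertex or stays put (all cops move simultaneously on the cops' turn; both sides have full information and the cops may coordinate). The cops win if after finitely many moves some cop occupies the robber's vertex. The cop number $c(G)$ is the minimum $\ell$ such that $\ell$ cops have a strategy that wins against every robber strategy. *)

theory Defs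
  imports "HOL-Analysis.Analysis"
begin

definition geom_adj :: "(nat \<Rightarrow> real^2) \<Rightarrow> real \<Rightarrow> nat \<Rightarrow> nat \<Rightarrow> bool" where
  "geom_adj x r i j \<longleftrightarrow> i \<noteq> j \<and> dist (x i) (x j) \<le> r"

definition graph_connected :: "nat \<Rightarrow> (nat \<Rightarrow> nat \<Rightarrow> bool) \<Rightarrow> bool" where
  "graph_connected n adj \<longleftrightarrow>
     (\<forall>i<n. \<forall>j<n. (\<lambda>u v. u < n \<and> v < n \<and> adj u v)\<^sup>*\<^sup>* i j)"

definition legal_move :: "nat \<Rightarrow> (nat \<Rightarrow> nat \<Rightarrow> bool) \<Rightarrow> nat \<Rightarrow> nat \<Rightarrow> bool" where
  "legal_move n adj u v \<longleftrightarrow> u < n \<and> v < n \<and> (v = u \<or> adj u v)"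

definition legal_hist :: "nat \<Rightarrow> (nat \<Rightarrow> nat \<Rightarrow> bool) \<Rightarrow> nat list \<Rightarrow> bool" where
  "legal_hist n adj rs \<longleftrightarrow> (\<forall>k<length rs. rs ! k < n) \<and>
     (\<forall>k. Suc k < length rs \<longrightarrow> legal_move n adj (rs ! k) (rs ! Suc k))"

text \<open>A (deterministic, full-information) strategy for l cops: given the robber's positions
  so far, it returns the positions of the cops (cop i at \<open>\<sigma> rs i\<close>, i < l).
  \<open>\<sigma> []\<close> is the initial placement; after the robber's positions rs @ [r], the cops move
  from \<open>\<sigma> rs\<close> to \<open>\<sigma> (rs @ [r])\<close>.  (The cops' own past positions are determined by \<open>\<sigma>\<close>
  and the robber history, so this loses no generality.)\<close>
definition cop_strategy :: "nat \<Rightarrow> (nat \<Rightarrow> nat \<Rightarrow> bool) \<Rightarrow> nat \<Rightarrow> (nat list \<Rightarrow> nat \<Rightarrow> nat) \<Rightarrow> bool" where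
  "cop_strategy n adj l \<sigma> \<longleftrightarrow>
     (\<forall>i<l. \<sigma> [] i < n) \<and>
     (\<forall>rs r. legal_hist n adj (rs @ [r]) \<longrightarrow> (\<forall>i<l. legal_move n adj (\<sigma> rs i) (\<sigma> (rs @ [r]) i)))"

definition robber_play :: "nat \<Rightarrow> (nat \<Rightarrow> nat \<Rightarrow> bool) \<Rightarrow> (nat \<Rightarrow> nat) \<Rightarrow> bool" where
  "robber_play n adj R \<longleftrightarrow> (\<forall>t. R t < n) \<and> (\<forall>t. legal_move n adj (R t) (R (Suc t)))"

text \<open>The cops capture the robber in the play: at some time some cop is on the robber's
  vertex, either just after the robber's turn t (cops at \<open>\<sigma> (R0..R(t-1))\<close>, robber at R t)
  or just after the following cops' turn (cops at \<open>\<sigma> (R0..Rt)\<close>).\<close>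
definition captured :: "nat \<Rightarrow> (nat list \<Rightarrow> nat \<Rightarrow> nat) \<Rightarrow> (nat \<Rightarrow> nat) \<Rightarrow> bool" where
  "captured l \<sigma> R \<longleftrightarrow>
     (\<exists>t. \<exists>i<l. \<sigma> (map R [0..<t]) i = R t \<or> \<sigma> (map R [0..<Suc t]) i = R t)"

definition cops_win :: "nat \<Rightarrow> (nat \<Rightarrow> nat \<Rightarrow> bool) \<Rightarrow> nat \<Rightarrow> bool" where
  "cops_win n adj l \<longleftrightarrow>
     (\<exists>\<sigma>. cop_strategy n adj l \<sigma> \<and> (\<forall>R. robber_play n adj R \<longrightarrow> captured l \<sigma> R))"

definition cop_number :: "nat \<Rightarrow> (nat \<Rightarrow> nat \<Rightarrow> bool) \<Rightarrow> nat" where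
  "cop_number n adj = (LEAST l. cops_win n adj l)"

end

theory Submission
  imports Defs
begin

text \<open>
  Fix a root vertex and let \<open>d\<close> be the graph distance from it. Three cops can guard a geodesic \<open>P\<close>
  from the root by staying on its vertices at the levels \<open>d z - 1\<close>, \<open>d z\<close>, \<open>d z + 1\<close>, where \<open>z\<close> is the
  position of the robber. If two edges \<open>ef\<close> and \<open>ab\<close> of length at most \<open>r\<close> cross, then \<open>ea\<close> or \<open>fb\<close>, and
  \<open>eb\<close> or \<open>fa\<close>, are edges, too; hence a robber who is not caught can never cross a guarded geodesic,
  and he cannot even enter the Voronoi cells of its vertices. So the winding number, around the
  robber, of a loop formed by two guarded geodesics with ends \<open>s\<close>, \<open>s'\<close> in touching Voronoi cells
  does not change.

  Label points \<open>t\<close> of the plane by geodesics ending at a vertex closest to \<open>t\<close>, and take a triangulated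
  grid of such points. An edge of the grid is a door for the robber if the loop of its two geodesics
  winds around him. If an edge with nonzero winding number is guarded and the cops guard the
  third vertex of the next triangle as well, one of the other two edges has a nonzero winding number,
  so the third group of cops becomes free again: three groups of three cops suffice.

  This walk through triangles never returns to an earlier triangle if the edges that are never doors
  connect all nodes of the grid: as the first cohomology modulo 2 of the grid is trivial, a closed
  dual walk that crosses no connecting edge crosses every edge an even number of times.
  To achieve this, the grid is adapted to the arrangement of all bisectors and all lines through two
  vertices. Geodesics are read off from the segments that join each vertex to the closest vertex of the
  previous level: for a point \<open>t\<close> on the segment from \<open>c\<close> to \<open>q\<close>, the vertex closest to \<open>t\<close> is near both
  \<open>c\<close> and \<open>q\<close>, so a geodesic ending in \<open>q\<close> can be extended to it.
\<close>

text \<open>As G need not be planar, there is no region that could shrink around the robber. The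
  winding number of a loop around him takes its place. All geodesics start at the root, so any two
  of them close up to a loop, and the winding numbers behave like a cocycle: they add up along a
  chain of geodesics. This additivity is what makes one of the two new edges of a triangle a door.

  The obstacle is termination. Which edges are doors depends on the robber, who moves while the
  third group is on its way, so the triangles to be visited cannot be planned and the walk might
  circle. What can be fixed beforehand is a set of edges that are doors for no position of the
  robber. If these connect all nodes, the walk lives in the dual of the complement of a connected
  spanning subgraph, and this dual has no cycles, just as the complement of a spanning tree is dual
  to a tree.

  Vertices may coincide in the plane and distances may tie. Both are resolved by the smallest index,
  and the two selections that use it, the closest vertex and the closest vertex of the previous
  level, have to agree along the segments.\<close>

section \<open>The game\<close>

text \<open>The robber is to move. Being inductive, the predicate allows only finite play, without a
  bound given in advance. The target \<open>Q\<close> lets partial strategies be chained by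
  \<open>force_trans\<close>; if \<open>Q\<close> is constantly false, only capture remains.\<close>

inductive force ::
  "nat \<Rightarrow> (nat \<Rightarrow> nat \<Rightarrow> bool) \<Rightarrow> nat \<Rightarrow> ((nat \<Rightarrow> nat) \<Rightarrow> nat \<Rightarrow> bool) \<Rightarrow> (nat \<Rightarrow> nat) \<Rightarrow> nat \<Rightarrow> bool"
  for n adj l Q where
  force_now: "Q C z \<Longrightarrow> force n adj l Q C z"
| force_step: "(\<And>z'. legal_move n adj z z' \<Longrightarrow>
      \<exists>C'. (\<forall>i<l. legal_move n adj (C i) (C' i)) \<and> ((\<exists>i<l. C' i = z') \<or> force n adj l Q C' z'))
    \<Longrightarrow> force n adj l Q C z"

lemma force_trans:
  assumes "force n adj l Q C z" and "\<And>C z. Q C z \<Longrightarrow> force n adj l Q' C z"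
  shows "force n adj l Q' C z"
  using assms(1)
proof induction
  case (force_now C z)
  then show ?case by (rule assms(2))
next
  case (force_step z C)
  show ?case
  proof (rule force.force_step)
    fix z' assume "legal_move n adj z z'"
    from force_step[OF this]
    show "\<exists>C'. (\<forall>i<l. legal_move n adj (C i) (C' i)) \<and> ((\<exists>i<l. C' i = z') \<or> force n adj l Q' C' z')"
      by blast
  qed
qed

lemma force_mono:
  assumes "force n adj l Q C z" and "\<And>C z. Q C z \<Longrightarrow> Q' C z"
  shows "force n adj l Q' C z"
  using force_trans[OF assms(1)] force_now[of Q'] assms(2) by blast

text \<open>Here the cops are to move, and the explicit bound serves as a rank: replying so that the
  least bound drops is a strategy without memory.\<close>

fun cops_win_in :: "nat \<Rightarrow> (nat \<Rightarrow> nat \<Rightarrow> bool) \<Rightarrow> nat \<Rightarrow> nat \<Rightarrow> (nat \<Rightarrow> nat) \<Rightarrow> nat \<Rightarrow> bool" where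
  "cops_win_in n adj l 0 C z \<longleftrightarrow> False"
| "cops_win_in n adj l (Suc k) C z \<longleftrightarrow>
     (\<exists>C'. (\<forall>i<l. legal_move n adj (C i) (C' i)) \<and>
       ((\<exists>i<l. C' i = z) \<or> (\<forall>z'. legal_move n adj z z' \<longrightarrow> cops_win_in n adj l k C' z')))"

lemma cops_win_in_Suc: "cops_win_in n adj l k C z \<Longrightarrow> cops_win_in n adj l (Suc k) C z"
proof (induction k arbitrary: C z)
  case (Suc k)
  then obtain C' where C': "\<forall>i<l. legal_move n adj (C i) (C' i)"
      "(\<exists>i<l. C' i = z) \<or> (\<forall>z'. legal_move n adj z z' \<longrightarrow> cops_win_in n adj l k C' z')"
    by auto
  then have "(\<exists>i<l. C' i = z) \<or> (\<forall>z'. legal_move n adj z z' \<longrightarrow> cops_win_in n adj l (Suc k) C' z')"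
    using Suc.IH by blast
  with C'(1) show ?case by (subst cops_win_in.simps) blast
qed simp

lemma cops_win_in_mono:
  assumes "cops_win_in n adj l k C z" and "k \<le> k'"
  shows "cops_win_in n adj l k' C z"
  using assms(2,1)
proof (induction k' rule: dec_induct)
  case (step m)
  then show ?case using cops_win_in_Suc by blast
qed

lemma force_imp_cops_win_in:
  assumes "force n adj l (\<lambda>_ _. False) C z" "legal_move n adj z z'"
  shows "\<exists>k. cops_win_in n adj l k C z'"
  using assms
proof (induction arbitrary: z')
  case (force_step z C)
  from force_step(1)[OF force_step.prems] obtain C' where C':
    "\<forall>i<l. legal_move n adj (C i) (C' i)"
    "(\<exists>i<l. C' i = z') \<or> (\<forall>z''. legal_move n adj z' z'' \<longrightarrow> (\<exists>k. cops_win_in n adj l k C' z''))"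
    by blast
  show ?case
  proof (cases "\<exists>i<l. C' i = z'")
    case True
    then have "cops_win_in n adj l (Suc 0) C z'" using C' by auto
    then show ?thesis ..
  next
    case False
    with C'(2) obtain K where K: "\<And>z''. legal_move n adj z' z'' \<Longrightarrow> cops_win_in n adj l (K z'') C' z''"
      by metis
    \<comment> \<open>The robber has at most \<open>n\<close> moves, so the bounds chosen for them
      have a maximum.\<close>
    define M where "M = Max (K ` {..<n})"
    have "cops_win_in n adj l M C' z''" if "legal_move n adj z' z''" for z''
      using K[OF that]
      by (rule cops_win_in_mono) (use that in \<open>auto simp: M_def legal_move_def\<close>)
    then have "cops_win_in n adj l (Suc M) C z'" using C'(1) by auto
    then show ?thesis ..
  qed
qed simp

definition cop_reply :: "nat \<Rightarrow> (nat \<Rightarrow> nat \<Rightarrow> bool) \<Rightarrow> nat \<Rightarrow> (nat \<Rightarrow> nat) \<Rightarrow> nat \<Rightarrow> nat \<Rightarrow> nat" where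
  "cop_reply n adj l C z = (let k = (LEAST k. cops_win_in n adj l k C z) in
     if \<exists>k. cops_win_in n adj l k C z
     then (SOME C'. (\<forall>i<l. legal_move n adj (C i) (C' i)) \<and>
       ((\<exists>i<l. C' i = z) \<or> (\<forall>z'. legal_move n adj z z' \<longrightarrow> cops_win_in n adj l (k - 1) C' z')))
     else C)"

lemma cop_reply:
  assumes "cops_win_in n adj l k C z"
  shows "\<forall>i<l. legal_move n adj (C i) (cop_reply n adj l C z i)"
    and "(\<exists>i<l. cop_reply n adj l C z i = z) \<or>
      (\<exists>j<k. \<forall>z'. legal_move n adj z z' \<longrightarrow> cops_win_in n adj l j (cop_reply n adj l C z) z')"
proof -
  define m where "m = (LEAST k. cops_win_in n adj l k C z)"
  have m: "cops_win_in n adj l m C z" unfolding m_def by (rule LeastI[of _ k]) fact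
  have "m \<le> k" unfolding m_def by (rule Least_le) fact
  obtain m' where m': "m = Suc m'" using m by (cases m) auto
  let ?P = "\<lambda>C'. (\<forall>i<l. legal_move n adj (C i) (C' i)) \<and>
       ((\<exists>i<l. C' i = z) \<or> (\<forall>z'. legal_move n adj z z' \<longrightarrow> cops_win_in n adj l (m - 1) C' z'))"
  have "\<exists>C'. ?P C'" using m unfolding m' by simp
  then have "?P (SOME C'. ?P C')" by (rule someI_ex)
  moreover have "cop_reply n adj l C z = (SOME C'. ?P C')"
    using assms unfolding cop_reply_def m_def Let_def by auto
  ultimately have *: "?P (cop_reply n adj l C z)" by simp
  then show "\<forall>i<l. legal_move n adj (C i) (cop_reply n adj l C z i)" by blast
  have "m - 1 < k" using m' \<open>m \<le> k\<close> by simp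
  with * show "(\<exists>i<l. cop_reply n adj l C z i = z) \<or>
      (\<exists>j<k. \<forall>z'. legal_move n adj z z' \<longrightarrow> cops_win_in n adj l j (cop_reply n adj l C z) z')"
    by blast
qed

text \<open>All cops may start on vertex 0, as they will be shown to win from every
  placement.\<close>

definition reply_strategy :: "nat \<Rightarrow> (nat \<Rightarrow> nat \<Rightarrow> bool) \<Rightarrow> nat \<Rightarrow> nat list \<Rightarrow> nat \<Rightarrow> nat" where
  "reply_strategy n adj l rs = foldl (cop_reply n adj l) (\<lambda>_. 0) rs"

lemma reply_strategy_snoc [simp]:
  "reply_strategy n adj l (rs @ [z]) = cop_reply n adj l (reply_strategy n adj l rs) z"
  by (simp add: reply_strategy_def)

text \<open>A win from every position makes the positional reply legal after every history, even one
  that continues after a capture, as \<open>cop_strategy\<close> demands.\<close>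

lemma force_everywhere_imp_cops_win:
  assumes "n > 0"
    and force: "\<And>C z. \<forall>i<l. C i < n \<Longrightarrow> z < n \<Longrightarrow> force n adj l (\<lambda>_ _. False) C z"
  shows "cops_win n adj l"
proof -
  let ?\<sigma> = "reply_strategy n adj l"
  have win: "\<exists>k. cops_win_in n adj l k C z" if "\<forall>i<l. C i < n" "z < n" for C z
    using force_imp_cops_win_in[OF force[OF that], of z] that by (auto simp: legal_move_def)
  have valid: "\<forall>i<l. ?\<sigma> rs i < n" if "\<forall>k<length rs. rs ! k < n" for rs
    using that
  proof (induction rs rule: rev_induct)
    case Nil
    then show ?case using \<open>n > 0\<close> by (simp add: reply_strategy_def)
  next
    case (snoc z rs)
    have "\<forall>k<length rs. rs ! k < n"
      using snoc.prems by (metis nth_append length_append_singleton less_Suc_eq)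
    moreover have "z < n" using snoc.prems by (metis nth_append_length length_append_singleton lessI)
    ultimately obtain k where "cops_win_in n adj l k (?\<sigma> rs) z" using snoc.IH win by blast
    from cop_reply(1)[OF this] show ?case by (simp add: legal_move_def)
  qed
  have strat: "cop_strategy n adj l ?\<sigma>"
    unfolding cop_strategy_def
  proof (intro conjI allI impI)
    fix i assume "i < l"
    then show "?\<sigma> [] i < n" using valid[of "[]"] by simp
  next
    fix rs r i assume h: "legal_hist n adj (rs @ [r])" and "i < l"
    have "\<forall>k<length rs. rs ! k < n"
      using h unfolding legal_hist_def by (metis nth_append length_append_singleton less_Suc_eq)
    moreover have "r < n"
      using h unfolding legal_hist_def by (metis nth_append_length length_append_singleton lessI)
    ultimately obtain k where "cops_win_in n adj l k (?\<sigma> rs) r" using valid win by blast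
    from cop_reply(1)[OF this] \<open>i < l\<close>
    show "legal_move n adj (?\<sigma> rs i) (?\<sigma> (rs @ [r]) i)" by simp
  qed
  have "captured l ?\<sigma> R" if R: "robber_play n adj R" for R
  proof -
    have *: "\<exists>t'\<ge>t. \<exists>i<l. ?\<sigma> (map R [0..<Suc t']) i = R t'"
      if "cops_win_in n adj l k (?\<sigma> (map R [0..<t])) (R t)" for k t
      using that
    proof (induction k arbitrary: t rule: less_induct)
      case (less k)
      let ?C = "?\<sigma> (map R [0..<t])"
      have s: "?\<sigma> (map R [0..<Suc t]) = cop_reply n adj l ?C (R t)" by simp
      from cop_reply(2)[OF less.prems] show ?case
      proof
        assume "\<exists>i<l. cop_reply n adj l ?C (R t) i = R t"
        then show ?thesis using s by (intro exI[of _ t]) simp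
      next
        assume "\<exists>j<k. \<forall>z'. legal_move n adj (R t) z' \<longrightarrow>
           cops_win_in n adj l j (cop_reply n adj l ?C (R t)) z'"
        then obtain j where "j < k" "cops_win_in n adj l j (?\<sigma> (map R [0..<Suc t])) (R (Suc t))"
          using R s unfolding robber_play_def by metis
        from less.IH[OF this] show ?thesis by (meson Suc_leD)
      qed
    qed
    have "R 0 < n" using R by (simp add: robber_play_def)
    moreover have "\<forall>i<l. ?\<sigma> [] i < n" using valid[of "[]"] by simp
    ultimately obtain k where "cops_win_in n adj l k (?\<sigma> (map R [0..<0])) (R 0)"
      using win[of "?\<sigma> []" "R 0"] by auto
    from *[OF this] show ?thesis unfolding captured_def by blast
  qed
  with strat show ?thesis unfolding cops_win_def by blast
qed

section \<open>Angles and winding numbers of polygons\<close>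

text \<open>Signed angle in (-pi, pi] under which \<open>z\<close> sees the way from
  \<open>a\<close> to \<open>b\<close>. While \<open>z\<close> is off the segment, the principal
  value is the change of argument along it.\<close>

definition ang :: "complex \<Rightarrow> complex \<Rightarrow> complex \<Rightarrow> real" where
  "ang z a b = Im (Ln ((b - z) / (a - z)))"

text \<open>Off the segment the quotient avoids the branch cut of \<open>Ln\<close>; this makes
  \<open>ang\<close> continuous in \<open>z\<close> and antisymmetric there.\<close>

lemma not_closed_segment_imp:
  fixes z :: complex
  assumes "z \<notin> closed_segment a b"
  shows "a \<noteq> z" "b \<noteq> z" "(b - z) / (a - z) \<notin> \<real>\<^sub>\<le>\<^sub>0"
proof -
  show ne: "a \<noteq> z" "b \<noteq> z" using assms by auto
  show "(b - z) / (a - z) \<notin> \<real>\<^sub>\<le>\<^sub>0"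
  proof
    assume "(b - z) / (a - z) \<in> \<real>\<^sub>\<le>\<^sub>0"
    then obtain t where t: "(b - z) / (a - z) = of_real t" "t \<le> 0"
      by (elim nonpos_Reals_cases)
    then have b: "b - z = t *\<^sub>R (a - z)"
      using ne by (simp add: field_simps scaleR_conv_of_real)
    \<comment> \<open>Solving b - z = t (a - z) for z gives this weight of \<open>b\<close>.\<close>
    define u where "u = 1 / (1 - t)"
    have u: "u * (1 - t) = 1" "0 \<le> u" "u \<le> 1" using t by (auto simp: u_def)
    have "z = (1 - u) *\<^sub>R a + u *\<^sub>R b"
    proof -
      have "(1 - u) *\<^sub>R a + u *\<^sub>R b - z = (1 - u) *\<^sub>R (a - z) + u *\<^sub>R (b - z)"
        by (simp add: algebra_simps)
      also have "\<dots> = (1 - u * (1 - t)) *\<^sub>R (a - z)"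
        unfolding b by (simp add: algebra_simps)
      finally show ?thesis using u by simp
    qed
    with u assms show False unfolding closed_segment_def by blast
  qed
qed

lemma ang_self [simp]: "a \<noteq> z \<Longrightarrow> ang z a a = 0"
  by (simp add: ang_def)

lemma ang_rev:
  assumes "z \<notin> closed_segment a b"
  shows "ang z b a = - ang z a b"
proof -
  have "(a - z) / (b - z) = inverse ((b - z) / (a - z))" by simp
  then show ?thesis
    using Ln_inverse[OF not_closed_segment_imp(3)[OF assms]] by (simp add: ang_def)
qed

lemma ang_pos:
  assumes "Im ((b - z) / (a - z)) > 0"
  shows "ang z a b > 0"
proof -
  have "(b - z) / (a - z) \<noteq> 0" using assms by auto
  then show ?thesis using assms Im_Ln_pos_lt unfolding ang_def by blast
qed

text \<open>Multiplication by \<open>w\<close> turns both directions into the right half-plane,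
  where arguments differ by less than pi, so no jump by 2 pi occurs.\<close>

lemma ang_halfplane:
  assumes "Re (w * (a - z)) > 0" "Re (w * (b - z)) > 0"
  shows "ang z a b = Im (Ln (w * (b - z))) - Im (Ln (w * (a - z)))"
proof -
  let ?u = "w * (a - z)" and ?v = "w * (b - z)"
  have ne: "?u \<noteq> 0" "?v \<noteq> 0" using assms by (metis less_irrefl zero_complex.sel(1))+
  have "\<bar>Im (Ln ?u)\<bar> < pi / 2" "\<bar>Im (Ln ?v)\<bar> < pi / 2"
    using Re_Ln_pos_lt ne assms by blast+
  then have "Ln (?v / ?u) = Ln ?v - Ln ?u"
    by (intro Ln_unique) (use ne in \<open>auto simp: exp_diff\<close>)
  moreover have "?v / ?u = (b - z) / (a - z)" using ne by auto
  ultimately show ?thesis by (simp add: ang_def)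
qed

text \<open>A line separates \<open>z\<close> from the triangle, so all three directions lie in one
  open half-plane and the angles are differences of arguments.\<close>

lemma ang_triangle:
  assumes "z \<notin> convex hull {a, b, c}"
  shows "ang z a b + ang z b c = ang z a c"
proof -
  have "closed (convex hull {a, b, c})"
    by (simp add: compact_imp_closed finite_imp_compact_convex_hull)
  then obtain v \<beta> where v: "inner v z < \<beta>" "\<forall>x\<in>convex hull {a, b, c}. inner v x > \<beta>"
    using separating_hyperplane_closed_point[OF convex_convex_hull _ assms] by blast
  have "Re (cnj v * (x - z)) > 0" if "x \<in> {a, b, c}" for x
  proof -
    have "x \<in> convex hull {a, b, c}" using that by (rule hull_inc)
    then have "inner v (x - z) > 0" using v by (force simp: inner_diff_right)
    then show ?thesis by (simp add: inner_complex_def)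
  qed
  then show ?thesis by (simp add: ang_halfplane[of "cnj v"])
qed

text \<open>For a closed polygon this is \<open>2 * pi\<close> times its winding number around \<open>z\<close>.\<close>
fun pang :: "complex \<Rightarrow> complex list \<Rightarrow> real" where
  "pang z (a # b # xs) = ang z a b + pang z (b # xs)"
| "pang z _ = 0"

fun avoids :: "complex set \<Rightarrow> complex list \<Rightarrow> bool" where
  "avoids S (a # b # xs) \<longleftrightarrow> S \<inter> closed_segment a b = {} \<and> avoids S (b # xs)"
| "avoids S _ \<longleftrightarrow> True"

lemma avoids_append:
  "xs \<noteq> [] \<Longrightarrow> ys \<noteq> [] \<Longrightarrow>
    avoids S (xs @ ys) \<longleftrightarrow> avoids S xs \<and> S \<inter> closed_segment (last xs) (hd ys) = {} \<and> avoids S ys"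
proof (induction xs rule: induct_list012)
  case (2 x)
  then show ?case by (cases ys) auto
qed auto

lemma pang_append:
  "xs \<noteq> [] \<Longrightarrow> ys \<noteq> [] \<Longrightarrow> pang z (xs @ ys) = pang z xs + ang z (last xs) (hd ys) + pang z ys"
proof (induction xs rule: induct_list012)
  case (2 x)
  then show ?case by (cases ys) auto
qed auto

lemma avoids_rev: "avoids S (rev xs) \<longleftrightarrow> avoids S xs"
proof (induction xs rule: induct_list012)
  case (3 x y zs)
  have "avoids S (rev (x # y # zs)) \<longleftrightarrow> avoids S (rev (y # zs)) \<and> S \<inter> closed_segment y x = {}"
    using avoids_append[of "rev (y # zs)" "[x]" S] by (simp add: last_rev del: rev.simps(2)) simp
  then show ?case using 3 by (auto simp: closed_segment_commute)
qed auto

lemma pang_rev: "avoids {z} xs \<Longrightarrow> pang z (rev xs) = - pang z xs"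
proof (induction xs rule: induct_list012)
  case (3 x y zs)
  have "pang z (rev (x # y # zs)) = pang z (rev (y # zs)) + ang z y x"
    using pang_append[of "rev (y # zs)" "[x]" z] by (simp add: last_rev del: rev.simps(2)) simp
  then show ?case using 3 by (simp add: ang_rev)
qed auto

lemma avoids_subset: "avoids S xs \<Longrightarrow> T \<subseteq> S \<Longrightarrow> avoids T xs"
  by (induction xs rule: induct_list012) auto

lemma avoids_nthI:
  assumes "\<And>i. Suc i < length xs \<Longrightarrow> S \<inter> closed_segment (xs ! i) (xs ! Suc i) = {}"
  shows "avoids S xs"
  using assms
proof (induction xs rule: induct_list012)
  case (3 x y zs)
  have "avoids S (y # zs)"
  proof (rule 3(2))
    fix i assume "Suc i < length (y # zs)"
    then show "S \<inter> closed_segment ((y # zs) ! i) ((y # zs) ! Suc i) = {}"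
      using "3.prems"[of "Suc i"] by simp
  qed
  then show ?case using "3.prems"[of 0] by simp
qed auto

text \<open>The quotients of successive directions multiply: their arguments add up to
  \<open>pang\<close>, their moduli to a positive factor. For a closed polygon the product is 1,
  whence \<open>pang_closed\<close>.\<close>

lemma pang_polar:
  assumes "avoids {z} xs" "xs \<noteq> []" "hd xs \<noteq> z"
  shows "\<exists>\<rho>>0. last xs - z = of_real \<rho> * exp (\<i> * of_real (pang z xs)) * (hd xs - z)"
  using assms
proof (induction xs rule: induct_list012)
  case (2 x)
  then show ?case by (auto intro!: exI[of _ 1])
next
  case (3 x y zs)
  have seg: "z \<notin> closed_segment x y" using 3 by auto
  note ne = not_closed_segment_imp[OF seg]
  obtain \<rho> where \<rho>: "\<rho> > 0"
    "last (y # zs) - z = of_real \<rho> * exp (\<i> * of_real (pang z (y # zs))) * (y - z)"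
    using 3 ne by auto
  have ne0: "(y - z) / (x - z) \<noteq> 0" using ne by simp
  define q where "q = (y - z) / (x - z)"
  have "q = exp (Ln q)" using ne0 by (simp add: q_def)
  also have "Ln q = of_real (Re (Ln q)) + \<i> * of_real (ang z x y)"
    by (simp add: q_def ang_def complex_eq)
  also have "exp \<dots> = of_real (exp (Re (Ln q))) * exp (\<i> * of_real (ang z x y))"
    by (simp add: exp_add exp_of_real)
  finally have q: "q = of_real (exp (Re (Ln q))) * exp (\<i> * of_real (ang z x y))" .
  have yz: "y - z = q * (x - z)" using ne by (simp add: q_def)
  have "last (x # y # zs) - z = of_real \<rho> * exp (\<i> * of_real (pang z (y # zs))) *
     (of_real (exp (Re (Ln q))) * exp (\<i> * of_real (ang z x y)) * (x - z))"
    using \<rho>(2) yz q by simp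
  also have "\<dots> = of_real (\<rho> * exp (Re (Ln q))) * exp (\<i> * of_real (pang z (x # y # zs))) * (x - z)"
    by (simp add: distrib_left exp_add mult_ac)
  finally show ?case using \<rho>(1)
    by (intro exI[of _ "\<rho> * exp (Re (Ln q))"]) (simp add: )
qed auto

lemma pang_closed:
  assumes "avoids {z} xs" "xs \<noteq> []" "hd xs \<noteq> z" "last xs = hd xs"
  shows "\<exists>k::int. pang z xs = 2 * pi * of_int k"
proof -
  obtain \<rho> where \<rho>: "\<rho> > 0" "last xs - z = of_real \<rho> * exp (\<i> * of_real (pang z xs)) * (hd xs - z)"
    using pang_polar[OF assms(1-3)] by blast
  then have e: "of_real \<rho> * exp (\<i> * of_real (pang z xs)) = 1" using assms by simp
  then have "norm (of_real \<rho> * exp (\<i> * complex_of_real (pang z xs))) = 1" by simp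
  then have "\<rho> = 1" using \<rho>(1) by (simp add: norm_mult)
  with e have "exp (\<i> * complex_of_real (pang z xs)) = 1" by simp
  then show ?thesis by (auto simp: exp_eq_1 mult_ac)
qed

lemma continuous_on_ang:
  assumes "S \<inter> closed_segment a b = {}"
  shows "continuous_on S (\<lambda>z. ang z a b)"
proof -
  have *: "a - z \<noteq> 0" "(b - z) / (a - z) \<notin> \<real>\<^sub>\<le>\<^sub>0" if "z \<in> S" for z
    using not_closed_segment_imp[of z a b] assms that by auto
  show ?thesis unfolding ang_def
    by (intro continuous_on_Im continuous_on_Ln' continuous_on_divide continuous_intros) (use * in auto)
qed

lemma continuous_on_pang: "avoids S xs \<Longrightarrow> continuous_on S (\<lambda>z. pang z xs)"
  by (induction xs rule: induct_list012) (auto intro!: continuous_on_add continuous_on_ang)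

text \<open>By \<open>pang_closed\<close> the values are integer multiples of 2 pi, and they vary
  continuously, so they cannot jump on a connected set.\<close>

lemma pang_constant:
  assumes "avoids S xs" "xs \<noteq> []" "hd xs \<notin> S" "last xs = hd xs" "connected S" "z \<in> S" "z' \<in> S"
  shows "pang z xs = pang z' xs"
proof -
  have int: "\<exists>k::int. pang z xs = 2 * pi * of_int k" if "z \<in> S" for z
    using pang_closed[OF avoids_subset[OF assms(1)], of z] assms that by auto
  have "(\<lambda>z. pang z xs) constant_on S"
  proof (rule continuous_discrete_range_constant[OF assms(5) continuous_on_pang[OF assms(1)]])
    fix z assume "z \<in> S"
    have "2 * pi \<le> norm (pang y xs - pang z xs)" if y: "y \<in> S" "pang y xs \<noteq> pang z xs" for y
    proof -
      obtain k l :: int where kl: "pang z xs = 2 * pi * of_int k" "pang y xs = 2 * pi * of_int l"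
        using int \<open>z \<in> S\<close> y by metis
      then have "k \<noteq> l" using y by auto
      then have "1 \<le> \<bar>l - k\<bar>" by auto
      then have "1 \<le> \<bar>real_of_int l - real_of_int k\<bar>" by linarith
      then have "2 * pi * 1 \<le> 2 * pi * \<bar>real_of_int l - real_of_int k\<bar>"
        by (intro mult_left_mono) auto
      also have "\<dots> = norm (pang y xs - pang z xs)"
        unfolding kl by (simp add: right_diff_distrib[symmetric] abs_mult)
      finally show ?thesis by simp
    qed
    then show "\<exists>e>0. \<forall>y. y \<in> S \<and> pang y xs \<noteq> pang z xs \<longrightarrow> e \<le> norm (pang y xs - pang z xs)"
      by (intro exI[of _ "2 * pi"]) auto
  qed
  then show ?thesis using assms(6,7) unfolding constant_on_def by auto
qed

section \<open>Dual walks in a triangulated grid\<close>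

text \<open>Horizontal, vertical and diagonal edges, named by their lower left node. The diagonals
  split each square into a triangle \<open>Lo\<close> below and a triangle \<open>Up\<close>
  above.\<close>

datatype grid_edge = EH nat nat | EV nat nat | ED nat nat
datatype grid_face = Outer | Lo nat nat | Up nat nat

fun edge_src :: "grid_edge \<Rightarrow> nat \<times> nat" where
  "edge_src (EH i k) = (i, k)"
| "edge_src (EV i k) = (i, k)"
| "edge_src (ED i k) = (i, k)"

fun edge_dst :: "grid_edge \<Rightarrow> nat \<times> nat" where
  "edge_dst (EH i k) = (Suc i, k)"
| "edge_dst (EV i k) = (i, Suc k)"
| "edge_dst (ED i k) = (Suc i, Suc k)"

locale grid =
  fixes J K :: nat
  assumes J_pos: "0 < J" and K_pos: "0 < K"
begin

fun valid_edge :: "grid_edge \<Rightarrow> bool" where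
  "valid_edge (EH i k) \<longleftrightarrow> i < J \<and> k \<le> K"
| "valid_edge (EV i k) \<longleftrightarrow> i \<le> J \<and> k < K"
| "valid_edge (ED i k) \<longleftrightarrow> i < J \<and> k < K"

fun sides :: "grid_edge \<Rightarrow> grid_face set" where
  "sides (EH i k) = {if k < K then Lo i k else Outer, if 0 < k then Up i (k - 1) else Outer}"
| "sides (EV i k) = {if i < J then Up i k else Outer, if 0 < i then Lo (i - 1) k else Outer}"
| "sides (ED i k) = {Lo i k, Up i k}"

fun face_edges :: "grid_face \<Rightarrow> grid_edge set" where
  "face_edges Outer = {}"
| "face_edges (Lo i k) = {EH i k, EV (Suc i) k, ED i k}"
| "face_edges (Up i k) = {EV i k, EH i (Suc k), ED i k}"

fun valid_face :: "grid_face \<Rightarrow> bool" where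
  "valid_face Outer \<longleftrightarrow> True"
| "valid_face (Lo i k) \<longleftrightarrow> i < J \<and> k < K"
| "valid_face (Up i k) \<longleftrightarrow> i < J \<and> k < K"

abbreviation "nodes \<equiv> {..J} \<times> {..K}"

lemma sides_valid: "valid_edge e \<Longrightarrow> f \<in> sides e \<Longrightarrow> valid_face f"
  using J_pos K_pos by (cases e) (auto split: if_splits)

lemma card_sides: "valid_edge e \<Longrightarrow> card (sides e) = 2"
  using J_pos K_pos by (cases e) (auto simp: card_insert_if)

lemma mem_face_edges_iff:
  "valid_edge e \<Longrightarrow> valid_face g \<Longrightarrow> g \<noteq> Outer \<Longrightarrow> e \<in> face_edges g \<longleftrightarrow> g \<in> sides e"
  by (cases e; cases g) (auto split: if_splits)

lemma face_edges_valid: "valid_face g \<Longrightarrow> e \<in> face_edges g \<Longrightarrow> valid_edge e"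
  by (cases g) auto

lemma finite_valid_faces: "finite {f. valid_face f}"
proof (rule finite_subset)
  show "{f. valid_face f} \<subseteq> {Outer} \<union> case_prod Lo ` ({..<J} \<times> {..<K}) \<union> case_prod Up ` ({..<J} \<times> {..<K})"
  proof
    fix f assume "f \<in> {f. valid_face f}"
    then show "f \<in> {Outer} \<union> case_prod Lo ` ({..<J} \<times> {..<K}) \<union> case_prod Up ` ({..<J} \<times> {..<K})"
      by (cases f) auto
  qed
qed auto

text \<open>Summing \<open>N\<close> along paths from (0, 0) gives the colouring; evenness around
  each triangle makes the parity independent of the path. This is the vanishing of the first
  cohomology modulo 2.\<close>

lemma even_cochain_coboundary:
  fixes N :: "grid_edge \<Rightarrow> nat"
  assumes "\<And>g. valid_face g \<Longrightarrow> g \<noteq> Outer \<Longrightarrow> even (\<Sum>e\<in>face_edges g. N e)"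
  shows "\<exists>\<phi>. \<forall>e. valid_edge e \<longrightarrow> (odd (N e) \<longleftrightarrow> \<phi> (edge_src e) \<noteq> (\<phi> (edge_dst e) :: bool))"
proof -
  \<comment> \<open>The path follows row 0 to column \<open>i\<close> and then climbs to row
    \<open>k\<close>.\<close>
  define P where "P i k = (\<Sum>a<i. N (EH a 0)) + (\<Sum>b<k. N (EV i b))" for i k
  have lo: "even (N (EH i k) + N (EV (Suc i) k) + N (ED i k))" if "i < J" "k < K" for i k
    using assms[of "Lo i k"] that by (simp add: add_ac)
  have up: "even (N (EV i k) + N (EH i (Suc k)) + N (ED i k))" if "i < J" "k < K" for i k
    using assms[of "Up i k"] that by (simp add: add_ac)
  have V: "P i (Suc k) = P i k + N (EV i k)" for i k by (simp add: P_def)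
  \<comment> \<open>Vertical edges are settled by the choice of the path; a horizontal edge is
    compared with the one below it through the two triangles between them.\<close>
  have H: "odd (N (EH i k)) \<longleftrightarrow> odd (P i k) \<noteq> odd (P (Suc i) k)" if "i < J" "k \<le> K" for i k
    using that(2)
  proof (induction k)
    case 0
    then show ?case by (auto simp: P_def)
  next
    case (Suc k)
    have "even (N (EH i k) + N (EV (Suc i) k) + N (ED i k))" "even (N (EV i k) + N (EH i (Suc k)) + N (ED i k))"
      using lo up Suc.prems that(1) by simp_all
    moreover have "odd (N (EH i k)) \<longleftrightarrow> odd (P i k) \<noteq> odd (P (Suc i) k)" using Suc by simp
    ultimately show ?case unfolding V even_add by blast
  qed
  have "odd (N e) \<longleftrightarrow> odd (case_prod P (edge_src e)) \<noteq> odd (case_prod P (edge_dst e))" if "valid_edge e" for e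
  proof (cases e)
    case (EH i k)
    then show ?thesis using H that by auto
  next
    case (EV i k)
    then show ?thesis using V by auto
  next
    case (ED i k)
    then have "i < J" "k < K" using that by auto
    then have "even (N (EH i k) + N (EV (Suc i) k) + N (ED i k))"
      "odd (N (EH i k)) \<longleftrightarrow> odd (P i k) \<noteq> odd (P (Suc i) k)" using lo H by simp_all
    then show ?thesis unfolding ED edge_src.simps edge_dst.simps prod.case V even_add by blast
  qed
  then show ?thesis by (intro exI[of _ "\<lambda>v. odd (case_prod P v)"]) blast
qed

end

text \<open>Connectedness of the subgraph \<open>T\<close> is expressed through two-colourings; the doors are the edges outside \<open>T\<close>.\<close>
locale grid_tree = grid +
  fixes T :: "grid_edge \<Rightarrow> bool"
  assumes T_conn: "\<forall>\<phi>. (\<forall>e. valid_edge e \<longrightarrow> T e \<longrightarrow> \<phi> (edge_src e) = (\<phi> (edge_dst e) :: bool)) \<longrightarrow>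
    (\<forall>v\<in>{..J} \<times> {..K}. \<forall>w\<in>{..J} \<times> {..K}. \<phi> v = \<phi> w)"
begin

text \<open>A closed walk enters every face as often as it leaves it, so the crossing counts have an
  even sum around each triangle, and their parity is the coboundary of a colouring. The colouring is
  constant along \<open>T\<close>, which is never crossed, and hence everywhere.\<close>

lemma closed_dual_walk_even:
  fixes E :: "nat \<Rightarrow> grid_edge" and F :: "nat \<Rightarrow> grid_face"
  assumes walk: "\<And>l. l < m \<Longrightarrow> valid_edge (E l) \<and> \<not> T (E l) \<and> sides (E l) = {F l, F (Suc l)}"
    and closed: "F m = F 0"
  shows "even (card {l. l < m \<and> E l = e})"
proof (cases "valid_edge e")
  case False
  then have "{l. l < m \<and> E l = e} = {}" using walk by auto
  then show ?thesis by (metis card.empty even_zero)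
next
  case True
  define N where "N e = card {l. l < m \<and> E l = e}" for e
  have "even (\<Sum>e\<in>face_edges g. N e)" if g: "valid_face g" "g \<noteq> Outer" for g
  proof -
    have fin: "finite (face_edges g)" by (cases g) auto
    have "(\<Sum>e\<in>face_edges g. N e) = card (\<Union>e\<in>face_edges g. {l. l < m \<and> E l = e})"
      unfolding N_def using fin by (subst card_UN_disjoint) auto
    also have "(\<Union>e\<in>face_edges g. {l. l < m \<and> E l = e}) = {l. l < m \<and> g \<in> sides (E l)}"
      using mem_face_edges_iff[OF _ g] walk by blast
    also have "\<dots> = {l. l < m \<and> F l = g} \<union> {l. l < m \<and> F (Suc l) = g}"
      using walk by auto
    also have "card \<dots> = card {l. l < m \<and> F l = g} + card {l. l < m \<and> F (Suc l) = g}"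
    proof (rule card_Un_disjoint)
      have ne: "F l \<noteq> F (Suc l)" if "l < m" for l
        using card_sides[of "E l"] walk[OF that] by (auto simp: card_insert_if)
      show "{l. l < m \<and> F l = g} \<inter> {l. l < m \<and> F (Suc l) = g} = {}"
      proof (rule equals0I)
        fix l assume "l \<in> {l. l < m \<and> F l = g} \<inter> {l. l < m \<and> F (Suc l) = g}"
        then show False using ne[of l] by simp
      qed
    qed auto
    \<comment> \<open>Shifting the index by one merely rotates the closed walk.\<close>
    also have "card {l. l < m \<and> F (Suc l) = g} = card {l. l < m \<and> F l = g}"
    proof -
      have "card {l. l < m \<and> F (Suc l) = g} = (\<Sum>l<m. of_bool (F (Suc l) = g))"
        by (simp add: sum_of_bool_eq Collect_conj_eq lessThan_def)
      also have "\<dots> = (\<Sum>l<m. of_bool (F l = g))"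
      proof -
        have "(\<Sum>l<Suc m. of_bool (F l = g)) = of_bool (F 0 = g) + (\<Sum>l<m. of_bool (F (Suc l) = g) :: nat)"
          by (rule sum.lessThan_Suc_shift)
        moreover have "(\<Sum>l<Suc m. of_bool (F l = g)) = (\<Sum>l<m. of_bool (F l = g)) + (of_bool (F m = g) :: nat)"
          by simp
        ultimately show ?thesis using closed by simp
      qed
      also have "\<dots> = card {l. l < m \<and> F l = g}"
        by (simp add: sum_of_bool_eq Collect_conj_eq lessThan_def)
      finally show ?thesis .
    qed
    finally show ?thesis by simp
  qed
  from even_cochain_coboundary[OF this] obtain \<phi> where
    \<phi>: "\<And>e. valid_edge e \<Longrightarrow> odd (N e) \<longleftrightarrow> \<phi> (edge_src e) \<noteq> (\<phi> (edge_dst e) :: bool)"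
    by blast
  have "\<phi> (edge_src e) = \<phi> (edge_dst e)" if e: "valid_edge e" "T e" for e
  proof -
    have "{l. l < m \<and> E l = e} = {}" using walk e by auto
    then have "N e = 0" by (simp add: N_def)
    then show ?thesis using \<phi>[OF e(1)] by simp
  qed
  then have "\<forall>e. valid_edge e \<longrightarrow> T e \<longrightarrow> \<phi> (edge_src e) = \<phi> (edge_dst e)" by blast
  with T_conn[THEN spec, of \<phi>] have const: "\<forall>v\<in>nodes. \<forall>w\<in>nodes. \<phi> v = \<phi> w" by (rule mp)
  have "edge_src e \<in> nodes" "edge_dst e \<in> nodes" using True by (cases e; auto)+
  then have "\<phi> (edge_src e) = \<phi> (edge_dst e)" using const by metis
  then show ?thesis using \<phi>[OF True] unfolding N_def by simp
qed

text \<open>Mind the indices: the edges \<open>E 0\<close>, ..., \<open>E m\<close> separate the m +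
  2 faces \<open>F 0\<close>, ..., \<open>F (m + 1)\<close>. The last condition forbids turning back
  at once.\<close>

definition door_walk :: "(nat \<Rightarrow> grid_face) \<Rightarrow> (nat \<Rightarrow> grid_edge) \<Rightarrow> nat \<Rightarrow> bool" where
  "door_walk F E m \<longleftrightarrow> (\<forall>l\<le>m. valid_edge (E l) \<and> \<not> T (E l) \<and> sides (E l) = {F l, F (Suc l)} \<and>
     (0 < l \<longrightarrow> E l \<noteq> E (l - 1)))"

text \<open>At a first return, the part since the earlier visit is a closed dual walk, so its last
  edge occurs in it a second time. As the faces before the return are distinct, an edge with these
  two sides can only be the one crossed just before, but turning back is forbidden.\<close>

lemma door_walk_inj:
  assumes "door_walk F E m"
  shows "inj_on F {..Suc m}"
  using assms
proof (induction m)
  case 0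
  then have "card {F 0, F (Suc 0)} = 2" using card_sides[of "E 0"] by (auto simp: door_walk_def)
  then have "F 0 \<noteq> F (Suc 0)" by (metis card_1_singleton_iff insert_absorb2 numeral_eq_one_iff One_nat_def semiring_norm(85))
  moreover have "{..Suc 0} = {0, Suc 0}" by auto
  ultimately show ?case by simp
next
  case (Suc m)
  then have inj: "inj_on F {..Suc m}" by (auto simp: door_walk_def)
  have w: "valid_edge (E l)" "\<not> T (E l)" "sides (E l) = {F l, F (Suc l)}" if "l \<le> Suc m" for l
    using Suc.prems that by (auto simp: door_walk_def)
  have nb: "E (Suc m) \<noteq> E m" using Suc.prems unfolding door_walk_def by (metis diff_Suc_1 order_refl zero_less_Suc)
  have "F (Suc (Suc m)) \<notin> F ` {..Suc m}"
  proof
    assume "F (Suc (Suc m)) \<in> F ` {..Suc m}"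
    then obtain a where a: "a \<le> Suc m" "F (Suc (Suc m)) = F a" by auto
    have "F (Suc m) \<noteq> F (Suc (Suc m))"
      using card_sides[OF w(1)[of "Suc m"]] w(3)[of "Suc m"] by (auto simp: card_insert_if)
    with a have am: "a < Suc m" using less_le by metis
    define q where "q = Suc (Suc m) - a"
    have "even (card {l. l < q \<and> E (a + l) = E (Suc m)})"
    proof (rule closed_dual_walk_even[where F = "\<lambda>l. F (a + l)"])
      fix l assume "l < q"
      then have "a + l \<le> Suc m" using am by (auto simp: q_def)
      from w[OF this] show "valid_edge (E (a + l)) \<and> \<not> T (E (a + l)) \<and> sides (E (a + l)) = {F (a + l), F (a + Suc l)}"
        by simp
    next
      show "F (a + q) = F (a + 0)" using a am by (simp add: q_def)
    qed
    then have "{l. l < q \<and> E (a + l) = E (Suc m)} \<noteq> {Suc m - a}"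
      by (metis card_1_singleton_iff One_nat_def odd_one)
    moreover have "Suc m - a \<in> {l. l < q \<and> E (a + l) = E (Suc m)}" using am by (auto simp: q_def)
    ultimately obtain l where l: "l < q" "E (a + l) = E (Suc m)" "l \<noteq> Suc m - a"
      by blast
    define b where "b = a + l"
    have b: "b \<le> m" "E b = E (Suc m)" using l am by (auto simp: b_def q_def)
    have "{F b, F (Suc b)} = {F (Suc m), F a}"
      using w(3)[of b] w(3)[of "Suc m"] b a(2) by simp
    then have "F ` {b, Suc b} = F ` {Suc m, a}" by simp
    then have "{b, Suc b} = {Suc m, a}"
      using inj_on_image_eq_iff[OF inj, of "{b, Suc b}" "{Suc m, a}"] b am by auto
    then have "b = m" using b by (auto simp: doubleton_eq_iff)
    with b nb show False by simp
  qed
  moreover have "{..Suc (Suc m)} = insert (Suc (Suc m)) {..Suc m}" by auto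
  ultimately show ?case using inj by auto
qed

lemma door_walk_bound:
  assumes "door_walk F E m"
  shows "m < card {f. valid_face f}"
proof -
  have "F ` {..m} \<subseteq> {f. valid_face f}"
    using assms sides_valid unfolding door_walk_def by fastforce
  then have "card (F ` {..m}) \<le> card {f. valid_face f}" by (rule card_mono[OF finite_valid_faces])
  moreover have "card (F ` {..m}) = Suc m"
    using card_image[OF inj_on_subset[OF door_walk_inj[OF assms], of "{..m}"]] by simp
  ultimately show ?thesis by simp
qed

end

section \<open>A grid adapted to finitely many lines\<close>

text \<open>Refinement of \<open>v\<close>: the entries sit at even indices and the midpoints of
  neighbours at odd ones, so that the open intervals are sampled, too.\<close>

definition mid :: "(nat \<Rightarrow> real) \<Rightarrow> nat \<Rightarrow> real" where
  "mid v k = (v (k div 2) + v (Suc k div 2)) / 2"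

lemma mid_even: "mid v (2 * a) = v a"
  by (simp add: mid_def)

text \<open>\<open>w\<close> may merge entries of \<open>v\<close> but exchanges none, and the
  position \<open>k'\<close> lies in the closure of the position \<open>k\<close>; so a sign
  relative to an entry can vanish but not flip.\<close>

lemma mid_sgn_closure:
  fixes v w :: "nat \<Rightarrow> real"
  assumes v: "\<And>p q. p \<le> q \<Longrightarrow> q \<le> N \<Longrightarrow> v p \<le> v q"
    and w: "\<And>p q. p \<le> q \<Longrightarrow> q \<le> N \<Longrightarrow> w p \<le> w q"
    and vw: "\<And>p q. p \<le> N \<Longrightarrow> q \<le> N \<Longrightarrow> w p < w q \<Longrightarrow> v p < v q"
    and k: "k \<le> 2 * N" "k' \<le> 2 * N" "k div 2 \<le> k' div 2" "Suc k' div 2 \<le> Suc k div 2"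
    and q: "q \<le> N"
  shows "sgn (mid w k' - w q) = 0 \<or> sgn (mid w k' - w q) = sgn (mid v k - v q)"
proof -
  define a b a' b' where ab: "a = k div 2" "b = Suc k div 2" "a' = k' div 2" "b' = Suc k' div 2"
  have *: "a \<le> a'" "a' \<le> b'" "b' \<le> b" "b \<le> Suc a" "b \<le> N" using k by (auto simp: ab)
  consider "q \<le> a" | "b \<le> q" using * by linarith
  then show ?thesis
  proof cases
    case 1
    then have le: "w q \<le> w a'" "w a' \<le> w b'" "w b' \<le> w b" "v q \<le> v a" "v a \<le> v b" using * v w by auto
    show ?thesis
    proof (cases "w q < w b")
      case True
      then have "v q < v b" using vw[of q b] q * by auto
      then have "mid v k - v q > 0" using le by (simp add: mid_def ab)
      moreover have "mid w k' - w q \<ge> 0" using le by (simp add: mid_def ab)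
      ultimately show ?thesis by (auto simp: sgn_real_def)
    next
      case False
      then have "mid w k' - w q = 0" using le by (simp add: mid_def ab)
      then show ?thesis by simp
    qed
  next
    case 2
    then have le: "w b' \<le> w q" "w a' \<le> w b'" "w a \<le> w a'" "v b \<le> v q" "v a \<le> v b" using * v w q by auto
    show ?thesis
    proof (cases "w a < w q")
      case True
      then have "v a < v q" using vw[of a q] q * by auto
      then have "mid v k - v q < 0" using le by (simp add: mid_def ab)
      moreover have "mid w k' - w q \<le> 0" using le by (simp add: mid_def ab)
      ultimately show ?thesis by (auto simp: sgn_real_def)
    next
      case False
      then have "mid w k' - w q = 0" using le by (simp add: mid_def ab)
      then show ?thesis by simp
    qed
  qed
qed

lemma mid_sgn_eq:
  fixes v w :: "nat \<Rightarrow> real"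
  assumes v: "\<And>p q. p \<le> q \<Longrightarrow> q \<le> N \<Longrightarrow> v p \<le> v q"
    and w: "\<And>p q. p \<le> q \<Longrightarrow> q \<le> N \<Longrightarrow> w p \<le> w q"
    and vw: "\<And>p q. p \<le> N \<Longrightarrow> q \<le> N \<Longrightarrow> w p < w q \<longleftrightarrow> v p < v q"
    and k: "k \<le> 2 * N" and q: "q \<le> N"
  shows "sgn (mid w k - w q) = sgn (mid v k - v q)"
  using mid_sgn_closure[of N v w k k q] mid_sgn_closure[of N w v k k q] assms by auto

lemma mid_locate:
  fixes v :: "nat \<Rightarrow> real"
  assumes v: "\<And>p q. p \<le> q \<Longrightarrow> q \<le> N \<Longrightarrow> v p \<le> v q" and y: "v 0 \<le> y" "y \<le> v N"
  shows "\<exists>k\<le>2 * N. \<forall>q\<le>N. sgn (mid v k - v q) = sgn (y - v q)"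
proof -
  define a where "a = (GREATEST a. a \<le> N \<and> v a \<le> y)"
  have ex: "0 \<le> N \<and> v 0 \<le> y" using y by simp
  have bnd: "\<forall>y'. (y' \<le> N \<and> v y' \<le> y) \<longrightarrow> y' \<le> N" by simp
  have a: "a \<le> N" "v a \<le> y"
    using GreatestI_nat[where P = "\<lambda>a. a \<le> N \<and> v a \<le> y", OF ex, of N] by (auto simp: a_def)
  have max: "b \<le> a" if "b \<le> N" "v b \<le> y" for b
    unfolding a_def using that by (intro Greatest_le_nat[where b = N]) auto
  show ?thesis
  proof (cases "v a = y")
    case True
    then show ?thesis using a by (intro exI[of _ "2 * a"]) (simp add: mid_even)
  next
    case False
    then have "v a < y" using a by simp
    with y have "a \<noteq> N" by auto
    with a have aN: "Suc a \<le> N" by simp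
    have "y < v (Suc a)" using max[of "Suc a"] aN by fastforce
    have m: "mid v (Suc (2 * a)) = (v a + v (Suc a)) / 2" by (simp add: mid_def)
    have "sgn (mid v (Suc (2 * a)) - v q) = sgn (y - v q)" if "q \<le> N" for q
    proof (cases "q \<le> a")
      case True
      then have "v q \<le> v a" using v a by auto
      then show ?thesis unfolding m using \<open>v a < y\<close> \<open>y < v (Suc a)\<close> by (simp add: sgn_real_def)
    next
      case False
      then have "v (Suc a) \<le> v q" using v that by auto
      then show ?thesis unfolding m using \<open>v a < y\<close> \<open>y < v (Suc a)\<close> by (simp add: sgn_real_def)
    qed
    then show ?thesis using aN by (intro exI[of _ "Suc (2 * a)"]) auto
  qed
qed

definition lv :: "real \<times> real \<Rightarrow> real \<Rightarrow> real" where
  "lv l x = fst l * x + snd l"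

lemma lv_convex: "lv l ((1 - t) * a + t * b) = (1 - t) * lv l a + t * lv l b"
  by (simp add: lv_def algebra_simps)

text \<open>\<open>L\<close> holds lines as pairs of slope and intercept, \<open>X\<close> the
  abscissas of vertical lines. Two of the latter guarantee at least one slab.\<close>

locale arrangement =
  fixes L :: "(real \<times> real) set" and X :: "real set"
  assumes fin_L: "finite L" and fin_X: "finite X" and card_X: "2 \<le> card X"
begin

definition crossings where
  "crossings = {x. \<exists>l\<in>L. \<exists>l'\<in>L. fst l \<noteq> fst l' \<and> lv l x = lv l' x}"

lemma finite_crossings: "finite crossings"
proof (rule finite_subset)
  show "crossings \<subseteq> (\<lambda>(l, l'). (snd l' - snd l) / (fst l - fst l')) ` (L \<times> L)"
  proof
    fix x assume "x \<in> crossings"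
    then obtain l l' where "l \<in> L" "l' \<in> L" "fst l \<noteq> fst l'" "lv l x = lv l' x"
      by (auto simp: crossings_def)
    moreover from this have "x = (snd l' - snd l) / (fst l - fst l')"
      by (simp add: lv_def field_simps)
    ultimately show "x \<in> (\<lambda>(l, l'). (snd l' - snd l) / (fst l - fst l')) ` (L \<times> L)" by force
  qed
qed (use fin_L in auto)

text \<open>Columns of even index are the vertical lines and the crossings, those of odd index lie
  halfway between. \<open>rowlist\<close> keeps coinciding heights, so that all columns have equally
  many nodes and the rows of neighbouring columns match; different nodes may be the same point. No
  line reaches \<open>-M\<close> or \<open>M\<close> over the range of the columns.\<close>

definition xs where "xs = sorted_list_of_set (X \<union> crossings)"
definition R where "R = length xs - 1"
definition \<xi> where "\<xi> = mid (nth xs)"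
definition bnd where "bnd = Max (abs ` set xs)"
definition M where "M = 1 + (\<Sum>l\<in>L. \<bar>fst l\<bar> * bnd + \<bar>snd l\<bar>)"
definition ls where "ls = (SOME ls. set ls = L \<and> distinct ls)"
definition N where "N = Suc (length ls)"
definition rowlist where "rowlist x = (- M) # sort (map (\<lambda>l. lv l x) ls) @ [M]"
definition row where "row i m = rowlist (\<xi> i) ! m"
definition pt where "pt i k = Complex (\<xi> i) (mid (row i) k)"

abbreviation "JJ \<equiv> 2 * R"
abbreviation "KK \<equiv> 2 * N"

lemma set_xs: "set xs = X \<union> crossings" and sorted_xs: "sorted xs" and distinct_xs: "distinct xs"
  using fin_X finite_crossings by (auto simp: xs_def)

lemma set_ls: "set ls = L"
  using someI_ex[OF finite_distinct_list[OF fin_L]] by (simp add: ls_def)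

lemma length_xs: "2 \<le> length xs"
proof -
  have "card X \<le> card (set xs)" using set_xs by (metis List.finite_set Un_upper1 card_mono)
  then show ?thesis using card_X distinct_card[OF distinct_xs] by simp
qed

lemma R_pos: "0 < R" and length_xs_eq: "length xs = Suc R"
  using length_xs by (auto simp: R_def)

lemma xs_less: "a < b \<Longrightarrow> b \<le> R \<Longrightarrow> xs ! a < xs ! b"
  using sorted_xs distinct_xs length_xs_eq
  by (metis le_imp_less_Suc sorted_wrt_nth_less strict_sorted_iff)

lemma \<xi>_even: "\<xi> (2 * a) = xs ! a" by (simp add: \<xi>_def mid_even)

lemma \<xi>_odd: "\<xi> (Suc (2 * a)) = (xs ! a + xs ! Suc a) / 2" by (simp add: \<xi>_def mid_def)

lemma \<xi>_Suc: "i < JJ \<Longrightarrow> \<xi> i < \<xi> (Suc i)"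
proof (cases "even i")
  case True
  assume "i < JJ"
  from True obtain a where a: "i = 2 * a" by (elim evenE)
  then have "xs ! a < xs ! Suc a" using xs_less[of a "Suc a"] \<open>i < JJ\<close> by simp
  then show ?thesis unfolding a \<xi>_even \<xi>_odd by simp
next
  case False
  assume "i < JJ"
  from False obtain a where a: "i = Suc (2 * a)" by (elim oddE) auto
  then have "xs ! a < xs ! Suc a" using xs_less[of a "Suc a"] \<open>i < JJ\<close> by simp
  moreover have "Suc i = 2 * Suc a" using a by simp
  ultimately show ?thesis unfolding \<open>Suc i = 2 * Suc a\<close> \<xi>_even unfolding a \<xi>_odd by simp
qed

lemma \<xi>_less: "i < j \<Longrightarrow> j \<le> JJ \<Longrightarrow> \<xi> i < \<xi> j"
proof (induction j)
  case (Suc j)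
  then show ?case using \<xi>_Suc[of j] by (cases "i = j") auto
qed simp

lemma lv_bound:
  assumes "xs ! 0 \<le> x" "x \<le> xs ! R" "l \<in> L"
  shows "\<bar>lv l x\<bar> < M"
proof -
  have "\<bar>xs ! 0\<bar> \<le> bnd" "\<bar>xs ! R\<bar> \<le> bnd"
    unfolding bnd_def using length_xs_eq by (auto intro!: Max_ge)
  then have x: "\<bar>x\<bar> \<le> bnd" using assms by linarith
  then have b: "0 \<le> bnd" by simp
  have "\<bar>lv l x\<bar> \<le> \<bar>fst l\<bar> * \<bar>x\<bar> + \<bar>snd l\<bar>"
    unfolding lv_def by (metis abs_mult abs_triangle_ineq)
  also have "\<dots> \<le> \<bar>fst l\<bar> * bnd + \<bar>snd l\<bar>" using x by (simp add: mult_left_mono)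
  also have "\<dots> \<le> (\<Sum>l\<in>L. \<bar>fst l\<bar> * bnd + \<bar>snd l\<bar>)"
    using assms(3) fin_L b by (intro member_le_sum[of l L "\<lambda>l. \<bar>fst l\<bar> * bnd + \<bar>snd l\<bar>"]) auto
  finally show ?thesis by (simp add: M_def)
qed

lemma M_pos: "0 < M"
proof -
  have "0 \<le> bnd" unfolding bnd_def using length_xs
    by (intro order_trans[OF abs_ge_zero Max_ge[of _ "\<bar>xs ! 0\<bar>"]]) (auto intro!: imageI nth_mem)
  then have "0 \<le> (\<Sum>l\<in>L. \<bar>fst l\<bar> * bnd + \<bar>snd l\<bar>)" by (intro sum_nonneg) auto
  then show ?thesis by (simp add: M_def)
qed

lemma \<xi>_range: "i \<le> JJ \<Longrightarrow> xs ! 0 \<le> \<xi> i \<and> \<xi> i \<le> xs ! R"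
  using \<xi>_less[of 0 i] \<xi>_less[of i JJ] \<xi>_even[of 0] \<xi>_even[of R]
  by (cases "i = 0"; cases "i = JJ") auto

text \<open>If the order changed between \<open>G\<close> and \<open>Y\<close>, the affine
  difference would vanish at a crossing strictly inside the slab, but all crossings are in
  \<open>xs\<close>.\<close>

lemma no_crossing:
  assumes a: "a < R" and G: "xs ! a < G" "G < xs ! Suc a" and Y: "xs ! a \<le> Y" "Y \<le> xs ! Suc a"
    and l: "l \<in> L" "l' \<in> L" and le: "lv l G \<le> lv l' G"
  shows "lv l Y \<le> lv l' Y"
proof (rule ccontr)
  assume "\<not> lv l Y \<le> lv l' Y"
  define d where "d x = lv l x - lv l' x" for x
  have dd: "d G \<le> 0" "0 < d Y" using le \<open>\<not> _\<close> by (auto simp: d_def)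
  define t where "t = - d G / (d Y - d G)"
  have t: "0 \<le> t" "t < 1" using dd by (auto simp: t_def field_simps)
  define x where "x = (1 - t) * G + t * Y"
  have "d x = (1 - t) * d G + t * d Y"
    unfolding d_def x_def lv_convex by (simp add: algebra_simps)
  also have "\<dots> = 0" using dd by (simp add: t_def field_simps)
  finally have dx: "d x = 0" .
  have "fst l \<noteq> fst l'"
  proof
    assume "fst l = fst l'"
    then have "d G = d Y" by (simp add: d_def lv_def)
    with dd show False by simp
  qed
  then have "x \<in> set xs" using dx l unfolding set_xs by (auto simp: crossings_def d_def)
  then obtain b where b: "b \<le> R" "xs ! b = x" using length_xs_eq by (metis in_set_conv_nth less_Suc_eq_le)
  have "xs ! a < x"
  proof -
    have "0 < (1 - t) * (G - xs ! a) + t * (Y - xs ! a)"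
      using t G Y by (intro add_pos_nonneg) auto
    then show ?thesis by (simp add: x_def algebra_simps)
  qed
  moreover have "x < xs ! Suc a"
  proof -
    have "0 < (1 - t) * (xs ! Suc a - G) + t * (xs ! Suc a - Y)"
      using t G Y by (intro add_pos_nonneg) auto
    then show ?thesis by (simp add: x_def algebra_simps)
  qed
  ultimately show False
    using b xs_less[of b a] xs_less[of "Suc a" b] a by (metis less_asym less_irrefl linorder_neqE_nat not_less_eq order_less_imp_le)
qed

text \<open>As the order of the lines does not change within the slab, one enumeration
  \<open>fl\<close> sorts the heights at all its abscissas at once. The horizontal lines at
  \<open>-M\<close> and \<open>M\<close> form the frame.\<close>

lemma ls_lines:
  assumes "a < R"
  shows "\<exists>fl. length fl = Suc N \<and> L \<subseteq> set fl \<and> set fl \<subseteq> L \<union> {(0, - M), (0, M)} \<and>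
     fl ! 0 = (0, - M) \<and> fl ! N = (0, M) \<and>
     (\<forall>Y. xs ! a \<le> Y \<longrightarrow> Y \<le> xs ! Suc a \<longrightarrow> rowlist Y = map (\<lambda>l. lv l Y) fl)"
proof -
  define G where "G = \<xi> (Suc (2 * a))"
  have G: "xs ! a < G" "G < xs ! Suc a"
    using xs_less[of a "Suc a"] assms by (auto simp: G_def \<xi>_odd)
  define as where "as = sort_key (\<lambda>l. lv l G) ls"
  have set_as: "set as = L" by (simp add: as_def set_ls)
  have sorted_as: "sorted (map (\<lambda>l. lv l G) as)" by (simp add: as_def)
  have "rowlist Y = map (\<lambda>l. lv l Y) ((0, - M) # as @ [(0, M)])"
    if Y: "xs ! a \<le> Y" "Y \<le> xs ! Suc a" for Y
  proof -
    have "sorted (map (\<lambda>l. lv l Y) as)"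
      unfolding sorted_map
    proof (rule sorted_wrt_mono_rel[OF _ sorted_as[unfolded sorted_map]])
      fix l l' assume "l \<in> set as" "l' \<in> set as" "lv l G \<le> lv l' G"
      then show "lv l Y \<le> lv l' Y" using no_crossing[OF assms G Y] set_as by blast
    qed
    then have "sort (map (\<lambda>l. lv l Y) ls) = map (\<lambda>l. lv l Y) as"
      by (intro properties_for_sort) (simp_all add: as_def)
    then show ?thesis by (simp add: rowlist_def lv_def)
  qed
  moreover have "length as = length ls" by (simp add: as_def)
  ultimately show ?thesis using set_as
    by (intro exI[of _ "(0, - M) # as @ [(0, M)]"]) (auto simp: N_def nth_append)
qed

lemma rowlist_mono:
  assumes "xs ! 0 \<le> x" "x \<le> xs ! R" "p \<le> q" "q \<le> N"
  shows "rowlist x ! p \<le> rowlist x ! q"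
proof -
  have b: "- M \<le> lv l x" "lv l x \<le> M" if "l \<in> L" for l using lv_bound[OF assms(1,2) that] by auto
  have "sorted (rowlist x)"
    using b M_pos by (auto simp: rowlist_def sorted_append set_ls)
  then show ?thesis using assms by (intro sorted_nth_mono) (auto simp: rowlist_def N_def)
qed

lemma row_mono: "i \<le> JJ \<Longrightarrow> p \<le> q \<Longrightarrow> q \<le> N \<Longrightarrow> row i p \<le> row i q"
  unfolding row_def using rowlist_mono \<xi>_range by blast

lemma row_0: "row i 0 = - M" and row_N: "row i N = M"
  by (auto simp: row_def rowlist_def N_def nth_append)

section \<open>Faces of the arrangement and their closures\<close>

definition sg :: "real \<times> real \<Rightarrow> complex \<Rightarrow> real" where
  "sg l t = sgn (Im t - lv l (Re t))"

definition sx :: "real \<Rightarrow> complex \<Rightarrow> real" where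
  "sx a t = sgn (Re t - a)"

text \<open>\<open>y\<close> lies in the closure of the face of \<open>t\<close> in the arrangement.\<close>
definition dom :: "complex \<Rightarrow> complex \<Rightarrow> bool" where
  "dom y t \<longleftrightarrow> (\<forall>l\<in>L. sg l y = 0 \<or> sg l y = sg l t) \<and> (\<forall>a\<in>X. sx a y = 0 \<or> sx a y = sx a t)"

text \<open>Column \<open>j\<close> lies in the closure of the open slab of column \<open>i\<close>, or equals it.\<close>
definition refines :: "nat \<Rightarrow> nat \<Rightarrow> bool" where
  "refines j i \<longleftrightarrow> i div 2 \<le> j div 2 \<and> Suc j div 2 \<le> Suc i div 2"

lemma slab:
  assumes "refines j i" "i \<le> JJ" "j \<le> JJ"
  obtains "j = i" | a where "a < R" "i = Suc (2 * a)" "j \<in> {2 * a, Suc (Suc (2 * a))}"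
proof (cases "even i")
  case True
  then obtain a where "i = 2 * a" by (elim evenE)
  with assms have "j = i" by (auto simp: refines_def)
  then show ?thesis using that by blast
next
  case False
  then obtain a where a: "i = Suc (2 * a)" by (elim oddE) auto
  then have "a < R" using assms by simp
  moreover have "j \<in> {2 * a, Suc (2 * a), Suc (Suc (2 * a))}" using assms a by (auto simp: refines_def)
  ultimately show ?thesis using that a by blast
qed

lemma slab_points:
  assumes "a < R"
  shows "xs ! a < \<xi> (Suc (2 * a))" "\<xi> (Suc (2 * a)) < xs ! Suc a"
    "j \<in> {2 * a, Suc (Suc (2 * a))} \<Longrightarrow> \<xi> j \<in> {xs ! a, xs ! Suc a}"
proof -
  show "xs ! a < \<xi> (Suc (2 * a))" "\<xi> (Suc (2 * a)) < xs ! Suc a"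
    using xs_less[of a "Suc a"] assms by (auto simp: \<xi>_odd)
  show "j \<in> {2 * a, Suc (Suc (2 * a))} \<Longrightarrow> \<xi> j \<in> {xs ! a, xs ! Suc a}"
    using \<xi>_even[of a] \<xi>_even[of "Suc a"] by auto
qed

lemma lines_order:
  assumes "a < R" "xs ! a < G" "G < xs ! Suc a" "xs ! a \<le> Y" "Y \<le> xs ! Suc a"
    and "l \<in> L \<union> {(0, - M), (0, M)}" "l' \<in> L \<union> {(0, - M), (0, M)}" "lv l G \<le> lv l' G"
  shows "lv l Y \<le> lv l' Y"
proof -
  have r: "xs ! 0 \<le> xs ! a" "xs ! Suc a \<le> xs ! R"
    using xs_less[of 0 a] xs_less[of "Suc a" R] assms(1) by (cases "a = 0"; cases "Suc a = R"; force)+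
  have b: "- M < lv l Z" "lv l Z < M" if "xs ! a \<le> Z" "Z \<le> xs ! Suc a" "l \<in> L" for l Z
    using lv_bound[of Z l] that r by auto
  have bG: "- M < lv l G" "lv l G < M" if "l \<in> L" for l using b[of G l] that assms by auto
  have bY: "- M < lv l Y" "lv l Y < M" if "l \<in> L" for l using b[of Y l] that assms by auto
  have c: "lv (0, c) Z = c" for c Z by (simp add: lv_def)
  show ?thesis
    using assms(6-8) no_crossing[OF assms(1-5), of l l'] bG[of l] bG[of l'] bY[of l] bY[of l'] M_pos
    by (auto simp: c intro: less_imp_le)
qed

text \<open>Passing from an open slab to its boundary can merge heights but not exchange them, so
  \<open>mid_sgn_closure\<close> applies, with \<open>fl\<close> naming the rows of both columns. No
  vertical line lies strictly inside a slab.\<close>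

lemma dom_pt:
  assumes "refines j i" "i \<le> JJ" "j \<le> JJ" "refines k' k" "k \<le> KK" "k' \<le> KK"
  shows "dom (pt j k') (pt i k)"
proof -
  have k: "k div 2 \<le> k' div 2" "Suc k' div 2 \<le> Suc k div 2" using assms by (auto simp: refines_def)
  from assms(1-3) show ?thesis
  proof (cases rule: slab)
    case 1
    \<comment> \<open>Any closed slab containing the column provides the enumeration of the lines;
      the last column is assigned to the slab on its left.\<close>
    obtain a where a: "a < R" "\<xi> i \<in> {xs ! a..xs ! Suc a}"
    proof (cases "even i")
      case True
      then obtain b where b: "i = 2 * b" by (elim evenE)
      show ?thesis
      proof (cases "b < R")
        case True
        then show ?thesis using that[of b] xs_less[of b "Suc b"] b by (auto simp: \<xi>_even)
      next
        case False
        then have "b = R" using b assms by simp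
        then show ?thesis using that[of "R - 1"] xs_less[of "R - 1" R] b R_pos by (auto simp: \<xi>_even)
      qed
    next
      case False
      then obtain b where b: "i = Suc (2 * b)" by (elim oddE) auto
      then have "b < R" using assms by simp
      then show ?thesis using that[of b] slab_points[of b] b by auto
    qed
    from ls_lines[OF a(1)] obtain fl where fl: "length fl = Suc N" "L \<subseteq> set fl"
      "rowlist (\<xi> i) = map (\<lambda>l. lv l (\<xi> i)) fl" using a by auto
    have "sg l (pt j k') = 0 \<or> sg l (pt j k') = sg l (pt i k)" if "l \<in> L" for l
    proof -
      have "l \<in> set fl" using that fl(2) by blast
      then obtain q where "q < length fl" "fl ! q = l" by (auto simp: in_set_conv_nth)
      then have q: "q \<le> N" "fl ! q = l" using fl(1) by auto
      have "row i q = lv l (\<xi> i)" using fl q by (simp add: row_def)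
      then show ?thesis
        using mid_sgn_closure[of N "row i" "row i" k k' q] row_mono k q assms 1
        by (simp add: sg_def pt_def)
    qed
    then show ?thesis using 1 by (simp add: dom_def sx_def pt_def)
  next
    case (2 a)
    note sl = slab_points[OF 2(1)]
    have j: "\<xi> j \<in> {xs ! a, xs ! Suc a}" using sl(3) 2(3) by blast
    have j': "xs ! a \<le> \<xi> j" "\<xi> j \<le> xs ! Suc a" using j sl by auto
    have i': "xs ! a < \<xi> i" "\<xi> i < xs ! Suc a" using sl 2(2) by auto
    from ls_lines[OF 2(1)] obtain fl where fl: "length fl = Suc N" "L \<subseteq> set fl"
      "set fl \<subseteq> L \<union> {(0, - M), (0, M)}"
      "\<And>Y. xs ! a \<le> Y \<Longrightarrow> Y \<le> xs ! Suc a \<Longrightarrow> rowlist Y = map (\<lambda>l. lv l Y) fl" by auto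
    have ri: "row i q = lv (fl ! q) (\<xi> i)" and rj: "row j q = lv (fl ! q) (\<xi> j)" if "q \<le> N" for q
      using fl(1) fl(4)[of "\<xi> i"] fl(4)[of "\<xi> j"] i' j' that by (auto simp: row_def)
    have mem: "fl ! q \<in> L \<union> {(0, - M), (0, M)}" if "q \<le> N" for q
      using fl(1,3) that by (metis le_imp_less_Suc nth_mem subsetD)
    have "sg l (pt j k') = 0 \<or> sg l (pt j k') = sg l (pt i k)" if "l \<in> L" for l
    proof -
      have "l \<in> set fl" using that fl(2) by blast
      then obtain q where "q < length fl" "fl ! q = l" by (auto simp: in_set_conv_nth)
      then have q: "q \<le> N" "fl ! q = l" using fl(1) by auto
      have "row i p < row i p'" if "p \<le> N" "p' \<le> N" "row j p < row j p'" for p p'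
        using lines_order[OF 2(1) i' j' mem[OF that(2)] mem[OF that(1)]] that ri rj by force
      then show ?thesis
        using mid_sgn_closure[of N "row i" "row j" k k' q] row_mono k q assms ri[OF q(1)] rj[OF q(1)]
        by (simp add: sg_def pt_def)
    qed
    moreover have "sx x (pt j k') = 0 \<or> sx x (pt j k') = sx x (pt i k)" if "x \<in> X" for x
    proof -
      have "x \<in> set xs" using that set_xs by auto
      then obtain b where b: "b \<le> R" "xs ! b = x" using length_xs_eq by (metis in_set_conv_nth less_Suc_eq_le)
      consider "b < a" | "b = a" | "b = Suc a" | "Suc a < b" by linarith
      then have "(x \<le> \<xi> j \<and> x < \<xi> i) \<or> (\<xi> j \<le> x \<and> \<xi> i < x)"
      proof cases
        case 1
        then have "x < xs ! a" using xs_less[of b a] 2(1) b by simp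
        then show ?thesis using j' i' by linarith
      next
        case 2
        then show ?thesis using j' i' b by auto
      next
        case 3
        then show ?thesis using j' i' b by auto
      next
        case 4
        then have "xs ! Suc a < x" using xs_less[of "Suc a" b] b by simp
        then show ?thesis using j' i' by linarith
      qed
      then show ?thesis by (auto simp: sx_def pt_def sgn_real_def)
    qed
    ultimately show ?thesis by (simp add: dom_def)
  qed
qed

end

section \<open>Paths of nodes inside convex unions of faces\<close>

context arrangement
begin

text \<open>Unions of faces cut out by one sign condition per line. Nonempty Voronoi cells and the
  segments between vertices will be of this form, which lets \<open>prodset_connected\<close> find
  paths of nodes in them.\<close>

definition prodset :: "(real \<times> real \<Rightarrow> real set) \<Rightarrow> (real \<Rightarrow> real set) \<Rightarrow> complex set" where
  "prodset S S' = {t. (\<forall>l\<in>L. sg l t \<in> S l) \<and> (\<forall>a\<in>X. sx a t \<in> S' a)}"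

fun unit_step :: "nat \<times> nat \<Rightarrow> nat \<times> nat \<Rightarrow> bool" where
  "unit_step (i, k) (j, m) \<longleftrightarrow> (j = Suc i \<or> i = Suc j) \<and> m = k \<or> j = i \<and> (m = Suc k \<or> k = Suc m)"

definition nodes_in :: "complex set \<Rightarrow> (nat \<times> nat) set" where
  "nodes_in H = {(i, k). i \<le> JJ \<and> k \<le> KK \<and> pt i k \<in> H}"

definition step_in :: "complex set \<Rightarrow> nat \<times> nat \<Rightarrow> nat \<times> nat \<Rightarrow> bool" where
  "step_in H v w \<longleftrightarrow> v \<in> nodes_in H \<and> w \<in> nodes_in H \<and> unit_step v w"

lemma step_in_sym: "step_in H v w \<Longrightarrow> step_in H w v"
  by (cases v; cases w) (auto simp: step_in_def)

lemma steps_in_sym: "(step_in H)\<^sup>*\<^sup>* v w \<Longrightarrow> (step_in H)\<^sup>*\<^sup>* w v"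
  by (induction rule: rtranclp_induct) (auto intro: step_in_sym converse_rtranclp_into_rtranclp)

lemma mid_row_mono:
  assumes "i \<le> JJ" "k \<le> k'" "k' \<le> KK"
  shows "mid (row i) k \<le> mid (row i) k'"
proof -
  have "row i (k div 2) \<le> row i (k' div 2)" "row i (Suc k div 2) \<le> row i (Suc k' div 2)"
    using assms by (auto intro!: row_mono div_le_mono)
  then show ?thesis by (simp add: mid_def)
qed

lemma pt_0: "pt i 0 = Complex (\<xi> i) (- M)" and pt_KK: "pt i KK = Complex (\<xi> i) M"
  using mid_even[of "row i" 0] mid_even[of "row i" N] by (auto simp: pt_def row_0 row_N)

lemma Im_pt_bound: "i \<le> JJ \<Longrightarrow> k \<le> KK \<Longrightarrow> - M \<le> Im (pt i k) \<and> Im (pt i k) \<le> M"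
  using mid_row_mono[of i 0 k] mid_row_mono[of i k KK] pt_0[of i] pt_KK[of i] by (auto simp: pt_def)

text \<open>Move from \<open>qj\<close>, on the boundary of the slab, slightly towards
  \<open>qi\<close>: nonzero signs are kept and vanishing ones become those of \<open>qi\<close>, so
  all conditions remain true. The row \<open>k\<close> of the face entered in this way serves in the
  open column; on the boundary it can only gain zeros, and only where \<open>qj\<close> has them as
  well.\<close>

lemma slab_pair:
  assumes a: "a < R" and i: "i = Suc (2 * a)" and j: "j \<in> {2 * a, Suc (Suc (2 * a))}"
    and qi: "qi \<in> prodset S S'" "Re qi = \<xi> i" "- M \<le> Im qi" "Im qi \<le> M"
    and qj: "qj \<in> prodset S S'" "Re qj = \<xi> j" "- M \<le> Im qj" "Im qj \<le> M"
  shows "\<exists>k\<le>KK. pt i k \<in> prodset S S' \<and> pt j k \<in> prodset S S'"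
proof -
  have ij: "i \<le> JJ" "j \<le> JJ" "refines j i" using a i j by (auto simp: refines_def)
  note sl = slab_points[OF a]
  have j': "xs ! a \<le> \<xi> j" "\<xi> j \<le> xs ! Suc a" using sl(3)[OF j] sl by auto
  have i': "xs ! a < \<xi> i" "\<xi> i < xs ! Suc a" using sl i by auto
  from ls_lines[OF a] obtain fl where fl: "length fl = Suc N" "L \<subseteq> set fl"
    "set fl \<subseteq> L \<union> {(0, - M), (0, M)}" "fl ! 0 = (0, - M)" "fl ! N = (0, M)"
    "\<And>Y. xs ! a \<le> Y \<Longrightarrow> Y \<le> xs ! Suc a \<Longrightarrow> rowlist Y = map (\<lambda>l. lv l Y) fl" by auto
  have mem: "fl ! q \<in> L \<union> {(0, - M), (0, M)}" if "q \<le> N" for q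
    using fl(1,3) that by (metis le_imp_less_Suc nth_mem subsetD)
  have rl: "rowlist Y ! q = lv (fl ! q) Y" if "q \<le> N" "xs ! a \<le> Y" "Y \<le> xs ! Suc a" for q Y
    using fl(1) fl(6)[OF that(2,3)] that by simp
  have r: "xs ! 0 \<le> xs ! a" "xs ! Suc a \<le> xs ! R"
    using xs_less[of 0 a] xs_less[of "Suc a" R] a by (cases "a = 0"; cases "Suc a = R"; force)+
  have mono: "rowlist Y ! p \<le> rowlist Y ! q" if "xs ! a \<le> Y" "Y \<le> xs ! Suc a" "p \<le> q" "q \<le> N" for p q Y
    using rowlist_mono[of Y p q] that r by auto
  \<comment> \<open>Signed heights above line \<open>q\<close>: at \<open>qj\<close>, at
    \<open>qi\<close>, and at the moving point with parameter \<open>u\<close>.\<close>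
  define D0 where "D0 q = Im qj - lv (fl ! q) (\<xi> j)" for q
  define D1 where "D1 q = Im qi - lv (fl ! q) (\<xi> i)" for q
  define D where "D u q = (1 - u) * D0 q + u * D1 q" for u q
  have "\<forall>\<^sub>F u in at_right 0. D0 q \<noteq> 0 \<longrightarrow> sgn (D u q) = sgn (D0 q)" for q
  proof -
    have lim: "((\<lambda>u. D u q) \<longlongrightarrow> D0 q) (at_right 0)"
      unfolding D_def by (rule tendsto_eq_intros | simp)+
    consider "D0 q = 0" | "0 < D0 q" | "D0 q < 0" by linarith
    then show ?thesis
    proof cases
      case 2
      from order_tendstoD(1)[OF lim 2] show ?thesis by eventually_elim (use 2 in auto)
    next
      case 3
      from order_tendstoD(2)[OF lim 3] show ?thesis by eventually_elim (use 3 in auto)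
    qed auto
  qed
  then have "\<forall>\<^sub>F u in at_right 0. \<forall>q\<in>{..N}. D0 q \<noteq> 0 \<longrightarrow> sgn (D u q) = sgn (D0 q)"
    by (intro eventually_ball_finite) auto
  moreover have "\<forall>\<^sub>F u in at_right (0::real). u \<in> {0<..<1}"
    by (rule eventually_at_right_real) simp
  ultimately have "\<forall>\<^sub>F u in at_right 0. (\<forall>q\<in>{..N}. D0 q \<noteq> 0 \<longrightarrow> sgn (D u q) = sgn (D0 q)) \<and> u \<in> {0<..<1}"
    by (rule eventually_conj)
  from eventually_happens'[OF _ this] obtain u where
    "(\<forall>q\<in>{..N}. D0 q \<noteq> 0 \<longrightarrow> sgn (D u q) = sgn (D0 q)) \<and> u \<in> {0<..<1}"
    using trivial_limit_at_right_real[of 0] by metis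
  then have u: "0 < u" "u < 1" "\<And>q. q \<le> N \<Longrightarrow> D0 q \<noteq> 0 \<Longrightarrow> sgn (D u q) = sgn (D0 q)" by auto
  have u0: "sgn (D u q) = sgn (D1 q)" if "D0 q = 0" for q using that u by (simp add: D_def sgn_mult)
  define x where "x = (1 - u) * \<xi> j + u * \<xi> i"
  define y where "y = (1 - u) * Im qj + u * Im qi"
  have "0 \<le> (1 - u) * (\<xi> j - xs ! a)" "0 < u * (\<xi> i - xs ! a)"
    "0 \<le> (1 - u) * (xs ! Suc a - \<xi> j)" "0 < u * (xs ! Suc a - \<xi> i)"
    using u i' j' by auto
  then have x: "xs ! a < x" "x < xs ! Suc a" by (auto simp: x_def algebra_simps)
  have yD: "y - rowlist x ! q = D u q" if "q \<le> N" for q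
  proof -
    have "rowlist x ! q = (1 - u) * lv (fl ! q) (\<xi> j) + u * lv (fl ! q) (\<xi> i)"
      using rl[OF that, of x] x lv_convex unfolding x_def by simp
    then show ?thesis unfolding y_def D_def D0_def D1_def by (simp add: algebra_simps)
  qed
  have "0 \<le> (1 - u) * (Im qj + M) + u * (Im qi + M)" "0 \<le> (1 - u) * (M - Im qj) + u * (M - Im qi)"
    using u qi qj by auto
  then have y: "- M \<le> y" "y \<le> M" by (auto simp: y_def algebra_simps)
  have "\<exists>k\<le>2 * N. \<forall>q\<le>N. sgn (mid (nth (rowlist x)) k - rowlist x ! q) = sgn (y - rowlist x ! q)"
  proof (rule mid_locate)
    show "rowlist x ! 0 \<le> y" "y \<le> rowlist x ! N" using y by (auto simp: rowlist_def N_def nth_append)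
  qed (use mono x in auto)
  then obtain k where k: "k \<le> KK"
    "\<And>q. q \<le> N \<Longrightarrow> sgn (mid (nth (rowlist x)) k - rowlist x ! q) = sgn (D u q)"
    using yD by auto
  have sgi: "sgn (mid (row i) k - row i q) = sgn (D u q)" if "q \<le> N" for q
  proof -
    have "rowlist x ! p < rowlist x ! p' \<longleftrightarrow> row i p < row i p'" if p: "p \<le> N" "p' \<le> N" for p p'
    proof -
      have "lv (fl ! p') x \<le> lv (fl ! p) x \<longleftrightarrow> lv (fl ! p') (\<xi> i) \<le> lv (fl ! p) (\<xi> i)"
        using lines_order[OF a x, of "\<xi> i"] lines_order[OF a i', of x] mem p i' x by (meson less_imp_le)
      then show ?thesis using rl[OF p(1)] rl[OF p(2)] x i' unfolding row_def by auto
    qed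
    then have "sgn (mid (row i) k - row i q) = sgn (mid (nth (rowlist x)) k - rowlist x ! q)"
      using mid_sgn_eq[of N "nth (rowlist x)" "row i" k q] mono x row_mono ij k that by auto
    then show ?thesis using k that by simp
  qed
  have row_eq: "row i q = lv (fl ! q) (\<xi> i)" "row j q = lv (fl ! q) (\<xi> j)" if "q \<le> N" for q
    using rl[OF that] i' j' by (auto simp: row_def)
  have SD: "sgn (D u q) \<in> S (fl ! q)" "sgn (D0 q) \<in> S (fl ! q)" if "q \<le> N" "fl ! q \<in> L" for q
  proof -
    have "sgn (D0 q) \<in> S (fl ! q)" "sgn (D1 q) \<in> S (fl ! q)"
      using qi qj that by (auto simp: prodset_def sg_def D0_def D1_def)
    then show "sgn (D u q) \<in> S (fl ! q)" "sgn (D0 q) \<in> S (fl ! q)"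
      using u(3)[OF that(1)] u0[of q] by (cases "D0 q = 0"; auto)+
  qed
  have idx: "\<exists>q\<le>N. fl ! q = l" if "l \<in> L" for l
  proof -
    have "l \<in> set fl" using that fl(2) by blast
    then show ?thesis using fl(1) by (auto simp: in_set_conv_nth less_Suc_eq_le)
  qed
  have pi: "pt i k \<in> prodset S S'"
    unfolding prodset_def
  proof (intro CollectI conjI ballI)
    fix l assume l: "l \<in> L"
    then obtain q where q: "q \<le> N" "fl ! q = l" using idx by blast
    have "sg l (pt i k) = sgn (D u q)" using sgi[OF q(1)] row_eq[OF q(1)] q by (simp add: sg_def pt_def)
    then show "sg l (pt i k) \<in> S l" using SD(1)[OF q(1)] q l by simp
  next
    fix c assume "c \<in> X"
    then show "sx c (pt i k) \<in> S' c" using qi by (auto simp: prodset_def sx_def pt_def)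
  qed
  have "dom (pt j k) (pt i k)" using ij k(1) by (intro dom_pt) (auto simp: refines_def)
  have pj: "pt j k \<in> prodset S S'"
    unfolding prodset_def
  proof (intro CollectI conjI ballI)
    fix l assume l: "l \<in> L"
    then obtain q where q: "q \<le> N" "fl ! q = l" using idx by blast
    have si: "sg l (pt i k) = sgn (D u q)" using sgi[OF q(1)] row_eq[OF q(1)] q by (simp add: sg_def pt_def)
    show "sg l (pt j k) \<in> S l"
    proof (cases "sg l (pt j k) = 0")
      case False
      then have "sg l (pt j k) = sg l (pt i k)" using \<open>dom _ _\<close> l by (auto simp: dom_def)
      then show ?thesis using si SD(1)[OF q(1)] q l by simp
    next
      case True
      \<comment> \<open>The node lies on line \<open>q\<close>, so the rows \<open>b\<close> and
        \<open>c\<close> around it collapse onto this line in column \<open>j\<close>;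
        \<open>qj\<close> is squeezed between them and lies on the line, too.\<close>
      then have eq: "mid (row j) k = row j q" using row_eq[OF q(1)] q by (simp add: sg_def pt_def sgn_eq_0_iff)
      define b c where "b = k div 2" and "c = Suc k div 2"
      have bc: "b \<le> c" "c \<le> Suc b" "c \<le> N" using k(1) by (auto simp: b_def c_def)
      have m: "mid (row i) k = (row i b + row i c) / 2" "mid (row j) k = (row j b + row j c) / 2"
        by (auto simp: mid_def b_def c_def)
      have "row i b \<le> row i c" using row_mono[OF ij(1) bc(1,3)] .
      then have "sgn (D u b) \<ge> 0" "sgn (D u c) \<le> 0"
        using sgi[of b] sgi[of c] bc m by (auto simp: sgn_real_def split: if_splits)
      moreover have "sgn (D u b) = -1" if "D0 b < 0" using u(3)[of b] bc that by simp
      moreover have "sgn (D u c) = 1" if "0 < D0 c" using u(3)[of c] bc that by simp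
      ultimately have "D0 b \<ge> 0" "D0 c \<le> 0" by (smt (verit))+
      then have y: "row j b \<le> Im qj" "Im qj \<le> row j c" using row_eq bc by (auto simp: D0_def)
      have "q \<le> b \<or> c \<le> q" using bc by linarith
      then have "row j q \<le> row j b \<or> row j c \<le> row j q"
        using row_mono[OF ij(2), of q b] row_mono[OF ij(2), of c q] bc q by linarith
      then have "row j q = Im qj" using eq m y row_mono[OF ij(2) bc(1,3)] by auto
      then have "D0 q = 0" using row_eq[OF q(1)] by (simp add: D0_def)
      then show ?thesis using SD(2)[OF q(1)] q l True by simp
    qed
  next
    fix c assume "c \<in> X"
    then show "sx c (pt j k) \<in> S' c" using qj by (auto simp: prodset_def sx_def pt_def)
  qed
  show ?thesis using k(1) pi pj by blast
qed

lemma column_connected: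
  assumes "convex H" "(i, k) \<in> nodes_in H" "(i, k') \<in> nodes_in H"
  shows "(step_in H)\<^sup>*\<^sup>* (i, k) (i, k')"
proof -
  have *: "(step_in H)\<^sup>*\<^sup>* (i, k) (i, k')" if "k \<le> k'" "(i, k) \<in> nodes_in H" "(i, k') \<in> nodes_in H" for k k'
    using that
  proof (induction k' rule: dec_induct)
    case (step m)
    have ik: "i \<le> JJ" "k \<le> m" "Suc m \<le> KK" "pt i k \<in> H" "pt i (Suc m) \<in> H"
      using step by (auto simp: nodes_in_def)
    have le: "Im (pt i k) \<le> Im (pt i m)" "Im (pt i m) \<le> Im (pt i (Suc m))"
      using mid_row_mono ik by (auto simp: pt_def)
    have "pt i m \<in> closed_segment (pt i k) (pt i (Suc m))"
    proof -
      have "Im (pt i m) \<in> closed_segment (Im (pt i k)) (Im (pt i (Suc m)))"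
        using le by (simp add: closed_segment_eq_real_ivl)
      then obtain t where t: "0 \<le> t" "t \<le> 1" "Im (pt i m) = (1 - t) * Im (pt i k) + t * Im (pt i (Suc m))"
        by (auto simp: closed_segment_def)
      then have "pt i m = (1 - t) *\<^sub>R pt i k + t *\<^sub>R pt i (Suc m)"
        by (intro complex_eqI) (auto simp: pt_def algebra_simps)
      then show ?thesis using t by (auto simp: closed_segment_def)
    qed
    then have "pt i m \<in> H" using assms(1) ik by (meson convex_contains_segment subsetD)
    then have m: "(i, m) \<in> nodes_in H" using ik by (simp add: nodes_in_def)
    then have "step_in H (i, m) (i, Suc m)" using step by (simp add: step_in_def)
    then show ?case using step.IH[OF step.prems(1) m] by simp
  qed simp
  show ?thesis using *[of k k'] *[of k' k] assms steps_in_sym by (meson nat_le_linear)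
qed

text \<open>Convexity yields a point of \<open>H\<close> in the next column, in general not a node.
  \<open>slab_pair\<close> trades it for two neighbouring nodes in \<open>H\<close>, and
  \<open>column_connected\<close> links nodes within a column.\<close>

lemma prodset_connected:
  assumes conv: "convex H" and H: "H = prodset S S'"
    and v: "v \<in> nodes_in H" "w \<in> nodes_in H"
  shows "(step_in H)\<^sup>*\<^sup>* v w"
proof -
  have *: "(step_in H)\<^sup>*\<^sup>* (i, k) (i', k')"
    if "i \<le> i'" "(i, k) \<in> nodes_in H" "(i', k') \<in> nodes_in H" for i i' k k'
    using that
  proof (induction "i' - i" arbitrary: i k)
    case 0
    then show ?case using column_connected[OF conv] by simp
  next
    case (Suc d)
    then have i: "i < i'" "i' \<le> JJ" "k \<le> KK" "k' \<le> KK" "pt i k \<in> H" "pt i' k' \<in> H"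
      by (auto simp: nodes_in_def)
    have x: "\<xi> i < \<xi> i'" "\<xi> i \<le> \<xi> (Suc i)" "\<xi> (Suc i) \<le> \<xi> i'"
      using \<xi>_less[of i i'] \<xi>_less[of i "Suc i"] \<xi>_less[of "Suc i" i'] i by (cases "Suc i = i'"; force)+
    then have "\<xi> (Suc i) \<in> closed_segment (\<xi> i) (\<xi> i')" by (simp add: closed_segment_eq_real_ivl)
    then obtain t where t: "0 \<le> t" "t \<le> 1" "\<xi> (Suc i) = (1 - t) * \<xi> i + t * \<xi> i'"
      by (auto simp: closed_segment_def)
    define q where "q = (1 - t) *\<^sub>R pt i k + t *\<^sub>R pt i' k'"
    have q: "q \<in> H" "Re q = \<xi> (Suc i)"
    proof -
      show "q \<in> H" unfolding q_def using conv i t by (intro convexD_alt) auto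
      show "Re q = \<xi> (Suc i)" using t by (simp add: q_def pt_def)
    qed
    have b: "- M \<le> Im (pt i k)" "Im (pt i k) \<le> M" "- M \<le> Im (pt i' k')" "Im (pt i' k') \<le> M"
      using Im_pt_bound[of i k] Im_pt_bound[of i' k'] i by auto
    have "0 \<le> (1 - t) * (Im (pt i k) + M) + t * (Im (pt i' k') + M)"
      "0 \<le> (1 - t) * (M - Im (pt i k)) + t * (M - Im (pt i' k'))" using t b by auto
    then have qb: "- M \<le> Im q" "Im q \<le> M" by (auto simp: q_def algebra_simps)
    have Re_p: "Re (pt i k) = \<xi> i" by (simp add: pt_def)
    have "\<exists>k0\<le>KK. pt i k0 \<in> H \<and> pt (Suc i) k0 \<in> H"
    proof (cases "even i")
      case True
      then obtain a where a: "i = 2 * a" by (elim evenE)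
      have "a < R" using a i by simp
      from slab_pair[OF this, of "Suc i" i q S S' "pt i k"] q qb b Re_p i a H show ?thesis by auto
    next
      case False
      then obtain a where a: "i = Suc (2 * a)" by (elim oddE) auto
      have "a < R" using a i by simp
      from slab_pair[OF this, of i "Suc i" "pt i k" S S' q] q qb b Re_p i a H show ?thesis by auto
    qed
    then obtain k0 where k0: "k0 \<le> KK" "pt i k0 \<in> H" "pt (Suc i) k0 \<in> H" by blast
    then have n: "(i, k0) \<in> nodes_in H" "(Suc i, k0) \<in> nodes_in H" using i by (auto simp: nodes_in_def)
    have "(step_in H)\<^sup>*\<^sup>* (i, k) (i, k0)" using column_connected[OF conv] Suc.prems n by blast
    also have "step_in H (i, k0) (Suc i, k0)" using n by (simp add: step_in_def)
    also have "(step_in H)\<^sup>*\<^sup>* (Suc i, k0) (i', k')" using Suc n i by (intro Suc.hyps(1)) auto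
    finally show ?case .
  qed
  obtain i k i' k' where "v = (i, k)" "w = (i', k')" by (cases v; cases w) auto
  then show ?thesis using *[of i i' k k'] *[of i' i k' k] v steps_in_sym by (meson nat_le_linear)
qed

text \<open>The corner with both indices even lies in the closures of the faces of all four corners.
  Hence the Voronoi cells of the vertices closest to the corners have this point in common.\<close>

lemma square_corner:
  assumes "i < JJ" "k < KK"
  shows "\<exists>y. \<forall>t\<in>{pt i k, pt (Suc i) k, pt i (Suc k), pt (Suc i) (Suc k)}. dom y t"
proof -
  define j where "j = (if even i then i else Suc i)"
  define m where "m = (if even k then k else Suc k)"
  have j: "refines j i" "refines j (Suc i)" "j \<le> JJ"
    using assms by (auto simp: j_def refines_def elim!: evenE oddE)
  have m: "refines m k" "refines m (Suc k)" "m \<le> KK"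
    using assms by (auto simp: m_def refines_def elim!: evenE oddE)
  show ?thesis using dom_pt j m assms by (intro exI[of _ "pt j m"]) auto
qed

text \<open>Of two neighbouring indices one is even, and that node lies in the closure of the face
  of the other. As \<open>y\<close> is itself one of the ends, whatever holds at both ends holds at
  \<open>y\<close>.\<close>

lemma unit_corner:
  assumes "unit_step v w" "v \<in> {..JJ} \<times> {..KK}" "w \<in> {..JJ} \<times> {..KK}"
  shows "\<exists>y\<in>{case_prod pt v, case_prod pt w}. dom y (case_prod pt v) \<and> dom y (case_prod pt w)"
proof -
  have h: "\<exists>y\<in>{pt i k, pt (Suc i) k}. dom y (pt i k) \<and> dom y (pt (Suc i) k)" if "Suc i \<le> JJ" "k \<le> KK" for i k
  proof -
    define j where "j = (if even i then i else Suc i)"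
    have "refines j i" "refines j (Suc i)" "j \<le> JJ" "refines k k"
      using that by (auto simp: j_def refines_def elim!: evenE oddE)
    then have "dom (pt j k) (pt i k) \<and> dom (pt j k) (pt (Suc i) k)" using dom_pt that by auto
    moreover have "pt j k \<in> {pt i k, pt (Suc i) k}" by (auto simp: j_def)
    ultimately show ?thesis by blast
  qed
  have v: "\<exists>y\<in>{pt i k, pt i (Suc k)}. dom y (pt i k) \<and> dom y (pt i (Suc k))" if "i \<le> JJ" "Suc k \<le> KK" for i k
  proof -
    define m where "m = (if even k then k else Suc k)"
    have "refines m k" "refines m (Suc k)" "m \<le> KK" "refines i i"
      using that by (auto simp: m_def refines_def elim!: evenE oddE)
    then have "dom (pt i m) (pt i k) \<and> dom (pt i m) (pt i (Suc k))" using dom_pt that by auto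
    moreover have "pt i m \<in> {pt i k, pt i (Suc k)}" by (auto simp: m_def)
    ultimately show ?thesis by blast
  qed
  obtain i k i' k' where vw: "v = (i, k)" "w = (i', k')" by (cases v; cases w) auto
  consider "i' = Suc i" "k' = k" | "i = Suc i'" "k' = k" | "i' = i" "k' = Suc k" | "i' = i" "k = Suc k'"
    using assms(1) vw by auto
  then show ?thesis
    by cases (use h[of i k] h[of i' k] v[of i k] v[of i k'] assms vw in auto)
qed

lemma site_node:
  assumes "Re p \<in> X" "l \<in> L" "Im p = lv l (Re p)"
  shows "\<exists>i\<le>JJ. \<exists>k\<le>KK. pt i k = p"
proof -
  have "Re p \<in> set xs" using assms set_xs by auto
  then obtain a where a: "a \<le> R" "xs ! a = Re p" using length_xs_eq by (metis in_set_conv_nth less_Suc_eq_le)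
  have "Im p \<in> set (rowlist (\<xi> (2 * a)))" using assms a by (auto simp: rowlist_def set_ls \<xi>_even)
  then obtain m where m: "m < length (rowlist (\<xi> (2 * a)))" "rowlist (\<xi> (2 * a)) ! m = Im p"
    by (auto simp: in_set_conv_nth)
  have "pt (2 * a) (2 * m) = p" using m a by (simp add: pt_def mid_even row_def \<xi>_even)
  moreover have "2 * m \<le> KK" using m by (simp add: rowlist_def N_def)
  ultimately show ?thesis using a by (metis mult_le_mono2)
qed

end

section \<open>Guarded geodesics and Voronoi cells\<close>

lemma dist_closed_segment: "t \<in> closed_segment a b \<Longrightarrow> dist a b = dist a t + dist t (b :: complex)"
  by (simp add: between[symmetric] between_mem_segment)

lemma dist_le_halfspace:
  fixes a b t :: complex
  shows "dist t a \<le> dist t b \<longleftrightarrow> inner (2 *\<^sub>R (b - a)) t \<le> inner b b - inner a a"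
proof -
  have "dist t a \<le> dist t b \<longleftrightarrow> (dist t a)\<^sup>2 \<le> (dist t b)\<^sup>2" by simp
  also have "\<dots> \<longleftrightarrow> inner (t - a) (t - a) \<le> inner (t - b) (t - b)"
    by (simp add: dist_norm power2_norm_eq_inner)
  also have "\<dots> \<longleftrightarrow> inner (2 *\<^sub>R (b - a)) t \<le> inner b b - inner a a"
    by (simp add: inner_diff_left inner_diff_right inner_commute algebra_simps)
  finally show ?thesis .
qed

lemma convex_dist_le: "convex {t :: complex. dist t a \<le> dist t b}"
  unfolding dist_le_halfspace by (rule convex_halfspace_le)

lemma convex_dist_less: "convex {t :: complex. dist t a < dist t b}"
proof -
  have "{t. dist t a < dist t b} = {t. inner (2 *\<^sub>R (a - b)) t > inner a a - inner b b}"
    using dist_le_halfspace[of _ b a] by (auto simp: not_le[symmetric] simp del: not_le)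
  then show ?thesis using convex_halfspace_gt by metis
qed

text \<open>The plane is modelled by the complex numbers for the sake of \<open>Ln\<close>.
  \<open>p\<close> need not be injective.\<close>

locale geometric_graph =
  fixes n :: nat and p :: "nat \<Rightarrow> complex" and r :: real
  assumes n_pos: "0 < n" and r_pos: "0 < r"
    and conn: "graph_connected n (\<lambda>i j. i \<noteq> j \<and> dist (p i) (p j) \<le> r)"
begin

definition near :: "nat \<Rightarrow> nat \<Rightarrow> bool" where
  "near a b \<longleftrightarrow> dist (p a) (p b) \<le> r"

abbreviation adj :: "nat \<Rightarrow> nat \<Rightarrow> bool" where
  "adj \<equiv> \<lambda>i j. i \<noteq> j \<and> dist (p i) (p j) \<le> r"

lemma near_refl [simp]: "near a a" using r_pos by (simp add: near_def)

lemma near_sym: "near a b \<longleftrightarrow> near b a" by (simp add: near_def dist_commute)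

lemma legal_move_iff: "legal_move n adj a b \<longleftrightarrow> a < n \<and> b < n \<and> near a b"
  using near_refl unfolding legal_move_def near_def by auto

section \<open>Levels and geodesics from the root, which is vertex 0\<close>

definition walks :: "(nat \<times> nat) set" where
  "walks = {(a, b). a < n \<and> b < n \<and> near a b}"

definition d :: "nat \<Rightarrow> nat" where
  "d v = (LEAST k. (0, v) \<in> walks ^^ k)"

lemma walk_d:
  assumes "v < n"
  shows "(0, v) \<in> walks ^^ d v"
proof -
  have "(\<lambda>u v. u < n \<and> v < n \<and> adj u v)\<^sup>*\<^sup>* 0 v"
    using conn assms n_pos unfolding graph_connected_def by blast
  then have "(0, v) \<in> walks\<^sup>*"
  proof (induction rule: rtranclp_induct)
    case (step y z)
    then have "(y, z) \<in> walks" by (auto simp: walks_def near_def)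
    with step show ?case by simp
  qed simp
  then obtain k where "(0, v) \<in> walks ^^ k" by (auto simp: rtrancl_power)
  then show ?thesis unfolding d_def by (rule LeastI)
qed

lemma d_le_Suc: "a < n \<Longrightarrow> b < n \<Longrightarrow> near a b \<Longrightarrow> d b \<le> Suc (d a)"
  using walk_d[of a] unfolding d_def[of b] by (intro Least_le) (auto simp: walks_def)

lemma d_eq_0_iff: "v < n \<Longrightarrow> d v = 0 \<longleftrightarrow> v = 0"
  using walk_d[of v] by (auto simp: d_def intro: Least_eq_0)

lemma d_pred:
  assumes "v < n" "d v = Suc i"
  obtains w where "w < n" "d w = i" "near w v"
proof -
  from walk_d[OF assms(1)] assms(2) obtain w where w: "(0, w) \<in> walks ^^ i" "(w, v) \<in> walks"
    by auto
  then have "d w \<le> i" unfolding d_def by (intro Least_le)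
  moreover have "Suc i \<le> Suc (d w)" using d_le_Suc[of w v] w assms by (auto simp: walks_def)
  ultimately show ?thesis using w that by (auto simp: walks_def)
qed

definition geo :: "nat list \<Rightarrow> bool" where
  "geo P \<longleftrightarrow> P \<noteq> [] \<and> (\<forall>i<length P. P ! i < n \<and> d (P ! i) = i) \<and>
     (\<forall>i. Suc i < length P \<longrightarrow> near (P ! i) (P ! Suc i))"

lemma geo_root: "geo [0]"
  using n_pos d_eq_0_iff[of 0] by (simp add: geo_def)

lemma geo_snoc:
  assumes "geo P" "s < n" "near (last P) s" "d s = length P"
  shows "geo (P @ [s])"
  unfolding geo_def
proof (intro conjI allI impI)
  fix i assume "Suc i < length (P @ [s])"
  then show "near ((P @ [s]) ! i) ((P @ [s]) ! Suc i)"
    using assms by (cases "Suc i = length P") (auto simp: geo_def nth_append last_conv_nth dest: arg_cong[of _ _ "\<lambda>x. x - 1"])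
next
  fix i assume "i < length (P @ [s])"
  then show "(P @ [s]) ! i < n" "d ((P @ [s]) ! i) = i"
    using assms by (auto simp: geo_def nth_append less_Suc_eq)
qed simp

lemma geo_last: "geo P \<Longrightarrow> last P < n \<and> d (last P) = length P - 1 \<and> last P \<in> set P"
  by (auto simp: geo_def last_conv_nth)

lemma geo_hd: "geo P \<Longrightarrow> hd P = 0"
  using d_eq_0_iff[of "hd P"] by (auto simp: geo_def hd_conv_nth)

text \<open>Holds for a robber at \<open>z\<close> who has survived a turn against three cops guarding \<open>P\<close>. The second
  condition keeps him from crossing \<open>P\<close>, because two crossing edges have an end point that is near the
  three others.\<close>
definition und :: "nat list \<Rightarrow> nat \<Rightarrow> bool" where
  "und P z \<longleftrightarrow> (\<forall>v\<in>set P. p v \<noteq> p z) \<and>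
     (\<forall>i. Suc i < length P \<longrightarrow> \<not> (near z (P ! i) \<and> near z (P ! Suc i)))"

definition safe :: "nat list \<Rightarrow> nat \<Rightarrow> nat \<Rightarrow> bool" where
  "safe P e f \<longleftrightarrow> e < n \<and> f < n \<and> near e f \<and> und P e \<and> und P f \<and>
     (\<forall>v\<in>set P. \<not> (near e v \<and> near f v))"

text \<open>Through the common point, the distances from \<open>e\<close> to \<open>a\<close> and
  from \<open>f\<close> to \<open>b\<close> add up to at most the sum of the two edge lengths, hence
  to at most 2 r.\<close>

lemma crossing:
  assumes "near e f" "near a b" "closed_segment (p e) (p f) \<inter> closed_segment (p a) (p b) \<noteq> {}"
  shows "near e a \<or> near f b"
proof -
  obtain q where q: "q \<in> closed_segment (p e) (p f)" "q \<in> closed_segment (p a) (p b)"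
    using assms by blast
  have "dist (p e) (p f) = dist (p e) q + dist q (p f)" "dist (p a) (p b) = dist (p a) q + dist q (p b)"
    using q by (auto intro: dist_closed_segment)
  moreover have "dist (p e) (p a) \<le> dist (p e) q + dist (p a) q" "dist (p f) (p b) \<le> dist q (p f) + dist q (p b)"
    by (metis dist_commute dist_triangle)+
  ultimately show ?thesis using assms unfolding near_def by linarith
qed

text \<open>\<open>crossing\<close>, applied twice, gives two alternatives. Any choice from them
  makes one of the four vertices near both ends of the other edge: \<open>und\<close> excludes this
  for \<open>e\<close> and \<open>f\<close>, the last part of \<open>safe\<close> for the vertices
  of \<open>P\<close>.\<close>

lemma safe_avoids_edge:
  assumes P: "geo P" "Suc i < length P" and s: "safe P e f"
  shows "closed_segment (p e) (p f) \<inter> closed_segment (p (P ! i)) (p (P ! Suc i)) = {}"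
proof (rule ccontr)
  assume ne: "\<not> ?thesis"
  let ?a = "P ! i" and ?b = "P ! Suc i"
  have ab: "near ?a ?b" using P by (auto simp: geo_def)
  have ef: "near e f" using s by (simp add: safe_def)
  have 1: "near e ?a \<or> near f ?b" using crossing[OF ef ab] ne by blast
  have 2: "near e ?b \<or> near f ?a" using crossing[OF ef, of ?b ?a] ab ne
    by (auto simp: near_sym closed_segment_commute)
  have "\<not> (near e ?a \<and> near e ?b)" "\<not> (near f ?a \<and> near f ?b)"
    using s P by (auto simp: safe_def und_def)
  moreover have "\<not> (near e ?a \<and> near f ?a)" "\<not> (near e ?b \<and> near f ?b)"
    using s P by (auto simp: safe_def)
  ultimately show False using 1 2 by blast
qed

definition vor :: "nat \<Rightarrow> complex set" where
  "vor s = {t. \<forall>v<n. dist t (p s) \<le> dist t (p v)}"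

lemma convex_vor: "convex (vor s)"
proof -
  have "vor s = (\<Inter>v\<in>{..<n}. {t. dist t (p s) \<le> dist t (p v)})" by (auto simp: vor_def)
  then show ?thesis by (auto intro!: convex_INT convex_dist_le)
qed

lemma site_in_vor: "p s \<in> vor s" by (simp add: vor_def)

lemma vor_segment: "t \<in> vor s \<Longrightarrow> t' \<in> vor s \<Longrightarrow> closed_segment t t' \<subseteq> vor s"
  using convex_vor convex_contains_segment by blast

lemma vor_hull: "A \<subseteq> vor s \<Longrightarrow> convex hull A \<subseteq> vor s"
  using convex_vor by (simp add: hull_minimal)

text \<open>From a point \<open>t\<close> of the robber's edge, \<open>v\<close> is at most as far
  as \<open>e\<close> and \<open>f\<close>, so each end reaches \<open>v\<close> via
  \<open>t\<close> within the length of the edge; \<open>v\<close> would be near both.\<close>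

lemma safe_avoids_vor:
  assumes "safe P e f" "v \<in> set P"
  shows "closed_segment (p e) (p f) \<inter> vor v = {}"
proof (rule ccontr)
  assume "\<not> ?thesis"
  then obtain t where t: "t \<in> closed_segment (p e) (p f)" "t \<in> vor v" by blast
  have ef: "e < n" "f < n" "dist (p e) (p f) \<le> r" using assms by (auto simp: safe_def near_def)
  have "dist (p e) (p f) = dist (p e) t + dist t (p f)" using t by (intro dist_closed_segment)
  moreover have "dist t (p v) \<le> dist t (p e)" "dist t (p v) \<le> dist t (p f)" using t ef by (auto simp: vor_def)
  moreover have "dist (p e) (p v) \<le> dist (p e) t + dist t (p v)" "dist (p f) (p v) \<le> dist t (p f) + dist t (p v)"
    by (metis dist_triangle, metis dist_triangle dist_commute)
  ultimately have "near e v" "near f v" using ef by (auto simp: near_def dist_commute)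
  then show False using assms by (auto simp: safe_def)
qed

lemma und_avoids_edge:
  assumes "geo P" "Suc i < length P" "und P z"
  shows "p z \<notin> closed_segment (p (P ! i)) (p (P ! Suc i))"
proof
  assume "p z \<in> closed_segment (p (P ! i)) (p (P ! Suc i))"
  from dist_closed_segment[OF this] have
    "dist (p (P ! i)) (p (P ! Suc i)) = dist (p (P ! i)) (p z) + dist (p z) (p (P ! Suc i))" .
  moreover have "dist (p (P ! i)) (p (P ! Suc i)) \<le> r" using assms by (auto simp: geo_def near_def)
  ultimately have "near z (P ! i)" "near z (P ! Suc i)" unfolding near_def
    by (smt (verit) dist_commute zero_le_dist)+
  then show False using assms by (auto simp: und_def)
qed

lemma und_avoids_vor: "z < n \<Longrightarrow> und P z \<Longrightarrow> v \<in> set P \<Longrightarrow> p z \<notin> vor v"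
  by (force simp: und_def vor_def)

lemma und_avoids_vor_last: "z < n \<Longrightarrow> geo P \<Longrightarrow> und P z \<Longrightarrow> p z \<notin> vor (last P)"
  using geo_last und_avoids_vor by blast

lemma avoids_geo:
  "geo P \<Longrightarrow> safe P e f \<Longrightarrow> avoids (closed_segment (p e) (p f)) (map p P)"
  by (intro avoids_nthI) (simp add: safe_avoids_edge)

lemma avoids_geo_und: "geo P \<Longrightarrow> und P z \<Longrightarrow> avoids {p z} (map p P)"
  by (intro avoids_nthI) (simp add: und_avoids_edge)

text \<open>Angle swept, as seen from \<open>z\<close>, along the closed polygon that follows the geodesic \<open>P\<close> from the
  root, then \<open>ts\<close>, and returns along the geodesic \<open>P'\<close>.\<close>
definition loop :: "nat \<Rightarrow> nat list \<Rightarrow> complex list \<Rightarrow> nat list \<Rightarrow> real" where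
  "loop z P ts P' = pang (p z) (map p P) + ang (p z) (p (last P)) (hd ts) + pang (p z) ts +
     ang (p z) (last ts) (p (last P')) - pang (p z) (map p P')"

lemma loop_eq:
  assumes "geo P" "geo P'" "und P' z" "ts \<noteq> []"
  shows "loop z P ts P' = pang (p z) (map p P @ ts @ rev (map p P'))"
proof -
  have ne: "map p P \<noteq> []" "rev (map p P') \<noteq> []" using assms by (auto simp: geo_def)
  have "pang (p z) (map p P @ ts @ rev (map p P')) = pang (p z) (map p P) +
      ang (p z) (last (map p P)) (hd ts) + (pang (p z) ts + ang (p z) (last ts) (hd (rev (map p P')))
      + pang (p z) (rev (map p P')))"
    using pang_append[of "map p P" "ts @ rev (map p P')"] pang_append[of ts "rev (map p P')"] ne assms
    by simp
  moreover have "pang (p z) (rev (map p P')) = - pang (p z) (map p P')"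
    using pang_rev[OF avoids_geo_und] assms by blast
  ultimately show ?thesis using ne by (simp add: loop_def last_map hd_rev)
qed

text \<open>The joins between \<open>ts\<close> and the ends of the geodesics stay in the Voronoi
  cells of these ends by convexity, so the robber's segment meets no part of the polygon and
  \<open>pang_constant\<close> applies along it.\<close>

lemma loop_invariant:
  assumes P: "geo P" "geo P'" and s: "safe P e f" "safe P' e f" and ts: "ts \<noteq> []"
    "avoids (closed_segment (p e) (p f)) ts" "hd ts \<in> vor (last P)" "last ts \<in> vor (last P')"
  shows "loop e P ts P' = loop f P ts P'"
proof -
  let ?S = "closed_segment (p e) (p f)"
  let ?xs = "map p P @ ts @ rev (map p P')"
  have ne: "map p P \<noteq> []" "rev (map p P') \<noteq> []" using P by (auto simp: geo_def)
  have seg: "?S \<inter> closed_segment (p (last P)) (hd ts) = {}" "?S \<inter> closed_segment (last ts) (p (last P')) = {}"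
    using safe_avoids_vor[OF s(1), of "last P"] safe_avoids_vor[OF s(2), of "last P'"] geo_last P
      vor_segment[OF site_in_vor ts(3)] vor_segment[OF ts(4) site_in_vor] by blast+
  have av: "avoids ?S ?xs"
    using avoids_append[of "map p P" "ts @ rev (map p P')"] avoids_append[of ts "rev (map p P')"]
      ne ts seg avoids_geo[OF P(1) s(1)] avoids_geo[OF P(2) s(2)]
    by (simp add: avoids_rev last_map hd_rev)
  have h: "hd ?xs = p 0" "last ?xs = p 0"
    using geo_hd P ne by (auto simp: hd_map last_rev)
  have "p 0 \<notin> ?S"
  proof -
    have "0 \<in> set P" using geo_hd[OF P(1)] P(1) by (metis geo_def list.set_sel(1))
    then show ?thesis using safe_avoids_vor[OF s(1)] site_in_vor[of 0] by blast
  qed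
  then have "pang (p e) ?xs = pang (p f) ?xs"
    using h av ts(1) by (intro pang_constant[of ?S]) auto
  then show ?thesis using loop_eq P ts s by (simp add: safe_def)
qed

abbreviation W :: "nat \<Rightarrow> nat list \<Rightarrow> complex \<Rightarrow> nat list \<Rightarrow> real" where
  "W z P y P' \<equiv> loop z P [y] P'"

lemma ang_vor:
  assumes "z < n" "geo P" "und P z" "a \<in> vor (last P)" "b \<in> vor (last P)" "c \<in> vor (last P)"
  shows "ang (p z) a b + ang (p z) b c = ang (p z) a c" "ang (p z) b a = - ang (p z) a b"
proof -
  have "convex hull {a, b, c} \<subseteq> vor (last P)" using assms by (intro vor_hull) auto
  then show "ang (p z) a b + ang (p z) b c = ang (p z) a c"
    using und_avoids_vor_last assms by (intro ang_triangle) blast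
  show "ang (p z) b a = - ang (p z) a b"
    using und_avoids_vor_last vor_segment assms by (intro ang_rev) blast
qed

lemma W_indep:
  assumes z: "z < n" and P: "geo P" "und P z" "geo P'" "und P' z"
    and y: "y \<in> vor (last P)" "y \<in> vor (last P')" "y' \<in> vor (last P)" "y' \<in> vor (last P')"
  shows "W z P y P' = W z P y' P'"
proof -
  have "ang (p z) (p (last P)) y + ang (p z) y y' = ang (p z) (p (last P)) y'"
    using z P y site_in_vor by (intro ang_vor) auto
  moreover have "ang (p z) y y' + ang (p z) y' (p (last P')) = ang (p z) y (p (last P'))"
    using z P y site_in_vor by (intro ang_vor(1)[of z P']) auto
  ultimately show ?thesis by (simp add: loop_def)
qed

text \<open>\<open>P'\<close> is travelled back and forth between the root and \<open>y\<close>, so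
  it cancels.\<close>

lemma W_add:
  assumes z: "z < n" and P: "geo P'" "und P' z" and y: "y \<in> vor (last P')"
  shows "W z P y P' + W z P' y P'' = W z P y P''"
proof -
  have "ang (p z) y (p (last P')) = - ang (p z) (p (last P')) y"
    using z P y site_in_vor by (intro ang_vor(2)) auto
  then show ?thesis by (simp add: loop_def)
qed

lemma W_self: "z < n \<Longrightarrow> geo P \<Longrightarrow> und P z \<Longrightarrow> y \<in> vor (last P) \<Longrightarrow> W z P y P = 0"
  using W_add[of z P y P P] by simp

text \<open>The bound on the sum puts \<open>y\<close> within \<open>r\<close> of both ends of the
  last edge, so the triangle lies in both discs of radius \<open>r\<close> around them; a robber in
  it would be near two consecutive vertices of the geodesic.\<close>

lemma und_snoc_hull:
  assumes "geo (G @ [s])" "und (G @ [s]) z" "G \<noteq> []" "dist (p s) y + dist y (p (last G)) \<le> r"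
  shows "p z \<notin> convex hull {p (last G), p s, y}"
proof
  assume z: "p z \<in> convex hull {p (last G), p s, y}"
  define i where "i = length G - 1"
  have i: "Suc i = length G" "(G @ [s]) ! i = last G" "(G @ [s]) ! Suc i = s"
    using assms by (auto simp: i_def nth_append last_conv_nth)
  have "near (last G) s" using assms(1) i unfolding geo_def by (metis length_append_singleton lessI)
  then have gs: "dist (p (last G)) (p s) \<le> r" by (simp add: near_def)
  have "convex hull {p (last G), p s, y} \<subseteq> cball (p (last G)) r"
    using assms gs r_pos by (intro hull_minimal) (auto simp: dist_commute intro: order_trans[OF _ assms(4)])
  moreover have "convex hull {p (last G), p s, y} \<subseteq> cball (p s) r"
    using assms gs r_pos by (intro hull_minimal) (auto simp: dist_commute intro: order_trans[OF _ assms(4)])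
  ultimately have "near z (last G)" "near z s" using z by (auto simp: near_def dist_commute)
  then show False using assms(2) i unfolding und_def by (metis length_append_singleton lessI)
qed

text \<open>The common part \<open>G\<close> cancels. What remains runs from \<open>last G\<close>
  via \<open>s\<close> to \<open>y\<close> and back via \<open>s'\<close>, around two triangles that
  do not contain the robber.\<close>

lemma W_snoc_snoc:
  assumes z: "z < n" and P: "geo (G @ [s])" "und (G @ [s]) z" "geo (G @ [s'])" "und (G @ [s']) z" "G \<noteq> []"
    and y: "y \<in> vor s'" "dist (p s) y + dist y (p (last G)) \<le> r" "dist (p s') y + dist y (p (last G)) \<le> r"
  shows "W z (G @ [s]) y (G @ [s']) = 0"
proof -
  have a: "ang (p z) (p (last G)) (p s) + ang (p z) (p s) y = ang (p z) (p (last G)) y"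
    by (intro ang_triangle und_snoc_hull) fact+
  have b: "ang (p z) (p (last G)) (p s') + ang (p z) (p s') y = ang (p z) (p (last G)) y"
    by (intro ang_triangle und_snoc_hull) fact+
  have c: "ang (p z) y (p s') = - ang (p z) (p s') y"
    using ang_vor(2)[OF z P(3,4), of "p s'" y] y site_in_vor by simp
  have G: "pang (p z) (map p (G @ [s])) = pang (p z) (map p G) + ang (p z) (p (last G)) (p s)" for s
    using pang_append[of "map p G" "[p s]"] \<open>G \<noteq> []\<close> by (simp add: last_map)
  show ?thesis using a b c unfolding loop_def G by simp
qed

lemma W_snoc:
  assumes z: "z < n" and P: "geo (G @ [s])" "und (G @ [s]) z" "geo G" "und G z"
    and y: "y \<in> vor (last G)" "dist (p s) y + dist y (p (last G)) \<le> r"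
  shows "W z (G @ [s]) y G = 0"
proof -
  have ne: "G \<noteq> []" using P by (simp add: geo_def)
  have a: "ang (p z) (p (last G)) (p s) + ang (p z) (p s) y = ang (p z) (p (last G)) y"
    by (intro ang_triangle und_snoc_hull) fact+
  have c: "ang (p z) y (p (last G)) = - ang (p z) (p (last G)) y"
    using ang_vor(2)[OF z P(3,4), of "p (last G)" y] y site_in_vor by simp
  have G: "pang (p z) (map p (G @ [s])) = pang (p z) (map p G) + ang (p z) (p (last G)) (p s)" for s
    using pang_append[of "map p G" "[p s]"] ne by (simp add: last_map)
  show ?thesis using a c unfolding loop_def G by simp
qed

end

section \<open>Taking up the guard of a geodesic\<close>

context geometric_graph
begin

text \<open>Three cops guard \<open>P\<close> by standing on its vertices at the levels \<open>d z - 1\<close>, \<open>d z\<close>, \<open>d z + 1\<close>,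
  clipped to \<open>P\<close>, where \<open>z\<close> is the robber.\<close>
definition level_ix :: "nat list \<Rightarrow> nat \<Rightarrow> nat \<Rightarrow> nat" where
  "level_ix P z j = min (length P - 1) (d z + j - 1)"

abbreviation tgt :: "nat list \<Rightarrow> nat \<Rightarrow> nat \<Rightarrow> nat" where
  "tgt P z j \<equiv> P ! level_ix P z j"

lemma level_ix_less: "geo P \<Longrightarrow> level_ix P z j < length P"
  by (auto simp: level_ix_def geo_def min_def)

lemma level_ix_step:
  assumes "e < n" "f < n" "near e f"
  shows "level_ix P f j \<le> Suc (level_ix P e j)"
  using d_le_Suc[OF assms] by (auto simp: level_ix_def)

lemma geo_nth_near:
  assumes "geo P" "a < length P" "b < length P" "a \<le> Suc b" "b \<le> Suc a"
  shows "near (P ! a) (P ! b)"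
proof -
  consider "a = b" | "a = Suc b" | "b = Suc a" using assms by linarith
  then show ?thesis using assms by cases (auto simp: geo_def near_sym)
qed

lemma tgt_near:
  assumes "geo P" "e < n" "f < n" "near e f"
  shows "near (tgt P e j) (tgt P f j)"
  using assms level_ix_less level_ix_step near_sym by (intro geo_nth_near) auto

lemma tgt_less: "geo P \<Longrightarrow> tgt P z j < n"
  using level_ix_less[of P z j] by (auto simp: geo_def)

lemma tgt_cover:
  assumes "i < length P" "d e \<le> Suc i" "i \<le> Suc (d e)"
  shows "\<exists>j<3. tgt P e j = P ! i"
proof -
  have "level_ix P e (Suc i - d e) = i" using assms by (auto simp: level_ix_def)
  then show ?thesis using assms by (intro exI[of _ "Suc i - d e"]) auto
qed

text \<open>Levels of near vertices differ by at most one. So a vertex of \<open>P\<close> near both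
  \<open>e\<close> and \<open>f\<close> has a level within one of \<open>d e\<close> and is occupied
  when the robber arrives at \<open>f\<close>. If \<open>f\<close> is near the vertices of levels i
  and i + 1, then \<open>d f\<close> is one of these levels, and at least one of the two is within
  one of \<open>d e\<close>. This accounts for the three guards.\<close>

lemma guard_safe:
  assumes P: "geo P" and ef: "e < n" "f < n" "near e f"
    and far: "\<And>j. j < 3 \<Longrightarrow> \<not> near f (tgt P e j)"
  shows "und P f" "\<forall>v\<in>set P. \<not> (near e v \<and> near f v)"
proof -
  have cover: "\<not> near f (P ! i)" if "i < length P" "d e \<le> Suc i" "i \<le> Suc (d e)" for i
    using tgt_cover[OF that] far by metis
  have lev: "P ! i < n" "d (P ! i) = i" if "i < length P" for i using P that by (auto simp: geo_def)
  show *: "\<forall>v\<in>set P. \<not> (near e v \<and> near f v)"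
  proof (intro ballI notI)
    fix v assume v: "v \<in> set P" "near e v \<and> near f v"
    then obtain i where i: "i < length P" "v = P ! i" by (auto simp: in_set_conv_nth)
    then show False
      using cover[of i] d_le_Suc[of e v] d_le_Suc[of v e] v ef lev[of i] near_sym by auto
  qed
  show "und P f"
    unfolding und_def
  proof (intro conjI ballI allI impI notI)
    fix v assume v: "v \<in> set P" "p v = p f"
    then have "near f v" "near e v" using ef r_pos by (auto simp: near_def)
    with * v show False by blast
  next
    fix i assume i: "Suc i < length P" "near f (P ! i) \<and> near f (P ! Suc i)"
    have "d f \<le> Suc i" "i \<le> Suc (d f)" "d f \<le> Suc (Suc i)" "Suc i \<le> Suc (d f)"
      using d_le_Suc[of f "P ! i"] d_le_Suc[of "P ! i" f] d_le_Suc[of f "P ! Suc i"] d_le_Suc[of "P ! Suc i" f]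
        lev[of i] lev[of "Suc i"] i ef near_sym by auto
    moreover have "d e \<le> Suc (d f)" "d f \<le> Suc (d e)" using d_le_Suc ef near_sym by auto
    ultimately show False using cover[of i] cover[of "Suc i"] i by (cases "d e \<le> Suc i") auto
  qed
qed

text \<open>The nine cops form three groups: cop \<open>3 * g + j\<close> is guard \<open>j\<close>
  of group \<open>g\<close>, and a group with \<open>pg g = None\<close> is free.\<close>

definition guarding :: "(nat \<Rightarrow> nat list option) \<Rightarrow> (nat \<Rightarrow> nat) \<Rightarrow> nat \<Rightarrow> bool" where
  "guarding pg C z \<longleftrightarrow> (\<forall>i<9. C i < n) \<and> z < n \<and>
     (\<forall>g<3. \<forall>P. pg g = Some P \<longrightarrow> geo P \<and> und P z \<and> (\<forall>j<3. C (3 * g + j) = tgt P z j))"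

definition safe_all :: "(nat \<Rightarrow> nat list option) \<Rightarrow> nat \<Rightarrow> nat \<Rightarrow> bool" where
  "safe_all pg e f \<longleftrightarrow> e < n \<and> f < n \<and> near e f \<and> (\<forall>g<3. \<forall>P. pg g = Some P \<longrightarrow> safe P e f)"

text \<open>One round: a cop who can reach the robber captures him; otherwise the guards follow
  their targets while the free group \<open>g0\<close> moves by \<open>new\<close>. The continuation
  may assume that the robber's move was safe against all guarded geodesics.\<close>

lemma guarding_step:
  assumes G: "guarding pg C z" and g0: "g0 < 3" "pg g0 = None"
    and new: "\<And>z' j. z' < n \<Longrightarrow> near z z' \<Longrightarrow> j < 3 \<Longrightarrow> new z' j < n \<and> near (C (3 * g0 + j)) (new z' j)"
    and cont: "\<And>z' C'. guarding pg C' z' \<Longrightarrow> safe_all pg z z' \<Longrightarrow>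
      (\<And>j. j < 3 \<Longrightarrow> C' (3 * g0 + j) = new z' j) \<Longrightarrow> (\<And>j. j < 3 \<Longrightarrow> \<not> near z' (C (3 * g0 + j))) \<Longrightarrow>
      force n adj 9 Q C' z'"
  shows "force n adj 9 Q C z"
proof (rule force_step)
  fix z' assume "legal_move n adj z z'"
  then have z': "z < n" "z' < n" "near z z'" by (auto simp: legal_move_iff)
  have C: "C i < n" if "i < 9" for i using G that by (auto simp: guarding_def)
  show "\<exists>C'. (\<forall>i<9. legal_move n adj (C i) (C' i)) \<and> ((\<exists>i<9. C' i = z') \<or> force n adj 9 Q C' z')"
  proof (cases "\<exists>i<9. near (C i) z'")
    case True
    then obtain i where "i < 9" "near (C i) z'" by blast
    then show ?thesis using C z' by (intro exI[of _ "C(i := z')"]) (auto simp: legal_move_iff)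
  next
    case False
    define C' where "C' i = (if i div 3 = g0 then new z' (i mod 3)
      else case pg (i div 3) of Some P \<Rightarrow> tgt P z' (i mod 3) | None \<Rightarrow> C i)" for i
    have gP: "geo P" "und P z" "\<And>j. j < 3 \<Longrightarrow> C (3 * g + j) = tgt P z j" if "g < 3" "pg g = Some P" for g P
      using G that by (auto simp: guarding_def)
    have legal: "legal_move n adj (C i) (C' i)" if "i < 9" for i
    proof -
      have i: "i div 3 < 3" "i mod 3 < 3" "3 * (i div 3) + i mod 3 = i" using that by auto
      show ?thesis
      proof (cases "i div 3 = g0")
        case True
        then show ?thesis using new[OF z'(2,3) i(2)] i C[OF that] by (auto simp: legal_move_iff C'_def)
      next
        case F: False
        show ?thesis
        proof (cases "pg (i div 3)")
          case None
          then show ?thesis using F C[OF that] by (simp add: C'_def legal_move_iff)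
        next
          case (Some P)
          then have "C i = tgt P z (i mod 3)" using gP(3)[OF i(1) Some i(2)] i by simp
          then show ?thesis
            using F Some gP(1)[OF i(1) Some] tgt_near[OF _ z'] tgt_less
            by (simp add: C'_def legal_move_iff)
        qed
      qed
    qed
    have s: "und P z'" "safe P z z'" if "g < 3" "pg g = Some P" for g P
    proof -
      have "\<not> near z' (tgt P z j)" if "j < 3" for j
      proof -
        have "3 * g + j < 9" using \<open>g < 3\<close> that by simp
        then show ?thesis
          using False gP(3)[OF \<open>g < 3\<close> \<open>pg g = Some P\<close> that] near_sym by metis
      qed
      from guard_safe[OF gP(1)[OF that] z' this] show "und P z'" "safe P z z'"
        using gP[OF that] z' by (auto simp: safe_def)
    qed
    have C'g: "C' (3 * g + j) = (if g = g0 then new z' j else case pg g of Some P \<Rightarrow> tgt P z' j | None \<Rightarrow> C (3 * g + j))"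
      if "j < 3" for g j
    proof -
      have "(3 * g + j) div 3 = g" "(3 * g + j) mod 3 = j" using that by auto
      then show ?thesis unfolding C'_def by presburger
    qed
    have "guarding pg C' z'"
      unfolding guarding_def
    proof (intro conjI allI impI)
      show "C' i < n" if "i < 9" for i using legal[OF that] by (simp add: legal_move_iff)
    next
      fix g P assume "g < 3" "pg g = Some P"
      then show "geo P" "und P z'" using gP s by auto
    next
      fix g P j assume "g < 3" "pg g = Some P" "j < (3::nat)"
      then show "C' (3 * g + j) = tgt P z' j" using C'g g0 by auto
    qed (use z' in auto)
    moreover have "safe_all pg z z'" using s z' by (auto simp: safe_all_def)
    moreover have "C' (3 * g0 + j) = new z' j" if "j < 3" for j using C'g[OF that] by simp
    moreover have "\<not> near z' (C (3 * g0 + j))" if "j < 3" for j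
      using False that g0 near_sym by auto
    ultimately have "force n adj 9 Q C' z'" by (rule cont)
    then show ?thesis using legal by blast
  qed
qed

text \<open>The root is where a group can enter any geodesic. \<open>I\<close> stands for a property
  kept by all moves that are safe against the other groups, later the nonvanishing of a winding
  number.\<close>

lemma force_root:
  assumes "guarding pg C z" "g0 < 3" "pg g0 = None" "I z"
    and inv: "\<And>e f. safe_all pg e f \<Longrightarrow> I e \<Longrightarrow> I f"
    and cont: "\<And>C z. guarding pg C z \<Longrightarrow> I z \<Longrightarrow> (\<And>j. j < 3 \<Longrightarrow> C (3 * g0 + j) = 0) \<Longrightarrow> force n adj 9 Q C z"
  shows "force n adj 9 Q C z"
  using assms(1,4)
proof (induction "\<Sum>j<3. d (C (3 * g0 + j))" arbitrary: C z rule: less_induct)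
  case less
  have Cn: "C (3 * g0 + j) < n" if "j < 3" for j using less.prems that assms(2) by (auto simp: guarding_def)
  show ?case
  proof (cases "\<forall>j<3. C (3 * g0 + j) = 0")
    case True
    then show ?thesis using cont less.prems by blast
  next
    case False
    have "\<exists>w. w < n \<and> near v w \<and> (v \<noteq> 0 \<longrightarrow> Suc (d w) = d v) \<and> (v = 0 \<longrightarrow> w = 0)" if "v < n" for v
    proof (cases "d v")
      case 0
      then show ?thesis using that d_eq_0_iff by auto
    next
      case (Suc i)
      then show ?thesis using d_pred[OF that Suc] d_eq_0_iff that near_sym by (metis nat.distinct(1))
    qed
    then obtain par where par: "\<And>v. v < n \<Longrightarrow> par v < n \<and> near v (par v) \<and>
        (v \<noteq> 0 \<longrightarrow> Suc (d (par v)) = d v) \<and> (v = 0 \<longrightarrow> par v = 0)" by metis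
    have le: "d (par (C (3 * g0 + j))) \<le> d (C (3 * g0 + j))"
      "C (3 * g0 + j) \<noteq> 0 \<Longrightarrow> d (par (C (3 * g0 + j))) < d (C (3 * g0 + j))" if "j < 3" for j
      using par[OF Cn[OF that]] by (cases "C (3 * g0 + j) = 0"; force)+
    show ?thesis
    proof (rule guarding_step[OF less.prems(1) assms(2,3), where new = "\<lambda>_ j. par (C (3 * g0 + j))"])
      fix z' C' assume C': "guarding pg C' z'" "safe_all pg z z'" "\<And>j. j < 3 \<Longrightarrow> C' (3 * g0 + j) = par (C (3 * g0 + j))"
      have "(\<Sum>j<3. d (C' (3 * g0 + j))) < (\<Sum>j<3. d (C (3 * g0 + j)))"
      proof (rule sum_strict_mono_ex1)
        show "\<forall>j\<in>{..<3}. d (C' (3 * g0 + j)) \<le> d (C (3 * g0 + j))" using le C' by simp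
        show "\<exists>j\<in>{..<3}. d (C' (3 * g0 + j)) < d (C (3 * g0 + j))" using le C' False by force
      qed simp
      then show "force n adj 9 Q C' z'" using less.hyps C' inv less.prems by blast
    qed (use par Cn in auto)
  qed
qed

text \<open>Each cop climbs one vertex per round, but not beyond its target. Targets move by at most
  one index per round, so a target once reached is kept; before that, either \<open>a j\<close>
  grows, bounded by the length of \<open>R\<close>, or the target comes down to it.\<close>

lemma force_climb:
  assumes "guarding pg C z" "g0 < 3" "pg g0 = None" "I z" and R: "geo R"
    and a: "\<And>j. j < 3 \<Longrightarrow> C (3 * g0 + j) = R ! a j \<and> a j \<le> level_ix R z j"
    and inv: "\<And>e f. safe_all pg e f \<Longrightarrow> I e \<Longrightarrow> I f"
    and cont: "\<And>C z. guarding pg C z \<Longrightarrow> I z \<Longrightarrow> (\<And>j. j < 3 \<Longrightarrow> C (3 * g0 + j) = tgt R z j) \<Longrightarrow> force n adj 9 Q C z"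
  shows "force n adj 9 Q C z"
  using assms(1,4) a
proof (induction "\<Sum>j<3. if a j = level_ix R z j then 0 else length R - a j" arbitrary: C z a rule: less_induct)
  case less
  show ?case
  proof (cases "\<forall>j<3. a j = level_ix R z j")
    case True
    show ?thesis
    proof (rule cont[OF less.prems(1,2)])
      show "C (3 * g0 + j) = tgt R z j" if "j < 3" for j using less.prems(3)[OF that] True that by simp
    qed
  next
    case False
    define a' where "a' z' j = min (Suc (a j)) (level_ix R z' j)" for z' j
    have zn: "z < n" using less.prems by (simp add: guarding_def)
    have a': "a' z' j < length R" "a' z' j \<le> Suc (a j)" "a j \<le> Suc (a' z' j)" "a j < length R"
      if "z' < n" "near z z'" "j < 3" for z' j
    proof -
      show "a' z' j < length R" "a' z' j \<le> Suc (a j)"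
        using level_ix_less[OF R, of z' j] by (auto simp: a'_def)
      have "level_ix R z j \<le> Suc (level_ix R z' j)" using level_ix_step[of z' z R j] that zn near_sym by auto
      then show "a j \<le> Suc (a' z' j)" using less.prems(3)[OF that(3)] by (auto simp: a'_def)
      show "a j < length R" using less.prems(3)[OF that(3)] level_ix_less[OF R, of z j] by auto
    qed
    show ?thesis
    proof (rule guarding_step[OF less.prems(1) assms(2,3), where new = "\<lambda>z' j. R ! a' z' j"])
      fix z' j assume h: "z' < n" "near z z'" "j < (3::nat)"
      then show "R ! a' z' j < n \<and> near (C (3 * g0 + j)) (R ! a' z' j)"
        using a'[OF h] geo_nth_near[OF R] less.prems(3)[OF h(3)] R by (auto simp: geo_def)
    next
      fix z' C' assume C': "guarding pg C' z'" "safe_all pg z z'" "\<And>j. j < 3 \<Longrightarrow> C' (3 * g0 + j) = R ! a' z' j"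
      have z': "z' < n" "near z z'" using C' by (auto simp: safe_all_def)
      let ?m = "\<lambda>a z j. if a j = level_ix R z j then 0 else length R - a j"
      have le: "?m (a' z') z' j \<le> ?m a z j" "a j \<noteq> level_ix R z j \<Longrightarrow> ?m (a' z') z' j < ?m a z j" if "j < 3" for j
      proof -
        have "level_ix R z j \<le> Suc (level_ix R z' j)" "level_ix R z' j \<le> Suc (level_ix R z j)"
          using level_ix_step z' zn near_sym by auto
        moreover have "a j \<le> level_ix R z j" using less.prems(3)[OF that] by simp
        moreover note level_ix_less[OF R, of z j] level_ix_less[OF R, of z' j]
        ultimately show "?m (a' z') z' j \<le> ?m a z j" "a j \<noteq> level_ix R z j \<Longrightarrow> ?m (a' z') z' j < ?m a z j"
          by (auto simp: a'_def min_def)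
      qed
      have "(\<Sum>j<3. ?m (a' z') z' j) < (\<Sum>j<3. ?m a z j)"
      proof (rule sum_strict_mono_ex1)
        show "\<forall>j\<in>{..<3}. ?m (a' z') z' j \<le> ?m a z j" using le by simp
        show "\<exists>j\<in>{..<3}. ?m (a' z') z' j < ?m a z j" using le False by (metis lessThan_iff)
      qed simp
      then show "force n adj 9 Q C' z'"
      proof (rule less.hyps)
        show "I z'" using inv C' less.prems by blast
        show "\<And>j. j < 3 \<Longrightarrow> C' (3 * g0 + j) = R ! a' z' j \<and> a' z' j \<le> level_ix R z' j"
          using C' by (auto simp: a'_def)
      qed fact
    qed
  qed
qed

lemma force_guard:
  assumes "guarding pg C z" "g0 < 3" "pg g0 = None" "I z" and R: "geo R"
    and inv: "\<And>e f. safe_all pg e f \<Longrightarrow> I e \<Longrightarrow> I f"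
  shows "force n adj 9 (\<lambda>C z. guarding (pg(g0 \<mapsto> R)) C z \<and> I z) C z"
  using assms(1-4) inv
proof (rule force_root)
  let ?Q = "\<lambda>C z. guarding (pg(g0 \<mapsto> R)) C z \<and> I z"
  fix C z assume C: "guarding pg C z" "I z" "\<And>j. j < 3 \<Longrightarrow> C (3 * g0 + j) = 0"
  show "force n adj 9 ?Q C z"
    using C(1) assms(2,3) C(2) R _ inv
  proof (rule force_climb[where a = "\<lambda>_. 0"])
    show "C (3 * g0 + j) = R ! 0 \<and> 0 \<le> level_ix R z j" if "j < 3" for j
      using C(3)[OF that] geo_hd[OF R] R by (simp add: geo_def hd_conv_nth)
  next
    fix C z assume C: "guarding pg C z" "I z" "\<And>j. j < 3 \<Longrightarrow> C (3 * g0 + j) = tgt R z j"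
    have zn: "z < n" using C by (simp add: guarding_def)
    \<comment> \<open>The group is in place, but \<open>und R\<close> is only known for a robber who
      has survived one more move.\<close>
    show "force n adj 9 ?Q C z"
    proof (rule guarding_step[OF C(1) assms(2,3), where new = "\<lambda>z' j. tgt R z' j"])
      fix z' j assume "z' < n" "near z z'" "j < (3::nat)"
      then show "tgt R z' j < n \<and> near (C (3 * g0 + j)) (tgt R z' j)"
        using C(3) tgt_less[OF R] tgt_near[OF R zn] by simp
    next
      fix z' C' assume C': "guarding pg C' z'" "safe_all pg z z'" "\<And>j. j < 3 \<Longrightarrow> C' (3 * g0 + j) = tgt R z' j"
        "\<And>j. j < 3 \<Longrightarrow> \<not> near z' (C (3 * g0 + j))"
      have z': "z' < n" "near z z'" using C' by (auto simp: safe_all_def)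
      have "und R z'" using guard_safe(1)[OF R zn z'] C'(4) C(3) by simp
      then have "guarding (pg(g0 \<mapsto> R)) C' z'" using C'(1,3) R by (auto simp: guarding_def)
      moreover have "I z'" using inv C' C by blast
      ultimately show "force n adj 9 ?Q C' z'" by (simp add: force_now)
    qed
  qed
qed

end

section \<open>Geodesic labels of the grid nodes\<close>

context arrangement
begin

definition is_prod :: "complex set \<Rightarrow> bool" where
  "is_prod A \<longleftrightarrow> (\<exists>S S'. A = prodset S S')"

lemma is_prod_UNIV: "is_prod UNIV"
  unfolding is_prod_def by (intro exI[of _ "\<lambda>_. UNIV"]) (simp add: prodset_def)

lemma is_prod_Int: "is_prod A \<Longrightarrow> is_prod B \<Longrightarrow> is_prod (A \<inter> B)"
proof -
  assume "is_prod A" "is_prod B"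
  then obtain S S' T T' where "A = prodset S S'" "B = prodset T T'" by (auto simp: is_prod_def)
  then have "A \<inter> B = prodset (\<lambda>l. S l \<inter> T l) (\<lambda>a. S' a \<inter> T' a)" by (auto simp: prodset_def)
  then show ?thesis unfolding is_prod_def by blast
qed

lemma is_prod_INT: "finite I \<Longrightarrow> (\<And>i. i \<in> I \<Longrightarrow> is_prod (A i)) \<Longrightarrow> is_prod (\<Inter>i\<in>I. A i)"
  by (induction rule: finite_induct) (auto intro: is_prod_UNIV is_prod_Int)

lemma is_prod_line: "l \<in> L \<Longrightarrow> is_prod {t. sg l t \<in> \<Sigma>}"
  unfolding is_prod_def
  by (intro exI[of _ "\<lambda>l'. if l' = l then \<Sigma> else UNIV"] exI[of _ "\<lambda>_. UNIV"]) (auto simp: prodset_def)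

lemma is_prod_vertical: "a \<in> X \<Longrightarrow> is_prod {t. sx a t \<in> \<Sigma>}"
  unfolding is_prod_def
  by (intro exI[of _ "\<lambda>a'. if a' = a then \<Sigma> else UNIV"] exI[of _ "\<lambda>_. UNIV"]) (auto simp: prodset_def)

abbreviation "grid_nodes \<equiv> {..JJ} \<times> {..KK}"

definition pos :: "nat \<times> nat \<Rightarrow> complex" where
  "pos v = pt (fst v) (snd v)"

lemma nodes_in_iff: "v \<in> nodes_in H \<longleftrightarrow> v \<in> grid_nodes \<and> pos v \<in> H"
  by (cases v) (auto simp: nodes_in_def pos_def)

lemma unit_step_sym: "unit_step v w \<longleftrightarrow> unit_step w v"
  by (cases v; cases w) auto

end

text \<open>\<open>bis\<close> and \<open>seg\<close> make nonempty Voronoi cells and segments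
  between vertices unions of faces, \<open>site\<close> makes every vertex a node, and
  \<open>box\<close> keeps the boundary of the grid away from the robber.\<close>

locale geo_grid = geometric_graph + arrangement +
  assumes bis: "\<And>s v. s < n \<Longrightarrow> v < n \<Longrightarrow> p s \<noteq> p v \<Longrightarrow>
      (\<exists>l\<in>L. \<exists>\<sigma>\<in>{1, -1}. \<forall>t. sgn (dist t (p v) - dist t (p s)) = \<sigma> * sg l t) \<or>
      (\<exists>a\<in>X. \<exists>\<sigma>\<in>{1, -1}. \<forall>t. sgn (dist t (p v) - dist t (p s)) = \<sigma> * sx a t)"
    and seg: "\<And>s v. s < n \<Longrightarrow> v < n \<Longrightarrow> p s \<noteq> p v \<Longrightarrow> is_prod (closed_segment (p s) (p v))"
    and site: "\<And>s. s < n \<Longrightarrow> Re (p s) \<in> X \<and> (\<exists>l\<in>L. Im (p s) = lv l (Re (p s)))"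
    and box: "\<And>s. s < n \<Longrightarrow> (\<exists>x\<in>X. x < Re (p s)) \<and> (\<exists>x\<in>X. Re (p s) < x)"
begin

text \<open>Bisectors belong to the arrangement, and passing to the closure of a face only turns
  signs into 0, which closed cells permit.\<close>

lemma dom_vor:
  assumes "dom y t" "s < n" "t \<in> vor s"
  shows "y \<in> vor s"
  unfolding vor_def
proof (intro CollectI allI impI)
  fix v assume v: "v < n"
  show "dist y (p s) \<le> dist y (p v)"
  proof (cases "p s = p v")
    case False
    have "sgn (dist y (p v) - dist y (p s)) = 0 \<or>
        sgn (dist y (p v) - dist y (p s)) = sgn (dist t (p v) - dist t (p s))"
      using bis[OF assms(2) v False] assms(1) unfolding dom_def by fastforce
    moreover have "0 \<le> dist t (p v) - dist t (p s)" using assms(3) v by (simp add: vor_def)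
    then have "sgn (dist t (p v) - dist t (p s)) \<ge> 0" by (metis sgn_less less_le_not_le linorder_not_le)
    ultimately have "sgn (dist y (p v) - dist y (p s)) \<ge> 0" by (metis order_refl)
    then show ?thesis by (simp add: sgn_real_def split: if_splits)
  qed simp
qed

text \<open>The least index breaks ties, which turns the overlapping closed cells into a partition
  of the plane.\<close>

definition nsite :: "complex \<Rightarrow> nat" where
  "nsite t = (LEAST s. s < n \<and> t \<in> vor s)"

lemma nsite: "nsite t < n" "t \<in> vor (nsite t)"
proof -
  define s where "s = arg_min_on (\<lambda>v. dist t (p v)) {..<n}"
  have "s \<in> {..<n}" unfolding s_def using n_pos by (intro arg_min_if_finite(1)) auto
  moreover have "dist t (p s) \<le> dist t (p v)" if "v < n" for v
    unfolding s_def using that by (intro arg_min_least) auto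
  ultimately have "s < n \<and> t \<in> vor s" by (auto simp: vor_def)
  from LeastI[of "\<lambda>s. s < n \<and> t \<in> vor s", OF this] show "nsite t < n" "t \<in> vor (nsite t)"
    by (simp_all add: nsite_def)
qed

lemma nsite_le: "s < n \<Longrightarrow> t \<in> vor s \<Longrightarrow> nsite t \<le> s"
  unfolding nsite_def by (rule Least_le) simp

lemma nsite_eq_iff:
  assumes "s < n"
  shows "nsite t = s \<longleftrightarrow> (\<forall>v<n. dist t (p s) \<le> dist t (p v) \<and> (v < s \<longrightarrow> dist t (p s) < dist t (p v)))"
proof
  assume s: "nsite t = s"
  have le: "dist t (p s) \<le> dist t (p v)" if "v < n" for v using nsite(2)[of t] s that by (auto simp: vor_def)
  moreover have "dist t (p s) < dist t (p v)" if v: "v < n" "v < s" for v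
  proof (rule ccontr)
    assume "\<not> ?thesis"
    then have "t \<in> vor v" using le by (force simp: vor_def)
    then have "nsite t \<le> v" by (rule nsite_le[OF v(1)])
    then show False using s v by simp
  qed
  ultimately show "\<forall>v<n. dist t (p s) \<le> dist t (p v) \<and> (v < s \<longrightarrow> dist t (p s) < dist t (p v))" by blast
next
  assume h: "\<forall>v<n. dist t (p s) \<le> dist t (p v) \<and> (v < s \<longrightarrow> dist t (p s) < dist t (p v))"
  then have "t \<in> vor s" by (auto simp: vor_def)
  then have "nsite t \<le> s" using nsite_le assms by blast
  moreover have "\<not> nsite t < s"
  proof
    assume "nsite t < s"
    then have "dist t (p s) < dist t (p (nsite t))" using h nsite(1) by blast
    moreover have "dist t (p (nsite t)) \<le> dist t (p s)" using nsite(2)[of t] assms by (simp add: vor_def)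
    ultimately show False by simp
  qed
  ultimately show "nsite t = s" by simp
qed

lemma nsite_site: "nsite (p (nsite t)) = nsite t"
proof -
  have "dist (p (nsite t)) (p v) > 0" if "v < n" "v < nsite t" for v
  proof -
    have "dist t (p (nsite t)) < dist t (p v)" using nsite_eq_iff[OF nsite(1)] that by blast
    then show ?thesis by auto
  qed
  then show ?thesis using nsite_eq_iff[OF nsite(1)[of t], of "p (nsite t)"] by auto
qed

text \<open>The cell is an intersection of half-planes, open against smaller indices and closed
  against larger ones. It is empty if a vertex of smaller index sits at the same point.\<close>

lemma cell_prod:
  assumes "s < n"
  shows "convex {t. nsite t = s}" "{t. nsite t = s} = {} \<or> is_prod {t. nsite t = s}"
proof -
  define A where "A v = {t. dist t (p s) \<le> dist t (p v) \<and> (v < s \<longrightarrow> dist t (p s) < dist t (p v))}" for v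
  have A: "A v = (if v < s then {t. dist t (p s) < dist t (p v)} else {t. dist t (p s) \<le> dist t (p v)})" for v
    by (auto simp: A_def)
  have eq: "{t. nsite t = s} = (\<Inter>v\<in>{..<n}. A v)" using nsite_eq_iff[OF assms] by (auto simp: A_def)
  have "convex (A v)" for v unfolding A by (simp add: convex_dist_le convex_dist_less)
  then show "convex {t. nsite t = s}" unfolding eq by (simp add: convex_INT)
  show "{t. nsite t = s} = {} \<or> is_prod {t. nsite t = s}"
  proof (cases "\<exists>v<s. p v = p s")
    case True
    then obtain v where v: "v < s" "p v = p s" by blast
    then have "A v = {}" by (auto simp: A)
    then show ?thesis using eq v assms by force
  next
    case False
    have "is_prod (A v)" if v: "v < n" for v
    proof (cases "p v = p s")
      case True
      then have "A v = UNIV" using False by (auto simp: A)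
      then show ?thesis by (simp add: is_prod_UNIV)
    next
      case ne: False
      define \<Sigma> :: "real set" where "\<Sigma> = (if v < s then {1} else {0, 1})"
      have Av: "A v = {t. sgn (dist t (p v) - dist t (p s)) \<in> \<Sigma>}"
        by (auto simp: A \<Sigma>_def sgn_real_def split: if_splits)
      from bis[OF assms v ne[symmetric]] show ?thesis
      proof (elim disjE bexE)
        fix l \<sigma> assume l: "l \<in> L" "\<forall>t. sgn (dist t (p v) - dist t (p s)) = \<sigma> * sg l t"
        then have "A v = {t. sg l t \<in> {x. \<sigma> * x \<in> \<Sigma>}}" using Av by simp
        then show ?thesis using is_prod_line[OF l(1)] by metis
      next
        fix a \<sigma> assume a: "a \<in> X" "\<forall>t. sgn (dist t (p v) - dist t (p s)) = \<sigma> * sx a t"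
        then have "A v = {t. sx a t \<in> {x. \<sigma> * x \<in> \<Sigma>}}" using Av by simp
        then show ?thesis using is_prod_vertical[OF a(1)] by metis
      qed
    qed
    then show ?thesis unfolding eq by (intro disjI2 is_prod_INT) auto
  qed
qed

lemma cell_connected:
  assumes "v \<in> grid_nodes" "w \<in> grid_nodes" "nsite (pos v) = nsite (pos w)"
  shows "(step_in {t. nsite t = nsite (pos v)})\<^sup>*\<^sup>* v w"
proof -
  have "{t. nsite t = nsite (pos v)} \<noteq> {}" by blast
  then obtain S S' where "{t. nsite t = nsite (pos v)} = prodset S S'"
    using cell_prod(2)[OF nsite(1)] unfolding is_prod_def by metis
  then show ?thesis
    using assms by (intro prodset_connected cell_prod(1) nsite(1)) (auto simp: nodes_in_iff)
qed

lemma site_pos: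
  assumes "s < n"
  obtains v where "v \<in> grid_nodes" "pos v = p s"
proof -
  obtain l where "l \<in> L" "Im (p s) = lv l (Re (p s))" "Re (p s) \<in> X" using site[OF assms] by blast
  then obtain i k where "i \<le> JJ" "k \<le> KK" "pt i k = p s" using site_node by blast
  then show ?thesis using that[of "(i, k)"] by (simp add: pos_def)
qed

definition closest :: "nat \<Rightarrow> nat \<Rightarrow> bool" where
  "closest c s \<longleftrightarrow> s < n \<and> Suc (d s) = d c \<and> (\<forall>w<n. Suc (d w) = d c \<longrightarrow> dist (p c) (p s) \<le> dist (p c) (p w))"

definition prv :: "nat \<Rightarrow> nat" where
  "prv c = (LEAST s. closest c s)"

lemma prv:
  assumes "c < n" "d c \<noteq> 0"
  shows "closest c (prv c)" "near c (prv c)"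
proof -
  obtain i where i: "d c = Suc i" using assms by (cases "d c") auto
  obtain w where w: "w < n" "d w = i" "near w c" using d_pred[OF assms(1) i] .
  define A where "A = {s. s < n \<and> Suc (d s) = d c}"
  have A: "finite A" "w \<in> A" using w i by (auto simp: A_def)
  define s where "s = arg_min_on (\<lambda>v. dist (p c) (p v)) A"
  have "s \<in> A" unfolding s_def using A by (intro arg_min_if_finite(1)) auto
  moreover have "dist (p c) (p s) \<le> dist (p c) (p v)" if "v \<in> A" for v
    unfolding s_def using that A by (intro arg_min_least) auto
  ultimately have "closest c s" by (auto simp: closest_def A_def)
  then show 1: "closest c (prv c)" unfolding prv_def by (rule LeastI)
  then show "near c (prv c)" using w i near_sym[of w c] unfolding closest_def near_def by force
qed

lemma prv_le: "closest c s \<Longrightarrow> prv c \<le> s"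
  unfolding prv_def by (rule Least_le)

definition onseg :: "nat \<Rightarrow> nat \<Rightarrow> complex \<Rightarrow> bool" where
  "onseg i q t \<longleftrightarrow> (\<exists>c<n. nsite (p c) = c \<and> d c = Suc i \<and> prv c = q \<and> t \<in> closed_segment (p c) (p q))"

text \<open>\<open>s\<close> is at least as close to \<open>t\<close> as both ends of a segment of
  length at most \<open>r\<close>, so it is near both ends and its level is within one of i and of i
  + 1. If its level is i, it is at least as close to \<open>c\<close> as \<open>q\<close> is, so
  \<open>s\<close> and \<open>q\<close> compete in both selections.\<close>

lemma onseg_bounds:
  assumes "onseg i q t" "s < n" "t \<in> vor s"
  shows "q < n" "d q = i" "dist (p s) t + dist t (p q) \<le> r" "near q s" "d s = i \<or> d s = Suc i"
    "nsite t = s \<Longrightarrow> d s = i \<Longrightarrow> s = q"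
proof -
  obtain c where c: "c < n" "d c = Suc i" "prv c = q" "t \<in> closed_segment (p c) (p q)"
    using assms(1) by (auto simp: onseg_def)
  have q: "closest c q" "near c q" using prv[of c] c by auto
  show qn: "q < n" "d q = i" using q c by (auto simp: closest_def)
  have e: "dist (p c) (p q) = dist (p c) t + dist t (p q)" using c by (intro dist_closed_segment)
  have sc: "dist t (p s) \<le> dist t (p c)" and sq: "dist t (p s) \<le> dist t (p q)"
    using assms c qn by (auto simp: vor_def)
  show b: "dist (p s) t + dist t (p q) \<le> r" using e sc q by (simp add: near_def dist_commute)
  then show qs: "near q s" unfolding near_def by (metis dist_commute dist_triangle order_trans)
  have "dist (p s) (p c) \<le> dist t (p s) + dist t (p c)" by (metis dist_commute dist_triangle)
  then have cs: "near c s" using e sq q by (simp add: near_def dist_commute)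
  have "d s \<le> Suc i" using d_le_Suc[of q s] qn assms qs by auto
  moreover have "Suc i \<le> Suc (d s)" using d_le_Suc[of s c] c assms cs near_sym by auto
  ultimately show "d s = i \<or> d s = Suc i" by auto
  assume s: "nsite t = s" "d s = i"
  have "dist (p c) (p s) \<le> dist (p c) t + dist t (p s)" by (rule dist_triangle)
  then have 1: "dist (p c) (p s) \<le> dist (p c) (p q)" using e sq by simp
  have "closest c s" unfolding closest_def using 1 q s c assms
    by (auto simp: closest_def intro: order_trans)
  \<comment> \<open>\<open>prv\<close> and \<open>nsite\<close> both prefer the least index; each
    yields one of the two inequalities.\<close>
  then have "q \<le> s" using prv_le c by blast
  moreover have "t \<in> vor q"
  proof -
    have "dist (p c) (p q) \<le> dist (p c) (p s)" using q s c assms by (auto simp: closest_def)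
    also have "\<dots> \<le> dist (p c) t + dist t (p s)" by (rule dist_triangle)
    finally have "dist t (p q) \<le> dist t (p s)" using e by simp
    then show ?thesis using assms(3) by (force simp: vor_def)
  qed
  then have "s \<le> q" using nsite_le[OF qn(1)] s by blast
  ultimately show "s = q" by simp
qed

text \<open>Exchange argument at the meeting point: \<open>q'\<close> is at least as close to
  \<open>t\<close> as \<open>q\<close>, since otherwise \<open>c'\<close> would have preferred
  \<open>q\<close>; so \<open>q'\<close> is a closest choice for \<open>c\<close>, too. The least
  index decides, and the situation is symmetric.\<close>

lemma onseg_unique:
  assumes "onseg i q t" "onseg i q' t"
  shows "q = q'"
proof -
  have *: "q \<le> q'" if q: "onseg i q t" "onseg i q' t" for q q'
  proof -
    obtain c where c: "c < n" "d c = Suc i" "prv c = q" "t \<in> closed_segment (p c) (p q)"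
      using q by (auto simp: onseg_def)
    obtain c' where c': "c' < n" "d c' = Suc i" "prv c' = q'" "t \<in> closed_segment (p c') (p q')"
      using q by (auto simp: onseg_def)
    have cl: "closest c q" "closest c' q'" using prv c c' by auto
    have e: "dist (p c) (p q) = dist (p c) t + dist t (p q)" "dist (p c') (p q') = dist (p c') t + dist t (p q')"
      using c c' by (auto intro: dist_closed_segment)
    have "dist (p c') (p q') \<le> dist (p c') (p q)" using cl c c' by (auto simp: closest_def)
    moreover have "dist (p c') (p q) \<le> dist (p c') t + dist t (p q)" by (rule dist_triangle)
    ultimately have "dist t (p q') \<le> dist t (p q)" using e by simp
    moreover have "dist (p c) (p q') \<le> dist (p c) t + dist t (p q')" by (rule dist_triangle)
    ultimately have "dist (p c) (p q') \<le> dist (p c) (p q)" using e by simp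
    moreover have "dist (p c) (p q) \<le> dist (p c) (p w)" if "w < n" "Suc (d w) = d c" for w
      using cl(1) that unfolding closest_def by blast
    moreover have "q' < n" "Suc (d q') = d c" using cl(2) c c' by (auto simp: closest_def)
    ultimately have "closest c q'" unfolding closest_def by (meson order_trans)
    then show ?thesis using prv_le c by blast
  qed
  show ?thesis using *[OF assms] *[OF assms(2,1)] by simp
qed

text \<open>A vertex at the same point as \<open>q\<close> has the same level, so \<open>prv\<close>
  would have preferred a smaller index there. At level 0 there is only the root, which has the least
  index of all.\<close>

lemma onseg_end:
  assumes "onseg i q t"
  shows "nsite (p q) = q"
proof -
  obtain c where c: "c < n" "nsite (p c) = c" "d c = Suc i" "prv c = q"
    using assms by (auto simp: onseg_def)
  then have on: "onseg i q (p q)" by (auto simp: onseg_def)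
  define s where "s = nsite (p q)"
  have s: "s < n" "p q \<in> vor s" using nsite by (auto simp: s_def)
  note b = onseg_bounds[OF on s]
  have "dist (p q) (p s) = 0" using s b(1) by (force simp: vor_def)
  then have pq: "p s = p q" by simp
  have "d s = i"
  proof (cases i)
    case 0
    then have "q = 0" using b d_eq_0_iff by auto
    then have "s \<le> 0" using nsite_le[OF b(1) site_in_vor] by (simp add: s_def)
    then show ?thesis using 0 b d_eq_0_iff n_pos by auto
  next
    case (Suc j)
    obtain w where w: "w < n" "d w = j" "near w q" using d_pred[OF b(1)] b(2) Suc by metis
    then have "near w s" by (simp add: near_def pq)
    then have "d s \<le> i" using d_le_Suc[OF w(1) s(1)] w Suc by auto
    then show ?thesis using b(5) by auto
  qed
  then show ?thesis using b(6) by (simp add: s_def)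
qed

lemma onseg_connected:
  assumes "onseg i q (pos v)" "v \<in> grid_nodes"
  obtains w H where "w \<in> grid_nodes" "pos w = p q" "(step_in H)\<^sup>*\<^sup>* v w" "\<And>t. t \<in> H \<Longrightarrow> onseg i q t"
proof -
  obtain c where c: "c < n" "nsite (p c) = c" "d c = Suc i" "prv c = q" "pos v \<in> closed_segment (p c) (p q)"
    using assms by (auto simp: onseg_def)
  have q: "closest c q" using prv[of c] c by auto
  then have qn: "q < n" by (simp add: closest_def)
  have "p c \<noteq> p q"
  proof
    assume "p c = p q"
    then have "c = q" using onseg_end[OF assms(1)] c(2) by simp
    then show False using q by (simp add: closest_def)
  qed
  define H where "H = closed_segment (p c) (p q)"
  obtain S S' where S: "H = prodset S S'" using seg[OF c(1) qn \<open>p c \<noteq> p q\<close>] by (auto simp: H_def is_prod_def)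
  obtain w where w: "w \<in> grid_nodes" "pos w = p q" using site_pos[OF qn] .
  have "(step_in H)\<^sup>*\<^sup>* v w"
    using w assms c by (intro prodset_connected[OF _ S]) (auto simp: nodes_in_iff H_def)
  moreover have "onseg i q t" if "t \<in> H" for t using that c by (auto simp: onseg_def H_def)
  ultimately show ?thesis using that w by blast
qed

end

section \<open>Construction of the labels by induction on the level\<close>

context geo_grid
begin

declare unit_step.simps [simp del]

abbreviation ct :: "nat \<times> nat \<Rightarrow> nat" where
  "ct v \<equiv> nsite (pos v)"

text \<open>The value of \<open>W\<close> does not depend on \<open>y\<close>, see \<open>W_indep\<close>.\<close>
definition trivial_edge :: "(nat \<times> nat \<Rightarrow> nat list) \<Rightarrow> nat \<times> nat \<Rightarrow> nat \<times> nat \<Rightarrow> bool" where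
  "trivial_edge lab v w \<longleftrightarrow> (\<forall>z<n. und (lab v) z \<longrightarrow> und (lab w) z \<longrightarrow>
     (\<forall>y\<in>vor (ct v) \<inter> vor (ct w). W z (lab v) y (lab w) = 0))"

lemma trivial_edgeI:
  assumes "geo (lab v)" "geo (lab w)" "last (lab v) = ct v" "last (lab w) = ct w"
    and "y \<in> vor (ct v)" "y \<in> vor (ct w)"
    and "\<And>z. z < n \<Longrightarrow> und (lab v) z \<Longrightarrow> und (lab w) z \<Longrightarrow> W z (lab v) y (lab w) = 0"
  shows "trivial_edge lab v w"
  unfolding trivial_edge_def
proof (intro allI impI ballI)
  fix z y' assume z: "z < n" "und (lab v) z" "und (lab w) z" "y' \<in> vor (ct v) \<inter> vor (ct w)"
  then have "W z (lab v) y' (lab w) = W z (lab v) y (lab w)" using assms by (intro W_indep) auto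
  then show "W z (lab v) y' (lab w) = 0" using assms z by simp
qed

lemma unit_vor:
  assumes "unit_step v w" "v \<in> grid_nodes" "w \<in> grid_nodes"
  obtains y where "y \<in> {pos v, pos w}" "y \<in> vor (ct v)" "y \<in> vor (ct w)"
proof -
  have "\<exists>y\<in>{pos v, pos w}. dom y (pos v) \<and> dom y (pos w)"
    using unit_corner[OF assms] by (simp add: pos_def case_prod_beta)
  then obtain y where "y \<in> {pos v, pos w}" "dom y (pos v)" "dom y (pos w)" by blast
  then show ?thesis using that dom_vor nsite by blast
qed

definition good_labels :: "nat \<Rightarrow> (nat \<times> nat \<Rightarrow> nat list) \<Rightarrow> bool" where
  "good_labels i lab \<longleftrightarrow> (\<forall>v\<in>grid_nodes. d (ct v) \<le> i \<longrightarrow> geo (lab v) \<and> last (lab v) = ct v) \<and>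
     (\<forall>\<phi>::nat \<times> nat \<Rightarrow> bool.
       (\<forall>v\<in>grid_nodes. \<forall>w\<in>grid_nodes. d (ct v) \<le> i \<longrightarrow> d (ct w) \<le> i \<longrightarrow> unit_step v w \<longrightarrow>
          trivial_edge lab v w \<longrightarrow> \<phi> v = \<phi> w) \<longrightarrow>
       (\<forall>v\<in>grid_nodes. \<forall>w\<in>grid_nodes. d (ct v) \<le> i \<longrightarrow> d (ct w) \<le> i \<longrightarrow> \<phi> v = \<phi> w))"

lemma trivial_same:
  assumes "geo (lab v)" "last (lab v) = ct v" "lab v = lab w" "ct v = ct w"
  shows "trivial_edge lab v w"
  unfolding trivial_edge_def using W_self assms by auto

lemma good_labels_0: "good_labels 0 (\<lambda>_. [0])"
  unfolding good_labels_def
proof (intro conjI allI impI ballI)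
  fix v assume "d (ct v) \<le> 0"
  then show "geo [0]" "last [0] = ct v" using geo_root d_eq_0_iff nsite by auto
next
  fix \<phi> :: "nat \<times> nat \<Rightarrow> bool" and v w
  assume \<phi>: "\<forall>v\<in>grid_nodes. \<forall>w\<in>grid_nodes. d (ct v) \<le> 0 \<longrightarrow> d (ct w) \<le> 0 \<longrightarrow> unit_step v w \<longrightarrow>
          trivial_edge (\<lambda>_. [0]) v w \<longrightarrow> \<phi> v = \<phi> w"
    and vw: "v \<in> grid_nodes" "w \<in> grid_nodes" "d (ct v) \<le> 0" "d (ct w) \<le> 0"
  have c: "ct v = 0" "ct w = 0" using vw d_eq_0_iff nsite by auto
  have "ct v = ct w" using c by simp
  then have "(step_in {t. nsite t = ct v})\<^sup>*\<^sup>* v w" by (rule cell_connected[OF vw(1,2)])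
  then show "\<phi> v = \<phi> w"
  proof (induction rule: rtranclp_induct)
    case (step x y)
    then have xy: "ct x = 0" "ct y = 0" "x \<in> grid_nodes" "y \<in> grid_nodes" "unit_step x y"
      using c by (auto simp: step_in_def nodes_in_iff)
    have "trivial_edge (\<lambda>_. [0]) x y" using xy geo_root by (intro trivial_same) auto
    then show ?case using step \<phi> xy d_eq_0_iff[of 0] n_pos by simp
  qed simp
qed

text \<open>There are two kinds of new nodes. A threaded node (\<open>thr\<close>) lies on a segment
  to the previous level; following the segment leads to a node \<open>att v\<close> in the cell of
  its end, whose label is prolonged by one vertex. The others (\<open>Nn\<close>) copy the label of
  a threaded node of their cell. The choice is the same along the whole way, so the edges passed are
  trivial and link the new nodes to the old ones.\<close>

lemma good_labels_Suc:
  assumes good: "good_labels i lab"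
  shows "\<exists>lab'. good_labels (Suc i) lab'"
proof -
  have lab: "geo (lab v)" "last (lab v) = ct v" if "v \<in> grid_nodes" "d (ct v) \<le> i" for v
    using good that by (auto simp: good_labels_def)
  define thr where "thr v \<longleftrightarrow> v \<in> grid_nodes \<and> d (ct v) = Suc i \<and> (\<exists>q. onseg i q (pos v))" for v
  define tg where "tg v = (THE q. onseg i q (pos v))" for v
  have tg: "tg v = q" if "onseg i q (pos v)" for v q
    unfolding tg_def using that onseg_unique by blast
  have thr_tg: "onseg i (tg v) (pos v)" if "thr v" for v using that tg by (auto simp: thr_def)
  define Rz where "Rz v w \<longleftrightarrow> thr v \<and> thr w \<and> tg v = tg w \<and> unit_step v w" for v w
  have Rz_sym: "Rz v w \<Longrightarrow> Rz w v" for v w using unit_step_sym by (auto simp: Rz_def)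
  define attP where "attP v w \<longleftrightarrow> (\<exists>u. Rz\<^sup>*\<^sup>* v u \<and> thr u \<and> unit_step u w \<and> w \<in> grid_nodes \<and> ct w = tg v \<and> onseg i (tg v) (pos w))" for v w
  \<comment> \<open>By \<open>attP_eq\<close> the predicate \<open>attP v\<close> is the same
    throughout a component of \<open>Rz\<close>, and so is the choice.\<close>
  define att where "att v = (SOME w. attP v w)" for v
  have attP_eq: "attP v = attP w" if "Rz v w" for v w
  proof -
    have "Rz\<^sup>*\<^sup>* v u \<longleftrightarrow> Rz\<^sup>*\<^sup>* w u" for u
      using that Rz_sym by (meson converse_rtranclp_into_rtranclp)
    then show ?thesis using that by (intro ext) (simp add: attP_def Rz_def)
  qed
  have attP_steps: "attP v = attP u" if "Rz\<^sup>*\<^sup>* v u" for v u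
    using that by (induction rule: rtranclp_induct) (auto dest: attP_eq)
  have tg_steps: "tg v = tg u" if "Rz\<^sup>*\<^sup>* v u" for v u
    using that by (induction rule: rtranclp_induct) (auto simp: Rz_def)
  have att: "attP v (att v)" if v: "thr v" for v
  proof -
    define q where "q = tg v"
    have on: "onseg i q (pos v)" "v \<in> grid_nodes" using thr_tg[OF v] v by (auto simp: q_def thr_def)
    obtain w H where w: "w \<in> grid_nodes" "pos w = p q" "(step_in H)\<^sup>*\<^sup>* v w" "\<And>t. t \<in> H \<Longrightarrow> onseg i q t"
      using onseg_connected[OF on] by blast
    have "(Rz\<^sup>*\<^sup>* v x \<and> thr x) \<or> (\<exists>w. attP v w)" if "(step_in H)\<^sup>*\<^sup>* v x" for x
      using that
    proof (induction rule: rtranclp_induct)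
      case (step x y)
      show ?case
      proof (cases "\<exists>w. attP v w")
        case False
        then have x: "Rz\<^sup>*\<^sup>* v x" "thr x" using step.IH by auto
        have y: "y \<in> grid_nodes" "onseg i q (pos y)" "unit_step x y"
          using step.hyps w(4) by (auto simp: step_in_def nodes_in_iff)
        note b = onseg_bounds[OF y(2) nsite]
        show ?thesis
        proof (cases "d (ct y) = i")
          case True
          then have "ct y = q" using b(6) by blast
          then have "attP v y" unfolding attP_def using x y by (intro exI[of _ x]) (auto simp: q_def)
          then show ?thesis by blast
        next
          case False
          then have "thr y" using b(5) y by (auto simp: thr_def)
          moreover have "tg x = tg y" using tg_steps[OF x(1)] tg[OF y(2)] by (simp add: q_def)
          ultimately have "Rz x y" using x y by (simp add: Rz_def)
          then show ?thesis using x \<open>thr y\<close> by auto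
        qed
      qed simp
    qed (use v in auto)
    \<comment> \<open>The walk has to leave the threaded nodes, because it ends at \<open>q\<close>,
      whose level is \<open>i\<close>.\<close>
    from this[OF w(3)] have "\<exists>w. attP v w"
    proof
      assume "Rz\<^sup>*\<^sup>* v w \<and> thr w"
      then have "d (nsite (p q)) = Suc i" using w by (simp add: thr_def)
      moreover have "d q = i" using onseg_bounds(2)[OF on(1) nsite] .
      ultimately show ?thesis using onseg_end[OF on(1)] by simp
    qed
    then show ?thesis unfolding att_def by (rule someI_ex)
  qed
  define lab1 where "lab1 v = (if thr v then lab (att v) @ [ct v] else lab v)" for v
  have lab1_thr: "geo (lab1 v)" "last (lab1 v) = ct v" "geo (lab (att v))" "last (lab (att v)) = tg v"
    "lab1 v = lab (att v) @ [ct v]" if v: "thr v" for v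
  proof -
    have a: "att v \<in> grid_nodes" "ct (att v) = tg v" using att[OF v] by (auto simp: attP_def)
    note b = onseg_bounds[OF thr_tg[OF v] nsite]
    have da: "d (ct (att v)) = i" using a b(2) by simp
    show g: "geo (lab (att v))" "last (lab (att v)) = tg v" using lab[OF a(1)] da a by auto
    show e: "lab1 v = lab (att v) @ [ct v]" using v by (simp add: lab1_def)
    have "length (lab (att v)) = Suc i" using geo_last[OF g(1)] g da a by (auto simp: geo_def)
    then have "geo (lab (att v) @ [ct v])"
      using b(4) v g nsite by (intro geo_snoc) (auto simp: thr_def)
    then show "geo (lab1 v)" "last (lab1 v) = ct v" using e by auto
  qed
  define Nn where "Nn v \<longleftrightarrow> v \<in> grid_nodes \<and> d (ct v) = Suc i \<and> \<not> thr v" for v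
  define Rn where "Rn v w \<longleftrightarrow> Nn v \<and> Nn w \<and> ct v = ct w \<and> unit_step v w" for v w
  have Rn_sym: "Rn v w \<Longrightarrow> Rn w v" for v w using unit_step_sym by (auto simp: Rn_def)
  define atnP where "atnP v w \<longleftrightarrow> (\<exists>u. Rn\<^sup>*\<^sup>* v u \<and> Nn u \<and> unit_step u w \<and> thr w \<and> ct w = ct v)" for v w
  define atn where "atn v = (SOME w. atnP v w)" for v
  have atnP_eq: "atnP v = atnP w" if "Rn v w" for v w
  proof -
    have "Rn\<^sup>*\<^sup>* v u \<longleftrightarrow> Rn\<^sup>*\<^sup>* w u" for u
      using that Rn_sym by (meson converse_rtranclp_into_rtranclp)
    then show ?thesis using that by (intro ext) (simp add: atnP_def Rn_def)
  qed
  have atnP_steps: "atnP v = atnP u" if "Rn\<^sup>*\<^sup>* v u" for v u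
    using that by (induction rule: rtranclp_induct) (auto dest: atnP_eq)
  have ct_steps: "ct v = ct u" if "Rn\<^sup>*\<^sup>* v u" for v u
    using that by (induction rule: rtranclp_induct) (auto simp: Rn_def)
  have atn: "atnP v (atn v)" if v: "Nn v" for v
  proof -
    define s where "s = ct v"
    have s: "s < n" "d s = Suc i" "nsite (p s) = s" using v nsite nsite_site by (auto simp: s_def Nn_def)
    obtain w where w: "w \<in> grid_nodes" "pos w = p s" using site_pos[OF s(1)] .
    \<comment> \<open>The vertex \<open>s\<close> is the start of a segment, so its node is
      threaded, and it can be reached within the cell of \<open>s\<close>.\<close>
    have "onseg i (prv s) (pos w)" using s w by (auto simp: onseg_def)
    then have tw: "thr w" using w s by (auto simp: thr_def)
    have "ct v = ct w" "v \<in> grid_nodes" using w s v by (auto simp: s_def Nn_def)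
    then have "(step_in {t. nsite t = ct v})\<^sup>*\<^sup>* v w" using w by (intro cell_connected)
    then have "(Rn\<^sup>*\<^sup>* v w \<and> Nn w) \<or> (\<exists>w. atnP v w)"
    proof (induction rule: rtranclp_induct)
      case (step x y)
      show ?case
      proof (cases "\<exists>w. atnP v w")
        case False
        then have x: "Rn\<^sup>*\<^sup>* v x" "Nn x" using step.IH by auto
        have y: "y \<in> grid_nodes" "ct x = ct v" "ct y = ct v" "unit_step x y"
          using step.hyps by (auto simp: step_in_def nodes_in_iff)
        show ?thesis
        proof (cases "thr y")
          case True
          then have "atnP v y" unfolding atnP_def using x y by (intro exI[of _ x]) auto
          then show ?thesis by blast
        next
          case F: False
          then have "Nn y" using y v by (simp add: Nn_def)
          then have "Rn x y" using x y by (simp add: Rn_def)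
          then show ?thesis using x \<open>Nn y\<close> by auto
        qed
      qed simp
    qed (use v in auto)
    then have "\<exists>w. atnP v w" using tw by (auto simp: Nn_def)
    then show ?thesis unfolding atn_def by (rule someI_ex)
  qed
  define lab' where "lab' v = (if Nn v then lab1 (atn v) else lab1 v)" for v
  have lab'_old: "lab' v = lab v" if "d (ct v) \<le> i" for v
    using that by (auto simp: lab'_def lab1_def Nn_def thr_def)
  have lab'_thr: "lab' v = lab1 v" if "thr v" for v using that by (simp add: lab'_def Nn_def)
  have lab'_Nn: "lab' v = lab1 (atn v)" "thr (atn v)" "ct (atn v) = ct v" if "Nn v" for v
    using that atn[OF that] by (auto simp: lab'_def atnP_def)
  have lab': "geo (lab' v)" "last (lab' v) = ct v" if v: "v \<in> grid_nodes" "d (ct v) \<le> Suc i" for v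
  proof -
    consider "d (ct v) \<le> i" | "thr v" | "Nn v" using v by (auto simp: Nn_def le_Suc_eq)
    then have "geo (lab' v) \<and> last (lab' v) = ct v"
    proof cases
      case 1
      then show ?thesis using lab'_old lab v by simp
    next
      case 2
      then show ?thesis using lab'_thr lab1_thr by simp
    next
      case 3
      then show ?thesis using lab'_Nn[OF 3] lab1_thr(1,2)[of "atn v"] by metis
    qed
    then show "geo (lab' v)" "last (lab' v) = ct v" by auto
  qed
  have triv_Rz: "trivial_edge lab' v w" if vw: "Rz v w" for v w
  proof -
    have t: "thr v" "thr w" "tg v = tg w" "unit_step v w" using vw by (auto simp: Rz_def)
    have g: "v \<in> grid_nodes" "w \<in> grid_nodes" "d (ct v) \<le> Suc i" "d (ct w) \<le> Suc i" using t by (auto simp: thr_def)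
    obtain y where y: "y \<in> {pos v, pos w}" "y \<in> vor (ct v)" "y \<in> vor (ct w)" using unit_vor[OF t(4) g(1,2)] .
    \<comment> \<open>\<open>y\<close> is one of the two nodes, so it inherits the distance bound
      that \<open>W_snoc_snoc\<close> requires.\<close>
    have on: "onseg i (tg v) y" using y(1) thr_tg[OF t(1)] thr_tg[OF t(2)] t(3) by auto
    have ae: "att v = att w" using attP_eq[OF vw] by (simp add: att_def)
    define G where "G = lab (att v)"
    have l: "lab' v = G @ [ct v]" "lab' w = G @ [ct w]"
      using lab'_thr lab1_thr(5) t ae by (auto simp: G_def)
    have G: "G \<noteq> []" "last G = tg v" using lab1_thr(3,4)[OF t(1)] by (auto simp: G_def geo_def)
    show ?thesis
    proof (rule trivial_edgeI[OF lab'(1)[OF g(1,3)] lab'(1)[OF g(2,4)] lab'(2)[OF g(1,3)] lab'(2)[OF g(2,4)] y(2,3)])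
      fix z assume z: "z < n" "und (lab' v) z" "und (lab' w) z"
      show "W z (lab' v) y (lab' w) = 0"
        using z lab'(1)[OF g(1,3)] lab'(1)[OF g(2,4)] unfolding l
        using G y onseg_bounds(3)[OF on nsite(1) y(2)] onseg_bounds(3)[OF on nsite(1) y(3)]
        by (intro W_snoc_snoc) auto
    qed
  qed
  have triv_att: "\<exists>u. Rz\<^sup>*\<^sup>* v u \<and> unit_step u (att v) \<and> trivial_edge lab' u (att v) \<and> u \<in> grid_nodes \<and> d (ct u) = Suc i"
    if v: "thr v" for v
  proof -
    obtain u where u: "Rz\<^sup>*\<^sup>* v u" "thr u" "unit_step u (att v)" "att v \<in> grid_nodes" "ct (att v) = tg v"
      "onseg i (tg v) (pos (att v))" using att[OF v] by (auto simp: attP_def)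
    define w where "w = att v"
    have tu: "tg u = tg v" using tg_steps[OF u(1)] by simp
    have au: "att u = w" using attP_steps[OF u(1)] by (simp add: att_def w_def)
    have dw: "d (ct w) = i" using onseg_bounds(2)[OF thr_tg[OF v] nsite] u by (simp add: w_def)
    have g: "u \<in> grid_nodes" "w \<in> grid_nodes" "d (ct u) \<le> Suc i" "d (ct w) \<le> Suc i"
      using u dw by (auto simp: thr_def w_def)
    obtain y where y: "y \<in> {pos u, pos w}" "y \<in> vor (ct u)" "y \<in> vor (ct w)"
      using unit_vor[of u w] u g by (auto simp: w_def)
    have on: "onseg i (tg v) y" using y(1) thr_tg[OF u(2)] tu u by (auto simp: w_def)
    have l: "lab' u = lab w @ [ct u]" "lab' w = lab w" using lab'_thr lab1_thr(5) u au lab'_old dw by auto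
    have G: "last (lab w) = tg v" using lab1_thr(4)[OF v] by (simp add: w_def)
    have "trivial_edge lab' u w"
    proof (rule trivial_edgeI[OF lab'(1)[OF g(1,3)] lab'(1)[OF g(2,4)] lab'(2)[OF g(1,3)] lab'(2)[OF g(2,4)] y(2,3)])
      fix z assume z: "z < n" "und (lab' u) z" "und (lab' w) z"
      show "W z (lab' u) y (lab' w) = 0"
        using z lab'(1)[OF g(1,3)] lab'(1)[OF g(2,4)] unfolding l
        using G y u onseg_bounds(3)[OF on nsite(1) y(2)]
        by (intro W_snoc) (auto simp: w_def)
    qed
    then show ?thesis using u g by (auto simp: w_def thr_def)
  qed
  have triv_Nn: "trivial_edge lab' v w" if "Nn v" "w \<in> grid_nodes" "lab' v = lab' w" "ct v = ct w" for v w
    using that lab'[of v] by (intro trivial_same) (auto simp: Nn_def)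
  have "good_labels (Suc i) lab'"
    unfolding good_labels_def
  proof (intro conjI allI impI ballI)
    fix v assume "v \<in> grid_nodes" "d (ct v) \<le> Suc i"
    then show "geo (lab' v)" "last (lab' v) = ct v" using lab' by auto
  next
    fix \<phi> :: "nat \<times> nat \<Rightarrow> bool" and v w
    assume \<phi>: "\<forall>v\<in>grid_nodes. \<forall>w\<in>grid_nodes. d (ct v) \<le> Suc i \<longrightarrow> d (ct w) \<le> Suc i \<longrightarrow> unit_step v w \<longrightarrow>
          trivial_edge lab' v w \<longrightarrow> \<phi> v = \<phi> w"
      and vw: "v \<in> grid_nodes" "w \<in> grid_nodes" "d (ct v) \<le> Suc i" "d (ct w) \<le> Suc i"
    have \<phi>e: "\<phi> v = \<phi> w" if "v \<in> grid_nodes" "w \<in> grid_nodes" "d (ct v) \<le> Suc i" "d (ct w) \<le> Suc i"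
      "unit_step v w" "trivial_edge lab' v w" for v w using \<phi> that by blast
    have old: "\<phi> v = \<phi> w" if "v \<in> grid_nodes" "w \<in> grid_nodes" "d (ct v) \<le> i" "d (ct w) \<le> i" for v w
    proof -
      have "\<phi> a = \<phi> b" if "a \<in> grid_nodes" "b \<in> grid_nodes" "d (ct a) \<le> i" "d (ct b) \<le> i" "unit_step a b"
        "trivial_edge lab a b" for a b
        using that lab'_old by (intro \<phi>e) (auto simp: trivial_edge_def)
      then have "\<forall>v\<in>grid_nodes. \<forall>w\<in>grid_nodes. d (ct v) \<le> i \<longrightarrow> d (ct w) \<le> i \<longrightarrow> unit_step v w \<longrightarrow>
          trivial_edge lab v w \<longrightarrow> \<phi> v = \<phi> w"
        by (intro ballI impI)
      with good[unfolded good_labels_def, THEN conjunct2, THEN spec, of \<phi>]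
      have "\<forall>v\<in>grid_nodes. \<forall>w\<in>grid_nodes. d (ct v) \<le> i \<longrightarrow> d (ct w) \<le> i \<longrightarrow> \<phi> v = \<phi> w"
        by (rule mp)
      then show ?thesis using that by blast
    qed
    have Rz_\<phi>: "\<phi> v = \<phi> u" if "Rz\<^sup>*\<^sup>* v u" for v u
      using that
    proof (induction rule: rtranclp_induct)
      case (step x y)
      then have "\<phi> x = \<phi> y" using triv_Rz[OF step.hyps(2)] by (intro \<phi>e) (auto simp: Rz_def thr_def)
      then show ?case using step by simp
    qed simp
    have Rn_\<phi>: "\<phi> v = \<phi> u" if "Rn\<^sup>*\<^sup>* v u" for v u
      using that
    proof (induction rule: rtranclp_induct)
      case (step x y)
      have "atn x = atn y" using atnP_eq[OF step.hyps(2)] by (simp add: atn_def)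
      then have "trivial_edge lab' x y" using step.hyps(2) lab'_Nn by (intro triv_Nn) (auto simp: Rn_def Nn_def)
      then have "\<phi> x = \<phi> y" using step.hyps(2) by (intro \<phi>e) (auto simp: Rn_def Nn_def)
      then show ?case using step by simp
    qed simp
    have ex_thr: "\<exists>w\<in>grid_nodes. d (ct w) \<le> i \<and> \<phi> v = \<phi> w" if v: "thr v" for v
    proof -
      obtain u where u: "Rz\<^sup>*\<^sup>* v u" "unit_step u (att v)" "trivial_edge lab' u (att v)" "u \<in> grid_nodes" "d (ct u) = Suc i"
        using triv_att[OF v] by blast
      have a: "att v \<in> grid_nodes" "ct (att v) = tg v" using att[OF v] by (auto simp: attP_def)
      then have "d (ct (att v)) = i" using onseg_bounds(2)[OF thr_tg[OF v] nsite] by simp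
      moreover have "\<phi> u = \<phi> (att v)" using u a calculation by (intro \<phi>e) auto
      ultimately show ?thesis using Rz_\<phi>[OF u(1)] a by (intro bexI[of _ "att v"]) auto
    qed
    have ex: "\<exists>w\<in>grid_nodes. d (ct w) \<le> i \<and> \<phi> v = \<phi> w" if v: "v \<in> grid_nodes" "d (ct v) \<le> Suc i" for v
    proof -
      consider "d (ct v) \<le> i" | "thr v" | "Nn v" using v by (auto simp: Nn_def le_Suc_eq)
      then show ?thesis
      proof cases
        case 1
        then show ?thesis using v by blast
      next
        case 2
        then show ?thesis by (rule ex_thr)
      next
        case 3
        define w where "w = atn v"
        obtain u where u: "Rn\<^sup>*\<^sup>* v u" "Nn u" "unit_step u w" "thr w" "ct w = ct v"
          using atn[OF 3] by (auto simp: atnP_def w_def)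
        have "atn u = w" using atnP_steps[OF u(1)] by (simp add: atn_def w_def)
        then have "lab' u = lab' w" using lab'_Nn[OF u(2)] lab'_thr[OF u(4)] by simp
        then have "trivial_edge lab' u w" using u ct_steps[OF u(1)] by (intro triv_Nn) (auto simp: thr_def)
        then have "\<phi> u = \<phi> w" using u by (intro \<phi>e) (auto simp: Nn_def thr_def)
        then show ?thesis using Rn_\<phi>[OF u(1)] ex_thr[OF u(4)] by simp
      qed
    qed
    show "\<phi> v = \<phi> w" using ex[OF vw(1,3)] ex[OF vw(2,4)] old by metis
  qed
  then show ?thesis by blast
qed

lemma labels_exist:
  obtains lab where "\<forall>v\<in>grid_nodes. geo (lab v) \<and> last (lab v) = ct v"
    "\<forall>\<phi>::nat \<times> nat \<Rightarrow> bool.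
       (\<forall>v\<in>grid_nodes. \<forall>w\<in>grid_nodes. unit_step v w \<longrightarrow> trivial_edge lab v w \<longrightarrow> \<phi> v = \<phi> w) \<longrightarrow>
       (\<forall>v\<in>grid_nodes. \<forall>w\<in>grid_nodes. \<phi> v = \<phi> w)"
proof -
  define m where "m = Max (d ` {..<n})"
  have m: "d (ct v) \<le> m \<longleftrightarrow> True" for v unfolding m_def using nsite by (auto intro!: Max_ge)
  have "\<exists>lab. good_labels i lab" for i
    by (induction i) (use good_labels_0 good_labels_Suc in blast)+
  then obtain lab where "good_labels m lab" by blast
  from this[unfolded good_labels_def m simp_thms] show ?thesis by (elim conjE) (rule that)
qed

end

section \<open>Capture\<close>

context geo_grid
begin

lemma guarding_sub:
  assumes "guarding pg C z" "\<And>g P. pg' g = Some P \<Longrightarrow> pg g = Some P"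
  shows "guarding pg' C z"
  using assms unfolding guarding_def by blast

lemma trivial_edge_sym:
  assumes "geo (lab v)" "geo (lab w)" "last (lab v) = ct v" "last (lab w) = ct w" "trivial_edge lab v w"
  shows "trivial_edge lab w v"
  unfolding trivial_edge_def
proof (intro allI impI ballI)
  fix z y assume z: "z < n" "und (lab w) z" "und (lab v) z" and y: "y \<in> vor (ct w) \<inter> vor (ct v)"
  have "W z (lab v) y (lab w) + W z (lab w) y (lab v) = W z (lab v) y (lab v)"
    using z y assms by (intro W_add) auto
  moreover have "W z (lab v) y (lab v) = 0" using z y assms by (intro W_self) auto
  moreover have "W z (lab v) y (lab w) = 0" using assms z y by (auto simp: trivial_edge_def)
  ultimately show "W z (lab w) y (lab v) = 0" by simp
qed

lemma inside_box:
  assumes "z < n"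
  shows "xs ! 0 < Re (p z)" "Re (p z) < xs ! R" "- M < Im (p z)" "Im (p z) < M"
proof -
  obtain x where x: "x \<in> set xs" "x < Re (p z)" using box[OF assms] set_xs by auto
  obtain x' where x': "x' \<in> set xs" "Re (p z) < x'" using box[OF assms] set_xs by auto
  have e: "xs ! 0 \<le> x" "x \<le> xs ! R" if x: "x \<in> set xs" for x
  proof -
    obtain a where a: "a \<le> R" "xs ! a = x" using x length_xs_eq by (metis in_set_conv_nth less_Suc_eq_le)
    then show "xs ! 0 \<le> x" "x \<le> xs ! R" using xs_less[of 0 a] xs_less[of a R] by (cases "a = 0"; cases "a = R"; force)+
  qed
  show 1: "xs ! 0 < Re (p z)" "Re (p z) < xs ! R" using e(1)[OF x(1)] e(2)[OF x'(1)] x x' by auto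
  obtain l where "l \<in> L" "Im (p z) = lv l (Re (p z))" using site[OF assms] by blast
  then show "- M < Im (p z)" "Im (p z) < M" using lv_bound[of "Re (p z)" l] 1 by auto
qed

section \<open>The boundary of the grid, counterclockwise from (0, 0)\<close>

definition bd :: "nat \<Rightarrow> nat \<times> nat" where
  "bd t = (if t \<le> JJ then (t, 0) else if t \<le> JJ + KK then (JJ, t - JJ)
     else if t \<le> JJ + KK + JJ then (JJ + KK + JJ - t, KK) else (0, JJ + KK + JJ + KK - t))"

definition "BB = JJ + KK + JJ + KK"

definition be :: "nat \<Rightarrow> grid_edge" where
  "be t = (if t < JJ then EH t 0 else if t < JJ + KK then EV JJ (t - JJ)
     else if t < JJ + KK + JJ then EH (JJ + KK + JJ - Suc t) KK else EV 0 (BB - Suc t))"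

lemma JJ_pos: "0 < JJ" and KK_pos: "0 < KK" using R_pos by (auto simp: N_def)

lemma bd_cases:
  assumes "t < BB"
  obtains (bottom) "t < JJ" "bd t = (t, 0)" "bd (Suc t) = (Suc t, 0)" "be t = EH t 0"
  | (right) k where "k < KK" "bd t = (JJ, k)" "bd (Suc t) = (JJ, Suc k)" "be t = EV JJ k"
  | (top) i where "i < JJ" "bd t = (Suc i, KK)" "bd (Suc t) = (i, KK)" "be t = EH i KK"
  | (left) k where "k < KK" "bd t = (0, Suc k)" "bd (Suc t) = (0, k)" "be t = EV 0 k"
proof -
  consider "t < JJ" | "JJ \<le> t" "t < JJ + KK" | "JJ + KK \<le> t" "t < JJ + KK + JJ" | "JJ + KK + JJ \<le> t"
    by linarith
  then show ?thesis
  proof cases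
    case 1
    then show ?thesis by (intro bottom) (auto simp: bd_def be_def)
  next
    case 2
    then show ?thesis by (intro right[of "t - JJ"]) (auto simp: bd_def be_def)
  next
    case 3
    then show ?thesis using KK_pos
      by (intro top[of "JJ + KK + JJ - Suc t"]) (auto simp: bd_def be_def BB_def Suc_diff_Suc)
  next
    case 4
    then show ?thesis using assms JJ_pos
      by (intro left[of "BB - Suc t"]) (auto simp: bd_def be_def BB_def Suc_diff_Suc)
  qed
qed

lemma bd_0: "bd 0 = (0, 0)" and bd_BB: "bd BB = (0, 0)" and BB_pos: "0 < BB"
  using JJ_pos KK_pos by (auto simp: bd_def BB_def)

lemma bd_node:
  assumes "t \<le> BB"
  shows "bd t \<in> grid_nodes"
proof (cases "t = BB")
  case True
  then show ?thesis by (simp add: bd_BB)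
next
  case False
  then have "t < BB" using assms by simp
  then show ?thesis by (cases rule: bd_cases) auto
qed

lemma bd_unit:
  assumes "t < BB"
  shows "unit_step (bd t) (bd (Suc t))"
  using assms by (cases rule: bd_cases) (auto simp: unit_step.simps)

text \<open>The imaginary part of the quotient has the sign of the cross product of a - z and b -
  z.\<close>

lemma ang_left_of:
  assumes "(Re a - Re z) * (Im b - Im z) - (Im a - Im z) * (Re b - Re z) > 0"
  shows "ang z a b > 0"
proof (rule ang_pos)
  have "a \<noteq> z" using assms by auto
  then have "0 < (Re (a - z))\<^sup>2 + (Im (a - z))\<^sup>2" by (metis complex_neq_0 eq_iff_diff_eq_0)
  moreover have "Im ((b - z) / (a - z)) = ((Re a - Re z) * (Im b - Im z) - (Im a - Im z) * (Re b - Re z)) /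
      ((Re (a - z))\<^sup>2 + (Im (a - z))\<^sup>2)"
    by (simp add: Im_divide algebra_simps)
  ultimately show "Im ((b - z) / (a - z)) > 0" using assms by simp
qed

lemma pos_pair: "pos (i, k) = pt i k" by (simp add: pos_def)

text \<open>The vertices lie strictly inside the box and see its boundary run counterclockwise.
  Nodes on the vertical sides may coincide, whence the weak inequality; the first bottom edge has
  positive length.\<close>

lemma ang_boundary:
  assumes z: "z < n" and t: "t < BB"
  shows "ang (p z) (pos (bd t)) (pos (bd (Suc t))) \<ge> 0"
    and "t = 0 \<Longrightarrow> ang (p z) (pos (bd t)) (pos (bd (Suc t))) > 0"
proof -
  note zb = inside_box[OF z]
  have x0: "\<xi> 0 = xs ! 0" "\<xi> JJ = xs ! R" using \<xi>_even[of 0] \<xi>_even[of R] by auto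
  have bot: "ang (p z) (pt i 0) (pt (Suc i) 0) > 0" if "i < JJ" for i
  proof (rule ang_left_of)
    have "0 < (M + Im (p z)) * (\<xi> (Suc i) - \<xi> i)" using zb \<xi>_Suc[OF that] by simp
    then show "(Re (pt i 0) - Re (p z)) * (Im (pt (Suc i) 0) - Im (p z)) - (Im (pt i 0) - Im (p z)) * (Re (pt (Suc i) 0) - Re (p z)) > 0"
      unfolding pt_0 by (simp add: algebra_simps)
  qed
  have top: "ang (p z) (pt (Suc i) KK) (pt i KK) > 0" if "i < JJ" for i
  proof (rule ang_left_of)
    have "0 < (M - Im (p z)) * (\<xi> (Suc i) - \<xi> i)" using zb \<xi>_Suc[OF that] by simp
    then show "(Re (pt (Suc i) KK) - Re (p z)) * (Im (pt i KK) - Im (p z)) - (Im (pt (Suc i) KK) - Im (p z)) * (Re (pt i KK) - Re (p z)) > 0"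
      unfolding pt_KK by (simp add: algebra_simps)
  qed
  have right: "ang (p z) (pt JJ k) (pt JJ (Suc k)) \<ge> 0" if "k < KK" for k
  proof (cases "pt JJ k = pt JJ (Suc k)")
    case True
    have "pt JJ k \<noteq> p z" using zb x0 by (auto simp: pt_def complex_eq_iff)
    then show ?thesis using True by simp
  next
    case False
    then have "Im (pt JJ k) < Im (pt JJ (Suc k))"
      using mid_row_mono[of JJ k "Suc k"] that by (auto simp: pt_def complex_eq_iff)
    then have "0 < (\<xi> JJ - Re (p z)) * (Im (pt JJ (Suc k)) - Im (pt JJ k))" using zb x0 by simp
    then show ?thesis by (intro less_imp_le ang_left_of) (simp add: pt_def algebra_simps)
  qed
  have left: "ang (p z) (pt 0 (Suc k)) (pt 0 k) \<ge> 0" if "k < KK" for k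
  proof (cases "pt 0 k = pt 0 (Suc k)")
    case True
    have "pt 0 k \<noteq> p z" using zb x0 by (auto simp: pt_def complex_eq_iff)
    then show ?thesis using True by simp
  next
    case False
    then have "Im (pt 0 k) < Im (pt 0 (Suc k))"
      using mid_row_mono[of 0 k "Suc k"] that by (auto simp: pt_def complex_eq_iff)
    then have "0 < (Re (p z) - \<xi> 0) * (Im (pt 0 (Suc k)) - Im (pt 0 k))" using zb x0 by simp
    then show ?thesis by (intro less_imp_le ang_left_of) (simp add: pt_def algebra_simps)
  qed
  from t show "ang (p z) (pos (bd t)) (pos (bd (Suc t))) \<ge> 0"
    by (cases rule: bd_cases) (use bot top left right in \<open>auto simp: pos_pair intro: less_imp_le\<close>)
  show "ang (p z) (pos (bd t)) (pos (bd (Suc t))) > 0" if "t = 0"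
  proof -
    have "bd 0 = (0, 0)" "bd (Suc 0) = (Suc 0, 0)" using JJ_pos by (auto simp: bd_def)
    then show ?thesis using bot[OF JJ_pos] that by (simp add: pos_pair)
  qed
qed

lemma boundary_avoids:
  assumes "e < n" "f < n" "t < BB"
  shows "closed_segment (p e) (p f) \<inter> closed_segment (pos (bd t)) (pos (bd (Suc t))) = {}"
proof (rule ccontr)
  assume "\<not> ?thesis"
  then obtain q where q: "q \<in> closed_segment (p e) (p f)" "q \<in> closed_segment (pos (bd t)) (pos (bd (Suc t)))"
    by blast
  note eb = inside_box[OF assms(1)] and fb = inside_box[OF assms(2)]
  have x0: "\<xi> 0 = xs ! 0" "\<xi> JJ = xs ! R" using \<xi>_even[of 0] \<xi>_even[of R] by auto
  have re: "Re q \<in> closed_segment (Re a) (Re b)" "Im q \<in> closed_segment (Im a) (Im b)"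
    if "q \<in> closed_segment a b" for a b using that by (auto simp: closed_segment_def)
  have in_box: "xs ! 0 < Re q" "Re q < xs ! R" "- M < Im q" "Im q < M"
    using re[OF q(1)] eb fb by (auto simp: closed_segment_eq_real_ivl split: if_splits)
  from assms(3) show False
  proof (cases rule: bd_cases)
    case bottom
    then show False using re(2)[OF q(2)] in_box by (simp add: pos_pair pt_0)
  next
    case (right k)
    then show False using re(1)[OF q(2)] in_box x0 by (simp add: pos_pair pt_def)
  next
    case (top i)
    then show False using re(2)[OF q(2)] in_box by (simp add: pos_pair pt_KK)
  next
    case (left k)
    then show False using re(1)[OF q(2)] in_box x0 by (simp add: pos_pair pt_def)
  qed
qed

definition bpath :: "nat \<Rightarrow> complex list" where
  "bpath t = map (\<lambda>t. pos (bd t)) [t..<Suc BB]"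

lemma bpath_BB: "bpath BB = [pos (bd BB)]" by (simp add: bpath_def)

lemma bpath_Cons:
  assumes "t < BB"
  shows "bpath t = pos (bd t) # bpath (Suc t)"
proof -
  have "[t..<Suc BB] = t # [Suc t..<Suc BB]" using assms by (intro upt_conv_Cons) simp
  then show ?thesis unfolding bpath_def by (simp only: list.map)
qed

lemma bpath_props:
  assumes "t \<le> BB"
  shows "bpath t \<noteq> []" "hd (bpath t) = pos (bd t)" "last (bpath t) = pos (bd BB)"
proof -
  show 1: "bpath t \<noteq> []" using assms by (simp add: bpath_def)
  show "last (bpath t) = pos (bd BB)" using 1 assms by (simp add: bpath_def last_map)
  show "hd (bpath t) = pos (bd t)" using assms bpath_Cons[of t] by (cases "t = BB") (auto simp: bpath_BB)
qed

lemma bpath_Cons_Cons: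
  assumes "t < BB"
  obtains zs where "bpath (Suc t) = pos (bd (Suc t)) # zs" "bpath t = pos (bd t) # pos (bd (Suc t)) # zs"
proof -
  have "bpath (Suc t) = pos (bd (Suc t)) # tl (bpath (Suc t))"
    using bpath_props(1,2)[of "Suc t"] assms by (metis Suc_leI list.collapse)
  then show ?thesis using that bpath_Cons[OF assms] by metis
qed

lemma bpath_avoids:
  assumes "e < n" "f < n" "t \<le> BB"
  shows "avoids (closed_segment (p e) (p f)) (bpath t)"
  using assms(3)
proof (induction rule: inc_induct)
  case (step t)
  show ?case
    using bpath_Cons_Cons[OF step(2)] step.IH boundary_avoids[OF assms(1,2) step(2)] by force
qed (simp add: bpath_BB)

lemma bpath_pang:
  assumes "z < n" "t \<le> BB"
  shows "0 \<le> pang (p z) (bpath t)"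
  using assms(2)
proof (induction rule: inc_induct)
  case (step t)
  obtain zs where "bpath (Suc t) = pos (bd (Suc t)) # zs" "bpath t = pos (bd t) # pos (bd (Suc t)) # zs"
    using bpath_Cons_Cons[OF step(2)] .
  then show ?case using step.IH ang_boundary(1)[OF assms(1) step(2)] by simp
qed (simp add: bpath_BB)

end

lemma card_2_insert: "card S = 2 \<Longrightarrow> a \<in> S \<Longrightarrow> \<exists>b. S = {a, b}"
  by (auto simp: card_2_iff)

section \<open>Enclosing the robber and walking through triangles\<close>

locale labelled_grid = geo_grid +
  fixes lab :: "nat \<times> nat \<Rightarrow> nat list"
  assumes lab_all: "\<forall>v\<in>{..2 * R} \<times> {..2 * N}. geo (lab v) \<and> last (lab v) = nsite (pos v)"
    and lab_conn: "\<forall>\<phi>::nat \<times> nat \<Rightarrow> bool.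
       (\<forall>v\<in>{..2 * R} \<times> {..2 * N}. \<forall>w\<in>{..2 * R} \<times> {..2 * N}. unit_step v w \<longrightarrow> trivial_edge lab v w \<longrightarrow> \<phi> v = \<phi> w) \<longrightarrow>
       (\<forall>v\<in>{..2 * R} \<times> {..2 * N}. \<forall>w\<in>{..2 * R} \<times> {..2 * N}. \<phi> v = \<phi> w)"
begin

sublocale G: grid "2 * R" "2 * N"
  by unfold_locales (use JJ_pos KK_pos in auto)

lemma lab: "v \<in> grid_nodes \<Longrightarrow> geo (lab v) \<and> last (lab v) = ct v"
  using lab_all by blast

text \<open>Trivial unit steps already connect the nodes, in either orientation by
  \<open>trivial_edge_sym\<close>; trivial diagonals can only help.\<close>

lemma trivial_edges_connect:
  "\<forall>\<phi>::nat \<times> nat \<Rightarrow> bool.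
    (\<forall>e. G.valid_edge e \<longrightarrow> trivial_edge lab (edge_src e) (edge_dst e) \<longrightarrow> \<phi> (edge_src e) = \<phi> (edge_dst e)) \<longrightarrow>
    (\<forall>v\<in>grid_nodes. \<forall>w\<in>grid_nodes. \<phi> v = \<phi> w)"
proof (intro allI impI)
  fix \<phi> :: "nat \<times> nat \<Rightarrow> bool"
  assume \<phi>: "\<forall>e. G.valid_edge e \<longrightarrow> trivial_edge lab (edge_src e) (edge_dst e) \<longrightarrow> \<phi> (edge_src e) = \<phi> (edge_dst e)"
  have \<phi>e: "\<phi> (edge_src e) = \<phi> (edge_dst e)" if "G.valid_edge e" "trivial_edge lab (edge_src e) (edge_dst e)" for e
    using \<phi> that by blast
  have "\<phi> v = \<phi> w" if h: "v \<in> grid_nodes" "w \<in> grid_nodes" "unit_step v w" "trivial_edge lab v w" for v w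
  proof -
    have t': "trivial_edge lab w v"
      using trivial_edge_sym[of lab v w] lab[OF h(1)] lab[OF h(2)] h(4) by simp
    obtain i k j m where ik: "v = (i, k)" "w = (j, m)" by (cases v; cases w) auto
    consider "j = Suc i" "m = k" | "i = Suc j" "m = k" | "j = i" "m = Suc k" | "j = i" "k = Suc m"
      using h(3) ik by (auto simp: unit_step.simps)
    then show ?thesis
    proof cases
      case 1 then show ?thesis using \<phi>e[of "EH i k"] h ik by simp
    next
      case 2 then show ?thesis using \<phi>e[of "EH j k"] h ik t' by simp
    next
      case 3 then show ?thesis using \<phi>e[of "EV i k"] h ik by simp
    next
      case 4 then show ?thesis using \<phi>e[of "EV i m"] h ik t' by simp
    qed
  qed
  then have "\<forall>v\<in>grid_nodes. \<forall>w\<in>grid_nodes. unit_step v w \<longrightarrow> trivial_edge lab v w \<longrightarrow> \<phi> v = \<phi> w" by blast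
  with lab_conn[THEN spec, of \<phi>] show "\<forall>v\<in>grid_nodes. \<forall>w\<in>grid_nodes. \<phi> v = \<phi> w" by (rule mp)
qed

sublocale G: grid_tree "2 * R" "2 * N" "\<lambda>e. trivial_edge lab (edge_src e) (edge_dst e)"
  by unfold_locales (rule trivial_edges_connect)

text \<open>Two groups are bound and the third is free for another geodesic. Hiding which ones they
  are lets the groups change roles from step to step.\<close>

definition enclosed :: "nat list \<Rightarrow> complex list \<Rightarrow> nat list \<Rightarrow> (nat \<Rightarrow> nat) \<Rightarrow> nat \<Rightarrow> bool" where
  "enclosed P ts P' C z \<longleftrightarrow> (\<exists>a<3. \<exists>b<3. a \<noteq> b \<and> guarding [a \<mapsto> P, b \<mapsto> P'] C z \<and> loop z P ts P' \<noteq> 0)"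

definition door :: "nat \<times> nat \<Rightarrow> nat \<times> nat \<Rightarrow> (nat \<Rightarrow> nat) \<Rightarrow> nat \<Rightarrow> bool" where
  "door v w C z \<longleftrightarrow> (\<exists>y\<in>vor (ct v) \<inter> vor (ct w). enclosed (lab v) [y] (lab w) C z)"

lemma third_group:
  assumes "a < (3::nat)" "b < 3"
  obtains c where "c < 3" "c \<noteq> a" "c \<noteq> b"
proof -
  have "card ({..<3} - {a, b}) \<noteq> 0" using assms by (simp add: card_Diff_subset card_insert_if)
  then obtain c where "c \<in> {..<3} - {a, b}" by (metis card.empty ex_in_conv)
  then show ?thesis using that by auto
qed

lemma guardingD:
  assumes "guarding pg C z" "pg g = Some P" "g < 3"
  shows "geo P" "und P z" "z < n"
  using assms by (auto simp: guarding_def)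

lemma enclosedD:
  assumes "enclosed P ts P' C z"
  shows "geo P" "und P z" "geo P'" "und P' z" "z < n" "loop z P ts P' \<noteq> 0"
proof -
  obtain a b where ab: "a < 3" "b < 3" "a \<noteq> b" "guarding [a \<mapsto> P, b \<mapsto> P'] C z" "loop z P ts P' \<noteq> 0"
    using assms by (auto simp: enclosed_def)
  then show "geo P" "und P z" "geo P'" "und P' z" "z < n" "loop z P ts P' \<noteq> 0"
    using guardingD[OF ab(4), of a P] guardingD[OF ab(4), of b P'] by auto
qed

lemma enclosed_cong:
  "enclosed P ts P' C z \<Longrightarrow> loop z P us P' \<noteq> 0 \<Longrightarrow> enclosed P us P' C z"
  unfolding enclosed_def by blast

lemma door_sym:
  assumes "v \<in> grid_nodes" "w \<in> grid_nodes" "door v w C z"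
  shows "door w v C z"
proof -
  obtain y where y: "y \<in> vor (ct v)" "y \<in> vor (ct w)" and e: "enclosed (lab v) [y] (lab w) C z"
    using assms(3) by (auto simp: door_def)
  obtain a b where ab: "a < 3" "b < 3" "a \<noteq> b" "guarding [a \<mapsto> lab v, b \<mapsto> lab w] C z"
    using e by (auto simp: enclosed_def)
  note g = enclosedD[OF e]
  have "W z (lab v) y (lab w) + W z (lab w) y (lab v) = W z (lab v) y (lab v)"
    using g y lab assms by (intro W_add) auto
  moreover have "W z (lab v) y (lab v) = 0" using g y lab assms by (intro W_self) auto
  ultimately have "W z (lab w) y (lab v) \<noteq> 0" using g by simp
  moreover have "guarding [b \<mapsto> lab w, a \<mapsto> lab v] C z" using ab by (intro guarding_sub[OF ab(4)]) (auto split: if_splits)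
  ultimately have "enclosed (lab w) [y] (lab v) C z" unfolding enclosed_def using ab by blast
  then show ?thesis using y by (auto simp: door_def)
qed

lemma door_not_trivial:
  assumes "door v w C z"
  shows "\<not> trivial_edge lab v w"
proof -
  obtain y where y: "y \<in> vor (ct v) \<inter> vor (ct w)" and e: "enclosed (lab v) [y] (lab w) C z"
    using assms by (auto simp: door_def)
  show ?thesis using y enclosedD[OF e] unfolding trivial_edge_def by blast
qed

lemma safe_allD:
  assumes "safe_all pg e f" "pg g = Some P" "g < 3"
  shows "safe P e f"
  using assms by (auto simp: safe_all_def)

text \<open>While the third group takes up \<open>Q\<close>, the winding number of the old loop
  stays nonzero. Then it splits at \<open>Q\<close> into two summands, one of which is nonzero, and
  the group whose geodesic is not part of that loop is released.\<close>

lemma enclosed_split: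
  assumes P: "geo P" "geo P'" "geo Q" and ts: "ts \<noteq> []" "hd ts \<in> vor (last P)" "last ts \<in> vor (last P')"
      "\<And>e f. e < n \<Longrightarrow> f < n \<Longrightarrow> avoids (closed_segment (p e) (p f)) ts"
    and split: "\<And>z. z < n \<Longrightarrow> und P z \<Longrightarrow> und Q z \<Longrightarrow> loop z P ts P' = loop z P us Q + loop z Q vs P'"
    and encl: "enclosed P ts P' C z"
  shows "force n adj 9 (\<lambda>C z. enclosed P us Q C z \<or> enclosed Q vs P' C z) C z"
proof -
  obtain a b where ab: "a < 3" "b < 3" "a \<noteq> b" "guarding [a \<mapsto> P, b \<mapsto> P'] C z" "loop z P ts P' \<noteq> 0"
    using encl by (auto simp: enclosed_def)
  define pg where "pg = [a \<mapsto> P, b \<mapsto> P']"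
  have pg: "pg a = Some P" "pg b = Some P'" using ab by (auto simp: pg_def)
  obtain c where c: "c < 3" "c \<noteq> a" "c \<noteq> b" using third_group ab by blast
  have "force n adj 9 (\<lambda>C z. guarding (pg(c \<mapsto> Q)) C z \<and> loop z P ts P' \<noteq> 0) C z"
  proof (rule force_guard)
    show "guarding pg C z" using ab by (simp add: pg_def)
    show "pg c = None" using c by (simp add: pg_def)
    fix e f assume s: "safe_all pg e f" "loop e P ts P' \<noteq> 0"
    then have "e < n" "f < n" by (auto simp: safe_all_def)
    then have "loop e P ts P' = loop f P ts P'"
      using P ts safe_allD[OF s(1) pg(1) ab(1)] safe_allD[OF s(1) pg(2) ab(2)] by (intro loop_invariant) auto
    then show "loop f P ts P' \<noteq> 0" using s by simp
  qed (use c ab P in auto)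
  then show ?thesis
  proof (rule force_trans)
    fix C z assume h: "guarding (pg(c \<mapsto> Q)) C z \<and> loop z P ts P' \<noteq> 0"
    let ?pg = "pg(c \<mapsto> Q)"
    have pg': "?pg a = Some P" "?pg b = Some P'" "?pg c = Some Q" using pg c by auto
    have "loop z P ts P' = loop z P us Q + loop z Q vs P'"
      using guardingD[OF conjunct1[OF h] pg'(1) ab(1)] guardingD[OF conjunct1[OF h] pg'(3) c(1)] by (intro split)
    then consider "loop z P us Q \<noteq> 0" | "loop z Q vs P' \<noteq> 0" using h by (metis add_0)
    then have "enclosed P us Q C z \<or> enclosed Q vs P' C z"
    proof cases
      case 1
      have "guarding [a \<mapsto> P, c \<mapsto> Q] C z"
        using pg' by (intro guarding_sub[OF conjunct1[OF h]]) (auto split: if_splits)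
      then have "enclosed P us Q C z" unfolding enclosed_def using ab c 1 by blast
      then show ?thesis ..
    next
      case 2
      have "guarding [c \<mapsto> Q, b \<mapsto> P'] C z"
        using pg' by (intro guarding_sub[OF conjunct1[OF h]]) (auto split: if_splits)
      then have "enclosed Q vs P' C z" unfolding enclosed_def using ab c 2 by blast
      then show ?thesis ..
    qed
    then show "force n adj 9 (\<lambda>C z. enclosed P us Q C z \<or> enclosed Q vs P' C z) C z"
      by (rule force_now[of "\<lambda>C z. enclosed P us Q C z \<or> enclosed Q vs P' C z"])
  qed
qed

text \<open>A point common to all three cells lets the three loops use the same junction, so that
  \<open>W_add\<close> splits the old one.\<close>

lemma door_step:
  assumes nodes: "v \<in> grid_nodes" "w \<in> grid_nodes" "u \<in> grid_nodes"
    and y: "y \<in> vor (ct v)" "y \<in> vor (ct w)" "y \<in> vor (ct u)"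
    and door: "door v w C z"
  shows "force n adj 9 (\<lambda>C z. door v u C z \<or> door u w C z) C z"
proof -
  note l = lab[OF nodes(1)] lab[OF nodes(2)] lab[OF nodes(3)]
  obtain y' where y': "y' \<in> vor (ct v)" "y' \<in> vor (ct w)" and e: "enclosed (lab v) [y'] (lab w) C z"
    using door by (auto simp: door_def)
  have "W z (lab v) y (lab w) = W z (lab v) y' (lab w)"
    using enclosedD[OF e] l y y' by (intro W_indep) auto
  then have "enclosed (lab v) [y] (lab w) C z" using enclosed_cong[OF e] enclosedD(6)[OF e] by simp
  then have "force n adj 9 (\<lambda>C z. enclosed (lab v) [y] (lab u) C z \<or> enclosed (lab u) [y] (lab w) C z) C z"
    using l y W_add[of _ "lab u" y "lab v" "lab w"] by (intro enclosed_split) auto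
  then show ?thesis
    by (rule force_mono) (use y in \<open>auto simp: door_def\<close>)
qed

lemma triangle:
  assumes "G.valid_face f" "f \<noteq> Outer" "e \<in> G.face_edges f"
  obtains u e1 e2 y where "u \<in> grid_nodes" "e1 \<in> G.face_edges f" "e2 \<in> G.face_edges f" "e1 \<noteq> e" "e2 \<noteq> e"
    "{edge_src e1, edge_dst e1} = {edge_src e, u}" "{edge_src e2, edge_dst e2} = {u, edge_dst e}"
    "edge_src e \<in> grid_nodes" "edge_dst e \<in> grid_nodes"
    "y \<in> vor (ct (edge_src e))" "y \<in> vor (ct (edge_dst e))" "y \<in> vor (ct u)"
proof -
  have sq: "\<exists>y. \<forall>t\<in>{pt i k, pt (Suc i) k, pt i (Suc k), pt (Suc i) (Suc k)}. y \<in> vor (nsite t)"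
    if "i < JJ" "k < KK" for i k using square_corner[OF that] dom_vor nsite by blast
  show ?thesis
  proof (cases f)
    case Outer
    then show ?thesis using assms by simp
  next
    case (Lo i k)
    then have ik: "i < JJ" "k < KK" using assms by auto
    obtain y where y: "y \<in> vor (nsite (pt i k))" "y \<in> vor (nsite (pt (Suc i) k))" "y \<in> vor (nsite (pt (Suc i) (Suc k)))"
      using sq[OF ik] by auto
    consider "e = EH i k" | "e = EV (Suc i) k" | "e = ED i k" using assms Lo by auto
    then show ?thesis
    proof cases
      case 1
      then show ?thesis using Lo ik y that[of "(Suc i, Suc k)" "ED i k" "EV (Suc i) k" y] by (auto simp: pos_pair)
    next
      case 2
      then show ?thesis using Lo ik y that[of "(i, k)" "EH i k" "ED i k" y] by (auto simp: pos_pair)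
    next
      case 3
      then show ?thesis using Lo ik y that[of "(Suc i, k)" "EH i k" "EV (Suc i) k" y] by (auto simp: pos_pair)
    qed
  next
    case (Up i k)
    then have ik: "i < JJ" "k < KK" using assms by auto
    obtain y where y: "y \<in> vor (nsite (pt i k))" "y \<in> vor (nsite (pt i (Suc k)))" "y \<in> vor (nsite (pt (Suc i) (Suc k)))"
      using sq[OF ik] by auto
    consider "e = EV i k" | "e = EH i (Suc k)" | "e = ED i k" using assms Up by auto
    then show ?thesis
    proof cases
      case 1
      then show ?thesis using Up ik y that[of "(Suc i, Suc k)" "ED i k" "EH i (Suc k)" y] by (auto simp: pos_pair)
    next
      case 2
      then show ?thesis using Up ik y that[of "(i, k)" "EV i k" "ED i k" y] by (auto simp: pos_pair)
    next
      case 3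
      then show ?thesis using Up ik y that[of "(i, Suc k)" "EV i k" "EH i (Suc k)" y] by (auto simp: pos_pair)
    qed
  qed
qed

lemma edge_nodes: "G.valid_edge e \<Longrightarrow> edge_src e \<in> grid_nodes \<and> edge_dst e \<in> grid_nodes"
  by (cases e) auto

text \<open>The next face is not \<open>Outer\<close>, which was visited at the start, so it is a
  triangle, and guarding its third node turns one of its other edges into a door. Each continuation
  uses up a face; since faces never repeat, the chase can only end in capture.\<close>

lemma door_walk_captures:
  assumes "G.door_walk F E m" "F 0 = Outer" "door (edge_src (E m)) (edge_dst (E m)) C z"
  shows "force n adj 9 (\<lambda>_ _. False) C z"
  using assms
proof (induction "card {f. G.valid_face f} - m" arbitrary: F E m C z rule: less_induct)
  case less
  define e where "e = E m"
  define f where "f = F (Suc m)"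
  have dw: "\<And>l. l \<le> m \<Longrightarrow> G.valid_edge (E l) \<and> \<not> trivial_edge lab (edge_src (E l)) (edge_dst (E l)) \<and>
     G.sides (E l) = {F l, F (Suc l)} \<and> (0 < l \<longrightarrow> E l \<noteq> E (l - 1))"
    using less.prems(1) by (simp add: G.door_walk_def)
  have e: "G.valid_edge e" "G.sides e = {F m, f}" using dw[of m] by (auto simp: e_def f_def)
  have fv: "G.valid_face f" using G.sides_valid[OF e(1)] e(2) by auto
  have "f \<noteq> Outer"
  proof
    assume "f = Outer"
    then have "F (Suc m) = F 0" using less.prems(2) by (simp add: f_def)
    then show False using inj_onD[OF G.door_walk_inj[OF less.prems(1)], of "Suc m" 0] by simp
  qed
  moreover from this have "e \<in> G.face_edges f" using G.mem_face_edges_iff[OF e(1) fv] e(2) by simp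
  ultimately obtain u e1 e2 y where t: "u \<in> grid_nodes" "e1 \<in> G.face_edges f" "e2 \<in> G.face_edges f" "e1 \<noteq> e" "e2 \<noteq> e"
    "{edge_src e1, edge_dst e1} = {edge_src e, u}" "{edge_src e2, edge_dst e2} = {u, edge_dst e}"
    "edge_src e \<in> grid_nodes" "edge_dst e \<in> grid_nodes"
    "y \<in> vor (ct (edge_src e))" "y \<in> vor (ct (edge_dst e))" "y \<in> vor (ct u)"
    using triangle[OF fv] by metis
  have next_door: "force n adj 9 (\<lambda>_ _. False) C' z'"
    if e': "e' \<in> G.face_edges f" "e' \<noteq> e" "{edge_src e', edge_dst e'} = {v, w}" and d: "door v w C' z'" for e' v w C' z'
  proof -
    have ev: "G.valid_edge e'" using G.face_edges_valid[OF fv e'(1)] .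
    have "edge_src e' \<in> grid_nodes" "edge_dst e' \<in> grid_nodes" using edge_nodes[OF ev] by auto
    moreover have "v = edge_src e' \<and> w = edge_dst e' \<or> v = edge_dst e' \<and> w = edge_src e'"
      using e'(3) by (auto simp: doubleton_eq_iff)
    ultimately have d': "door (edge_src e') (edge_dst e') C' z'"
      using d door_sym[of "edge_dst e'" "edge_src e'" C' z'] by auto
    have "f \<in> G.sides e'" using G.mem_face_edges_iff[OF ev fv \<open>f \<noteq> Outer\<close>] e'(1) by simp
    then obtain g where g: "G.sides e' = {f, g}" using card_2_insert[OF G.card_sides[OF ev]] by blast
    define E' where "E' = E(Suc m := e')"
    define F' where "F' = F(Suc (Suc m) := g)"
    have "G.door_walk F' E' (Suc m)"
      unfolding G.door_walk_def
    proof (intro allI impI)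
      fix l assume l: "l \<le> Suc m"
      show "G.valid_edge (E' l) \<and> \<not> trivial_edge lab (edge_src (E' l)) (edge_dst (E' l)) \<and>
         G.sides (E' l) = {F' l, F' (Suc l)} \<and> (0 < l \<longrightarrow> E' l \<noteq> E' (l - 1))"
      proof (cases "l = Suc m")
        case True
        then show ?thesis using ev door_not_trivial[OF d'] g e'(2) by (simp add: E'_def F'_def f_def e_def)
      next
        case False
        then have "l \<le> m" "l - 1 \<noteq> Suc m" using l by auto
        then show ?thesis using dw[of l] False by (simp add: E'_def F'_def)
      qed
    qed
    moreover have "F' 0 = Outer" using less.prems by (simp add: F'_def)
    moreover have "door (edge_src (E' (Suc m))) (edge_dst (E' (Suc m))) C' z'" using d' by (simp add: E'_def)
    moreover have "card {f. G.valid_face f} - Suc m < card {f. G.valid_face f} - m"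
      using G.door_walk_bound[OF less.prems(1)] by simp
    ultimately show ?thesis using less.hyps by blast
  qed
  have "force n adj 9 (\<lambda>C z. door (edge_src e) u C z \<or> door u (edge_dst e) C z) C z"
    using t less.prems(3) by (intro door_step) (auto simp: e_def)
  then show ?case
  proof (rule force_trans)
    fix C z assume "door (edge_src e) u C z \<or> door u (edge_dst e) C z"
    then show "force n adj 9 (\<lambda>_ _. False) C z"
      using next_door[OF t(2,4,6)] next_door[OF t(3,5,7)] by blast
  qed
qed

lemma boundary_edge:
  assumes "t < BB"
  shows "G.valid_edge (be t)" "{edge_src (be t), edge_dst (be t)} = {bd t, bd (Suc t)}" "Outer \<in> G.sides (be t)"
  using assms by (cases rule: bd_cases; use JJ_pos KK_pos in force)+

lemma boundary_door_captures:
  assumes t: "t < BB" and d: "door (bd t) (bd (Suc t)) C z"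
  shows "force n adj 9 (\<lambda>_ _. False) C z"
proof -
  note b = boundary_edge[OF t]
  have "bd t = edge_src (be t) \<and> bd (Suc t) = edge_dst (be t) \<or> bd t = edge_dst (be t) \<and> bd (Suc t) = edge_src (be t)"
    using b(2) by (auto simp: doubleton_eq_iff)
  then have d': "door (edge_src (be t)) (edge_dst (be t)) C z"
    using d door_sym edge_nodes[OF b(1)] by metis
  obtain g where g: "G.sides (be t) = {Outer, g}"
    using card_2_insert[OF G.card_sides[OF b(1)] b(3)] by blast
  have "G.door_walk (\<lambda>l. if l = 0 then Outer else g) (\<lambda>_. be t) 0"
    using b g door_not_trivial[OF d'] by (simp add: G.door_walk_def)
  then show ?thesis by (rule door_walk_captures) (use d' in auto)
qed

text \<open>Two guarded geodesics and the boundary from \<open>bd t\<close> on. At the start this is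
  the whole boundary; it shrinks edge by edge until an edge cut off is a door.\<close>

definition arc :: "nat \<Rightarrow> (nat \<Rightarrow> nat) \<Rightarrow> nat \<Rightarrow> bool" where
  "arc t = enclosed (lab (bd t)) (bpath t) (lab (bd BB))"

text \<open>The junction \<open>y\<close> is one end of the boundary edge and also lies in the cell
  of the other end. By convexity the edge lies in that cell, where angles add up.\<close>

lemma arc_loop_split:
  assumes t: "t < BB" and z: "z < n" "und (lab (bd t)) z" "und (lab (bd (Suc t))) z"
    and y: "y \<in> {pos (bd t), pos (bd (Suc t))}" "y \<in> vor (ct (bd t))" "y \<in> vor (ct (bd (Suc t)))"
  shows "loop z (lab (bd t)) (bpath t) P = W z (lab (bd t)) y (lab (bd (Suc t))) + loop z (lab (bd (Suc t))) (bpath (Suc t)) P"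
proof -
  let ?P = "lab (bd t)" and ?P' = "lab (bd (Suc t))" and ?a = "pos (bd t)" and ?b = "pos (bd (Suc t))"
  have l: "geo ?P" "last ?P = ct (bd t)" "geo ?P'" "last ?P' = ct (bd (Suc t))"
    using lab bd_node t by auto
  obtain zs where zs: "bpath (Suc t) = ?b # zs" and "bpath t = ?a # ?b # zs"
    using bpath_Cons_Cons[OF t] .
  with zs have *: "loop z ?P (bpath t) P - loop z ?P' (bpath (Suc t)) P =
      pang (p z) (map p ?P) + ang (p z) (p (last ?P)) ?a + ang (p z) ?a ?b
      - ang (p z) (p (last ?P')) ?b - pang (p z) (map p ?P')"
    using zs by (simp add: loop_def)
  have in_vor: "?a \<in> vor (last ?P)" "?b \<in> vor (last ?P')" "p (last ?P) \<in> vor (last ?P)" "p (last ?P') \<in> vor (last ?P')"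
    "y \<in> vor (last ?P)" "y \<in> vor (last ?P')"
    using nsite site_in_vor l y by auto
  consider "y = ?b" | "y = ?a" using y by blast
  then show ?thesis
  proof cases
    case 1
    have "ang (p z) (p (last ?P)) ?a + ang (p z) ?a y = ang (p z) (p (last ?P)) y"
      using in_vor z l by (intro ang_vor) auto
    moreover have "ang (p z) y (p (last ?P')) = - ang (p z) (p (last ?P')) y"
      using in_vor z l by (intro ang_vor(2)[of z ?P']) auto
    ultimately show ?thesis using * 1 by (simp add: loop_def)
  next
    case 2
    have "ang (p z) y (p (last ?P')) + ang (p z) (p (last ?P')) ?b = ang (p z) y ?b"
      using in_vor z l by (intro ang_vor(1)[of z ?P']) auto
    then show ?thesis using * 2 by (simp add: loop_def)
  qed
qed

lemma arc_step:
  assumes t: "t < BB" and arc: "arc t C z"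
  shows "force n adj 9 (\<lambda>C z. door (bd t) (bd (Suc t)) C z \<or> arc (Suc t) C z) C z"
proof -
  have nd: "bd t \<in> grid_nodes" "bd (Suc t) \<in> grid_nodes" "bd BB \<in> grid_nodes" using bd_node t by auto
  note l = lab[OF nd(1)] lab[OF nd(2)] lab[OF nd(3)]
  obtain y where y: "y \<in> {pos (bd t), pos (bd (Suc t))}" "y \<in> vor (ct (bd t))" "y \<in> vor (ct (bd (Suc t)))"
    using unit_vor[OF bd_unit[OF t] nd(1,2)] .
  have "force n adj 9 (\<lambda>C z. enclosed (lab (bd t)) [y] (lab (bd (Suc t))) C z \<or>
      enclosed (lab (bd (Suc t))) (bpath (Suc t)) (lab (bd BB)) C z) C z"
    using arc bpath_props[OF less_imp_le[OF t]] bpath_avoids t l nsite arc_loop_split[OF t _ _ _ y]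
    by (intro enclosed_split) (auto simp: arc_def)
  then show ?thesis
    by (rule force_mono) (use y in \<open>auto simp: door_def arc_def\<close>)
qed

text \<open>At \<open>t = BB\<close> the arc is a single point between two copies of one geodesic
  and has winding number 0, so a door must turn up earlier unless the robber is caught.\<close>

lemma arc_captures: "t \<le> BB \<Longrightarrow> arc t C z \<Longrightarrow> force n adj 9 (\<lambda>_ _. False) C z"
proof (induction arbitrary: C z rule: inc_induct)
  case base
  then have e: "enclosed (lab (bd BB)) [pos (bd BB)] (lab (bd BB)) C z" by (simp add: arc_def bpath_BB)
  have "W z (lab (bd BB)) (pos (bd BB)) (lab (bd BB)) = 0"
    using enclosedD[OF e] lab[OF bd_node] nsite by (intro W_self) auto
  then show ?case using enclosedD(6)[OF e] by blast
next
  case (step t)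
  show ?case
    using arc_step[OF step(2) step.prems]
    by (rule force_trans) (use boundary_door_captures[OF step(2)] step.IH in blast)
qed

text \<open>The geodesic to the corner is guarded by two groups. In its loop with the whole boundary
  both copies cancel, and the angle of the boundary, seen from inside, is positive.\<close>

lemma force_capture:
  assumes "\<forall>i<9. C i < n" "z < n"
  shows "force n adj 9 (\<lambda>_ _. False) C z"
proof -
  let ?P = "lab (bd BB)"
  have b: "bd BB = bd 0" using bd_0 bd_BB by simp
  have l: "geo ?P" "last ?P = ct (bd BB)" using lab bd_node by auto
  have "guarding Map.empty C z" using assms by (simp add: guarding_def)
  then have "force n adj 9 (\<lambda>C z. guarding [0 \<mapsto> ?P] C z \<and> True) C z"
    using l by (intro force_guard) auto
  then show ?thesis
  proof (rule force_trans)
    fix C z assume "guarding [0 \<mapsto> ?P] C z \<and> True"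
    then have "force n adj 9 (\<lambda>C z. guarding ([0 \<mapsto> ?P, 1 \<mapsto> ?P]) C z \<and> True) C z"
      using l by (intro force_guard) auto
    then show "force n adj 9 (\<lambda>_ _. False) C z"
    proof (rule force_trans)
      fix C z assume h: "guarding [0 \<mapsto> ?P, 1 \<mapsto> ?P] C z \<and> True"
      then have g: "z < n" "und ?P z" using guardingD[of _ C z 1 ?P] by auto
      have "0 < pang (p z) (bpath 0)"
      proof -
        obtain zs where "bpath (Suc 0) = pos (bd (Suc 0)) # zs" "bpath 0 = pos (bd 0) # pos (bd (Suc 0)) # zs"
          using bpath_Cons_Cons[OF BB_pos] .
        then show ?thesis
          using bpath_pang[OF g(1), of "Suc 0"] ang_boundary(2)[OF g(1) BB_pos] BB_pos by simp
      qed
      moreover have "ang (p z) (pos (bd BB)) (p (last ?P)) = - ang (p z) (p (last ?P)) (pos (bd BB))"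
        using g l nsite site_in_vor by (intro ang_vor(2)[of z ?P]) auto
      ultimately have "loop z (lab (bd 0)) (bpath 0) ?P \<noteq> 0"
        using bpath_props(2,3)[of 0] b by (simp add: loop_def)
      then have "arc 0 C z" unfolding arc_def enclosed_def using h b by (intro exI[of _ 0] exI[of _ 1] conjI) auto
      then show "force n adj 9 (\<lambda>_ _. False) C z" by (rule arc_captures[rotated]) simp
    qed
  qed
qed

end

section \<open>The grid of a geometric graph\<close>

text \<open>Found by equating the distances of \<open>t\<close> to \<open>a\<close> and
  \<open>b\<close> and solving for \<open>Im t\<close>. If \<open>Im a = Im b\<close>, the bisector
  is vertical and \<open>bis_vert\<close> gives its abscissa.\<close>

definition bis_line :: "complex \<Rightarrow> complex \<Rightarrow> real \<times> real" where
  "bis_line a b = (- (Re a - Re b) / (Im a - Im b), - ((cmod b)\<^sup>2 - (cmod a)\<^sup>2) / (2 * (Im a - Im b)))"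

definition bis_vert :: "complex \<Rightarrow> complex \<Rightarrow> real" where
  "bis_vert a b = ((cmod a)\<^sup>2 - (cmod b)\<^sup>2) / (2 * (Re a - Re b))"

definition line_thru :: "complex \<Rightarrow> complex \<Rightarrow> real \<times> real" where
  "line_thru a b = ((Im b - Im a) / (Re b - Re a), Im a - (Im b - Im a) / (Re b - Re a) * Re a)"

text \<open>Distances compare like their squares, and in the difference of the squares the quadratic
  terms in \<open>t\<close> cancel.\<close>

lemma dist_diff_sgn:
  "sgn (dist t b - dist t a) = sgn (2 * (Re a - Re b) * Re t + 2 * (Im a - Im b) * Im t + ((cmod b)\<^sup>2 - (cmod a)\<^sup>2))"
proof -
  have "(dist t b)\<^sup>2 - (dist t a)\<^sup>2 =
      2 * (Re a - Re b) * Re t + 2 * (Im a - Im b) * Im t + ((cmod b)\<^sup>2 - (cmod a)\<^sup>2)"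
    unfolding dist_norm cmod_power2 by (simp add: power2_eq_square algebra_simps)
  moreover have "dist t a < dist t b \<longleftrightarrow> (dist t a)\<^sup>2 < (dist t b)\<^sup>2" "dist t b < dist t a \<longleftrightarrow> (dist t b)\<^sup>2 < (dist t a)\<^sup>2"
    using power_mono_iff[of "dist t a" "dist t b" 2] power_mono_iff[of "dist t b" "dist t a" 2]
    by (auto simp: not_le[symmetric] simp del: not_le)
  ultimately show ?thesis by (auto simp: sgn_real_def)
qed

lemma bisector_line:
  assumes "Im a \<noteq> Im b"
  shows "sgn (dist t b - dist t a) = sgn (Im a - Im b) * sgn (Im t - lv (bis_line a b) (Re t))"
proof -
  have "2 * (Re a - Re b) * Re t + 2 * (Im a - Im b) * Im t + ((cmod b)\<^sup>2 - (cmod a)\<^sup>2) =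
     2 * ((Im a - Im b) * (Im t - lv (bis_line a b) (Re t)))"
  proof -
    have *: "2 * (c * (y - (- A / c * x + - B / (2 * c)))) = 2 * A * x + 2 * c * y + B" if "c \<noteq> 0" for A B c x y :: real
      using that by (simp add: field_simps)
    show ?thesis unfolding lv_def bis_line_def fst_conv snd_conv by (rule *[symmetric]) (use assms in simp)
  qed
  then show ?thesis unfolding dist_diff_sgn by (simp add: sgn_mult)
qed

lemma bisector_vert:
  assumes "Im a = Im b" "Re a \<noteq> Re b"
  shows "sgn (dist t b - dist t a) = sgn (Re a - Re b) * sgn (Re t - bis_vert a b)"
proof -
  have "2 * (Re a - Re b) * Re t + 2 * (Im a - Im b) * Im t + ((cmod b)\<^sup>2 - (cmod a)\<^sup>2) =
     2 * ((Re a - Re b) * (Re t - bis_vert a b))"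
  proof -
    have *: "2 * (c * (x - B / (2 * c))) = 2 * c * x - B" if "c \<noteq> 0" for B c x :: real
      using that by (simp add: field_simps)
    show ?thesis using *[of "Re a - Re b"] assms unfolding bis_vert_def by simp
  qed
  then show ?thesis unfolding dist_diff_sgn by (simp add: sgn_mult)
qed

lemma closed_segment_slanted:
  assumes "Re a < Re b"
  shows "closed_segment a b = {t. Im t = lv (line_thru a b) (Re t) \<and> Re a \<le> Re t \<and> Re t \<le> Re b}"
proof (intro set_eqI iffI)
  fix t assume "t \<in> closed_segment a b"
  then obtain u where u: "0 \<le> u" "u \<le> 1" "t = (1 - u) *\<^sub>R a + u *\<^sub>R b" by (auto simp: closed_segment_def)
  have Re: "Re t = Re a + u * (Re b - Re a)" "Im t = Im a + u * (Im b - Im a)" unfolding u(3) by (simp_all add: algebra_simps)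
  have "0 \<le> u * (Re b - Re a)" "u * (Re b - Re a) \<le> 1 * (Re b - Re a)"
    using assms u by (auto intro: mult_right_mono)
  then have "Re a \<le> Re t" "Re t \<le> Re b" using Re by auto
  moreover have "Im t = lv (line_thru a b) (Re t)"
  proof -
    have *: "D / c * (\<alpha> + u * c) + (\<beta> - D / c * \<alpha>) = \<beta> + u * D" if "c \<noteq> 0" for D c \<alpha> \<beta> :: real
      using that by (simp add: field_simps)
    show ?thesis using *[of "Re b - Re a"] assms unfolding Re lv_def line_thru_def by simp
  qed
  ultimately show "t \<in> {t. Im t = lv (line_thru a b) (Re t) \<and> Re a \<le> Re t \<and> Re t \<le> Re b}" by simp
next
  fix t assume t: "t \<in> {t. Im t = lv (line_thru a b) (Re t) \<and> Re a \<le> Re t \<and> Re t \<le> Re b}"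
  define u where "u = (Re t - Re a) / (Re b - Re a)"
  have u: "0 \<le> u" "u \<le> 1" using t assms by (auto simp: u_def field_simps)
  have uR: "u * (Re b - Re a) = Re t - Re a" using assms by (simp add: u_def)
  have "Im t = Im a + u * (Im b - Im a)"
    using t unfolding u_def lv_def line_thru_def by (simp add: diff_divide_distrib algebra_simps)
  then have "t = (1 - u) *\<^sub>R a + u *\<^sub>R b" using uR by (intro complex_eqI) (auto simp: algebra_simps)
  then show "t \<in> closed_segment a b" using u by (auto simp: closed_segment_def)
qed

lemma closed_segment_upright:
  assumes "Re a = Re b" "Im a \<le> Im b"
  shows "closed_segment a b = {t. Re t = Re a \<and> Im a \<le> Im t \<and> Im t \<le> Im b}"
proof (intro set_eqI iffI)
  fix t assume "t \<in> closed_segment a b"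
  then obtain u where u: "0 \<le> u" "u \<le> 1" "t = (1 - u) *\<^sub>R a + u *\<^sub>R b" by (auto simp: closed_segment_def)
  have Im: "Im t = Im a + u * (Im b - Im a)" "Re t = Re a" unfolding u(3) using assms by (simp_all add: algebra_simps)
  have "0 \<le> u * (Im b - Im a)" "u * (Im b - Im a) \<le> 1 * (Im b - Im a)"
    using mult_right_mono[OF u(2), of "Im b - Im a"] assms u(1) by simp_all
  then show "t \<in> {t. Re t = Re a \<and> Im a \<le> Im t \<and> Im t \<le> Im b}" using Im by auto
next
  fix t assume t: "t \<in> {t. Re t = Re a \<and> Im a \<le> Im t \<and> Im t \<le> Im b}"
  then have "Im t \<in> closed_segment (Im a) (Im b)" using assms by (simp add: closed_segment_eq_real_ivl)
  then obtain u where u: "0 \<le> u" "u \<le> 1" "Im t = (1 - u) *\<^sub>R Im a + u *\<^sub>R Im b" by (auto simp: closed_segment_def)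
  then have "t = (1 - u) *\<^sub>R a + u *\<^sub>R b" using t assms by (intro complex_eqI) (auto simp: algebra_simps)
  then show "t \<in> closed_segment a b" using u by (auto simp: closed_segment_def)
qed

lemma sgn_cases:
  "sgn (x :: real) \<in> {0, 1} \<longleftrightarrow> 0 \<le> x" "sgn x \<in> {0, -1} \<longleftrightarrow> x \<le> 0" "sgn x \<in> {0} \<longleftrightarrow> x = 0"
  by (auto simp: sgn_real_def)

context geometric_graph
begin

definition sites :: "complex set" where "sites = p ` {..<n}"

text \<open>A pair with vanishing denominator contributes some further line, which merely refines
  the grid. The horizontal lines turn the vertices into nodes and cut out vertical segments.\<close>

definition grid_lines :: "(real \<times> real) set" where
  "grid_lines = (\<lambda>(a, b). bis_line a b) ` (sites \<times> sites) \<union> (\<lambda>(a, b). line_thru a b) ` (sites \<times> sites) \<union>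
     (\<lambda>a. (0, Im a)) ` sites"

text \<open>The shifts by 1 put columns to the left and to the right of all vertices.\<close>

definition grid_verts :: "real set" where
  "grid_verts = Re ` sites \<union> (\<lambda>(a, b). bis_vert a b) ` (sites \<times> sites) \<union>
     (\<lambda>a. Re a - 1) ` sites \<union> (\<lambda>a. Re a + 1) ` sites"

lemma arrangement_grid: "arrangement grid_lines grid_verts"
proof
  show "finite grid_lines" "finite grid_verts" by (auto simp: grid_lines_def grid_verts_def sites_def)
  have "{Re (p 0), Re (p 0) + 1} \<subseteq> grid_verts" using n_pos by (auto simp: grid_verts_def sites_def)
  then have "card {Re (p 0), Re (p 0) + 1} \<le> card grid_verts"
    using \<open>finite grid_verts\<close> by (intro card_mono)
  then show "2 \<le> card grid_verts" by simp
qed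

sublocale A: arrangement grid_lines grid_verts by (rule arrangement_grid)

text \<open>A slanted segment is cut out of its line by the vertical lines through its ends, a
  vertical one by horizontal lines.\<close>

lemma segment_prod:
  assumes ab: "a \<in> sites" "b \<in> sites" "a \<noteq> b"
  shows "A.is_prod (closed_segment a b)"
proof -
  have slanted: "A.is_prod (closed_segment a b)" if "a \<in> sites" "b \<in> sites" "Re a < Re b" for a b
  proof -
    have mem: "line_thru a b \<in> grid_lines" "Re a \<in> grid_verts" "Re b \<in> grid_verts"
      using that by (auto simp: grid_lines_def grid_verts_def)
    have "closed_segment a b = {t. A.sg (line_thru a b) t \<in> {0}} \<inter> ({t. A.sx (Re a) t \<in> {0, 1}} \<inter> {t. A.sx (Re b) t \<in> {0, -1}})"
      unfolding closed_segment_slanted[OF that(3)] A.sg_def A.sx_def sgn_cases by auto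
    then show ?thesis using mem A.is_prod_Int A.is_prod_line A.is_prod_vertical by metis
  qed
  have upright: "A.is_prod (closed_segment a b)" if "a \<in> sites" "b \<in> sites" "Re a = Re b" "Im a \<le> Im b" for a b
  proof -
    have mem: "(0, Im a) \<in> grid_lines" "(0, Im b) \<in> grid_lines" "Re a \<in> grid_verts"
      using that by (auto simp: grid_lines_def grid_verts_def)
    have "closed_segment a b = {t. A.sx (Re a) t \<in> {0}} \<inter> ({t. A.sg (0, Im a) t \<in> {0, 1}} \<inter> {t. A.sg (0, Im b) t \<in> {0, -1}})"
      unfolding closed_segment_upright[OF that(3,4)] A.sg_def A.sx_def sgn_cases by (auto simp: lv_def)
    then show ?thesis using mem A.is_prod_Int A.is_prod_line A.is_prod_vertical by metis
  qed
  consider "Re a < Re b" | "Re b < Re a" | "Re a = Re b" "Im a \<le> Im b" | "Re b = Re a" "Im b \<le> Im a" by linarith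
  then show ?thesis
    using slanted[of a b] slanted[of b a] upright[of a b] upright[of b a] ab
    by cases (simp_all add: closed_segment_commute)
qed

lemma geo_grid: "geo_grid n p r grid_lines grid_verts"
proof
  fix s v assume sv: "s < n" "v < n" "p s \<noteq> p v"
  then have S: "p s \<in> sites" "p v \<in> sites" by (auto simp: sites_def)
  show "A.is_prod (closed_segment (p s) (p v))" using segment_prod S sv(3) .
  show "(\<exists>l\<in>grid_lines. \<exists>\<sigma>\<in>{1, -1}. \<forall>t. sgn (dist t (p v) - dist t (p s)) = \<sigma> * A.sg l t) \<or>
      (\<exists>a\<in>grid_verts. \<exists>\<sigma>\<in>{1, -1}. \<forall>t. sgn (dist t (p v) - dist t (p s)) = \<sigma> * A.sx a t)"
  proof (cases "Im (p s) = Im (p v)")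
    case False
    have "bis_line (p s) (p v) \<in> grid_lines" using S by (auto simp: grid_lines_def)
    moreover have "sgn (Im (p s) - Im (p v)) \<in> {1, -1}" using False by (auto simp: sgn_real_def)
    ultimately show ?thesis using bisector_line[OF False] unfolding A.sg_def by blast
  next
    case True
    then have ne: "Re (p s) \<noteq> Re (p v)" using sv by (auto simp: complex_eq_iff)
    have "bis_vert (p s) (p v) \<in> grid_verts" using S by (auto simp: grid_verts_def)
    moreover have "sgn (Re (p s) - Re (p v)) \<in> {1, -1}" using ne by (auto simp: sgn_real_def)
    ultimately show ?thesis using bisector_vert[OF True ne] unfolding A.sx_def by blast
  qed
next
  fix s assume "s < n"
  then have S: "p s \<in> sites" by (auto simp: sites_def)
  then have "(0, Im (p s)) \<in> grid_lines" "Re (p s) \<in> grid_verts" "Re (p s) - 1 \<in> grid_verts" "Re (p s) + 1 \<in> grid_verts"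
    by (auto simp: grid_lines_def grid_verts_def)
  moreover have "Im (p s) = lv (0, Im (p s)) (Re (p s))" by (simp add: lv_def)
  ultimately show "Re (p s) \<in> grid_verts \<and> (\<exists>l\<in>grid_lines. Im (p s) = lv l (Re (p s)))"
    and "(\<exists>x\<in>grid_verts. x < Re (p s)) \<and> (\<exists>x\<in>grid_verts. Re (p s) < x)"
    by (blast, metis less_add_one diff_less_eq)
qed

lemma nine_cops_win: "cops_win n adj 9"
proof -
  interpret GG: geo_grid n p r grid_lines grid_verts by (rule geo_grid)
  obtain lab where lab: "\<forall>v\<in>{..2 * A.R} \<times> {..2 * A.N}. geo (lab v) \<and> last (lab v) = GG.nsite (A.pos v)"
    "\<forall>\<phi>::nat \<times> nat \<Rightarrow> bool.
       (\<forall>v\<in>{..2 * A.R} \<times> {..2 * A.N}. \<forall>w\<in>{..2 * A.R} \<times> {..2 * A.N}. A.unit_step v w \<longrightarrow> GG.trivial_edge lab v w \<longrightarrow> \<phi> v = \<phi> w) \<longrightarrow>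
       (\<forall>v\<in>{..2 * A.R} \<times> {..2 * A.N}. \<forall>w\<in>{..2 * A.R} \<times> {..2 * A.N}. \<phi> v = \<phi> w)"
    by (rule GG.labels_exist)
  interpret LG: labelled_grid n p r grid_lines grid_verts lab
    by unfold_locales (rule lab)+
  show ?thesis
    using n_pos LG.force_capture by (intro force_everywhere_imp_cops_win) auto
qed

end

theorem theorem3:
  fixes n :: nat and x :: "nat \<Rightarrow> real^2" and r :: real
  assumes "r > 0"
    and "graph_connected n (geom_adj x r)"
  shows "cop_number n (geom_adj x r) \<le> 9"
proof (cases "n = 0")
  case True
  \<comment> \<open>The robber has no vertex to stand on, so there is no play to be won.\<close>
  have "cops_win n (geom_adj x r) 0"
    using True by (auto simp: cops_win_def cop_strategy_def robber_play_def)
  then have "cop_number n (geom_adj x r) \<le> 0" unfolding cop_number_def by (rule Least_le)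
  then show ?thesis by simp
next
  case False
  define p where "p i = Complex (x i $ 1) (x i $ 2)" for i
  have "dist (p i) (p j) = dist (x i) (x j)" for i j
    by (simp add: p_def dist_norm cmod_def norm_vec_def L2_set_def sum_2)
  then have adj: "geom_adj x r = (\<lambda>i j. i \<noteq> j \<and> dist (p i) (p j) \<le> r)"
    by (intro ext) (simp add: geom_adj_def)
  interpret geometric_graph n p r
    by unfold_locales (use assms False in \<open>auto simp: adj\<close>)
  have "cops_win n (geom_adj x r) 9" unfolding adj by (rule nine_cops_win)
  then show ?thesis unfolding cop_number_def by (rule Least_le)
qed

end
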